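(* Let $(A,M,a)$ be a Lie algebroid of rank $n$ over a manifold $M$ and let $\mathcal{A}=\bigoplus_i\Gamma(\wedge^iA)$ be its associated Gerstenhaber algebra. Then there exists a one-to-one correspondence between $A$-connections on the line bundle $\wedge^nA$ and linear operators $\widetilde D$ generating the Gerstenhaber algebra bracket (Gerstenhaber generators), namely the one associating to an $A$-connection $\nabla$ the Gerstenhaber generator $\widetilde D$ associated to $\nabla$. Under this correspondence, flat connections correspond to BV-generators on $\mathcal{A}$.
   Context: A Lie algebroid $(A,M,a)$ is a real vector bundle $A\to M$ with anchor $a:A\to TM$ and a Lie bracket $[\,,]$ on $\Gamma(A)$ satisfying $[X,fY]=f[X,Y]+(a(X)f)Y$. Its associated Gerstenhaber algebra is $\big(\mathcal{A}=\bigoplus_{i\ge0}\mathcal{A}^i,\wedge,[\,,]\big)$ with $\mathcal{A}^i=\Gamma(\wedge^iA)$, $\mathcal{A}^0=C^\infty(M)$, and $[\,,]$ the generalized Schouten bracket, i.e. the degree $-1$ super-Lie bracket with $[X,f]=a(X)f$, $[a,b]=-(-1)^{(|a|-1)(|b|-1)}[b,a]$ and $[a,b\wedge c]=[a,b]\wedge c+(-1)^{(|a|-1)|b|}b\wedge[a,c]$, extending the bracket of $\Gamma(A)$. For $X\in\Gamma(A)$, the Lie derivative on $\Gamma(\wedge^nA)$ is $L_X\Lambda=[X,\Lambda]$. A Gerstenhaber generator is a linear operator $D:\mathcal{A}\to\mathcal{A}$ of degree $-1$ such that $[a,b]=(-1)^{|a|}\big(D(a\wedge b)-Da\wedge b-(-1)^{|a|}a\wedge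 Db\big)$ for all $a\in\mathcal{A}^{|a|}$, $b\in\mathcal{A}$. A BV-generator is a Gerstenhaber generator with $D^2=0$. An $A$-connection on a vector bundle $E\to M$ is an $\mathbb{R}$-linear map $\nabla:\Gamma(A)\otimes\Gamma(E)\to\Gamma(E)$, $X\otimes s\mapsto\nabla_Xs$, with $\nabla_{fX}s=f\nabla_Xs$ and $\nabla_X(fs)=(a(X)f)s+f\nabla_Xs$ for $f\in C^\infty(M)$. It is flat if its curvature $R(X,Y)=\nabla_X\nabla_Y-\nabla_Y\nabla_X-\nabla_{[X,Y]}$ vanishes for all $X,Y\in\Gamma(A)$. The Gerstenhaber generator $\widetilde D$ associated to an $A$-connection $\nabla$ on $\wedge^nA$ is the unique Gerstenhaber generator extending the operator $D$ defined on $C^\infty(M)\oplus\Gamma(A)$ by $Df=0$ for $f\in C^\infty(M)$ and, for $X\in\Gamma(A)$, by letting $DX\in C^\infty(M)$ be the function with $(DX)\Lambda=L_X\Lambda-\nabla_X\Lambda$ for all $\Lambda\in\Gamma(\wedge^nA)$. Explicitly, $\widetilde D(a\wedge b)=(-1)^{|a|}[a,b]+\widetilde Da\wedge b+(-1)^{|a|}a\wedge\widetilde Db$. *)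

theory Defs
  imports "HOL-Analysis.Analysis" "HOL-Library.Function_Algebras" "HOL-Library.FuncSet"
begin

section \<open>Pointwise vector space structure on functions\<close>

text \<open>Addition on function types comes from Function Algebras (HOL-Library).\<close>

instantiation "fun" :: (type, real_vector) real_vector
begin

definition scaleR_fun_def: "c *\<^sub>R f = (\<lambda>x. c *\<^sub>R f x)"

instance
  by standard (auto simp: scaleR_fun_def plus_fun_def scaleR_add_right scaleR_add_left)

end

definition linear_on_subspace ::
    "'a::real_vector set \<Rightarrow> ('a \<Rightarrow> 'b::real_vector) \<Rightarrow> bool" where
  "linear_on_subspace V f \<longleftrightarrow>
     (\<forall>u\<in>V. \<forall>v\<in>V. f (u + v) = f u + f v) \<and> (\<forall>c. \<forall>u\<in>V. f (c *\<^sub>R u) = c *\<^sub>R f u)"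

definition bilinear_on_subspaces ::
    "'a::real_vector set \<Rightarrow> 'b::real_vector set \<Rightarrow> ('a \<Rightarrow> 'b \<Rightarrow> 'c::real_vector) \<Rightarrow> bool" where
  "bilinear_on_subspaces V W f \<longleftrightarrow>
     (\<forall>v\<in>V. linear_on_subspace W (f v)) \<and> (\<forall>w\<in>W. linear_on_subspace V (\<lambda>v. f v w))"

definition is_basis_of :: "'a::real_vector set \<Rightarrow> 'a list \<Rightarrow> bool" where
  "is_basis_of V bs \<longleftrightarrow> distinct bs \<and> \<not> dependent (set bs) \<and> span (set bs) = V"


section \<open>Smooth manifolds\<close>

text \<open>On an open subset of a finite-dimensional space, \<open>Ck_on k f S\<close> is k-fold continuous
  differentiability, phrased by iterated directional derivatives.\<close>

primrec Ck_on :: "nat \<Rightarrow> ('a::real_normed_vector \<Rightarrow> 'b::real_normed_vector) \<Rightarrow> 'a set \<Rightarrow> bool" where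
  "Ck_on 0 f S = continuous_on S f"
| "Ck_on (Suc k) f S =
     ((\<forall>x\<in>S. f differentiable (at x)) \<and> (\<forall>v. Ck_on k (\<lambda>x. frechet_derivative f (at x) v) S))"

definition smooth_on :: "'a::real_normed_vector set \<Rightarrow> ('a \<Rightarrow> 'b::real_normed_vector) \<Rightarrow> bool" where
  "smooth_on S f \<longleftrightarrow> (\<forall>k. Ck_on k f S)"

text \<open>The points of the manifold are the elements of a topological type \<open>'m\<close>, and its charts
  \<open>(U, \<phi>)\<close> take values in a real inner product space \<open>'e\<close> that is required to be
  finite-dimensional. The class \<open>euclidean_space\<close> is not used because it would exclude manifolds
  of dimension 0, hence Lie algebras.\<close>

type_synonym ('m, 'e) atlas = "('m set \<times> ('m \<Rightarrow> 'e)) set"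

definition is_chart :: "'m::topological_space set \<Rightarrow> ('m \<Rightarrow> 'e::real_inner) \<Rightarrow> bool" where
  "is_chart U \<phi> \<longleftrightarrow> open U \<and> open (\<phi> ` U) \<and> (\<exists>\<psi>. homeomorphism U (\<phi> ` U) \<phi> \<psi>)"

definition smooth_manifold ::
    "('m::{t2_space,second_countable_topology}, 'e::real_inner) atlas \<Rightarrow> bool" where
  "smooth_manifold M \<longleftrightarrow>
     (\<exists>B. finite B \<and> span B = (UNIV :: 'e set)) \<and>
     (\<forall>(U, \<phi>)\<in>M. is_chart U \<phi>) \<and>
     (\<Union>(U, \<phi>)\<in>M. U) = UNIV \<and>
     (\<forall>(U, \<phi>)\<in>M. \<forall>(V, \<psi>)\<in>M. smooth_on (\<phi> ` (U \<inter> V)) (\<psi> \<circ> inv_into U \<phi>))"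

definition smooth_fun_on ::
    "('m, 'e::real_inner) atlas \<Rightarrow> 'm set \<Rightarrow> ('m \<Rightarrow> real) \<Rightarrow> bool" where
  "smooth_fun_on M W f \<longleftrightarrow> (\<forall>(U, \<phi>)\<in>M. smooth_on (\<phi> ` (U \<inter> W)) (f \<circ> inv_into U \<phi>))"

definition smooth_funs :: "('m, 'e::real_inner) atlas \<Rightarrow> ('m \<Rightarrow> real) set" where
  "smooth_funs M = {f. smooth_fun_on M UNIV f}"


section \<open>Vector bundles\<close>

text \<open>A vector bundle is a family of subspaces \<open>fibre E x\<close> of some real vector space, together
  with a set of local trivialisations. A trivialisation over \<open>U\<close> is given as a pair \<open>(U, es)\<close>,
  where \<open>es\<close> is the corresponding frame, i.e. a list of local sections whose values at each
  \<open>x \<in> U\<close> form a basis of the fibre. The ambient vector space only serves to host the fibres: its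
  topology plays no role, and the smooth structure is given by the frames.\<close>

record ('m, 'v) vbundle =
  fibre :: "'m \<Rightarrow> 'v set"
  frames :: "('m set \<times> ('m \<Rightarrow> 'v) list) set"

definition sections_on ::
    "('m, 'e::real_inner) atlas \<Rightarrow> ('m, 'v::real_vector, 'z) vbundle_scheme \<Rightarrow> 'm set \<Rightarrow> ('m \<Rightarrow> 'v) set"
  where
  "sections_on M E W =
     {s. (\<forall>x\<in>W. s x \<in> fibre E x) \<and>
         (\<forall>(U, es)\<in>frames E. \<exists>c :: nat \<Rightarrow> 'm \<Rightarrow> real.
            (\<forall>i<length es. smooth_fun_on M (U \<inter> W) (c i)) \<and>
            (\<forall>x\<in>U \<inter> W. s x = (\<Sum>i<length es. c i x *\<^sub>R (es ! i) x)))}"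

abbreviation sections where "sections M E \<equiv> sections_on M E UNIV"

text \<open>The last condition below is the smoothness of the transition functions.\<close>

definition vector_bundle ::
    "('m::topological_space, 'e::real_inner) atlas \<Rightarrow> nat \<Rightarrow> ('m, 'v::real_vector, 'z) vbundle_scheme
      \<Rightarrow> bool" where
  "vector_bundle M n E \<longleftrightarrow>
     (\<forall>x. subspace (fibre E x)) \<and>
     (\<Union>(U, es)\<in>frames E. U) = UNIV \<and>
     (\<forall>(U, es)\<in>frames E. open U \<and> length es = n \<and>
        (\<forall>x\<in>U. is_basis_of (fibre E x) (map (\<lambda>e. e x) es)) \<and>
        (\<forall>e\<in>set es. e \<in> sections_on M E U))"

definition fun_mult :: "('m \<Rightarrow> real) \<Rightarrow> ('m \<Rightarrow> 'v::real_vector) \<Rightarrow> ('m \<Rightarrow> 'v)"  (infixr \<open>\<odot>\<close> 75) where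
  "f \<odot> s = (\<lambda>x. f x *\<^sub>R s x)"

text \<open>Smooth bundle maps over the identity of the base: fibrewise linear, with smooth matrix
  entries in local trivialisations.\<close>

definition bundle_map ::
    "('m, 'e::real_inner) atlas \<Rightarrow> ('m, 'v::real_vector, 'y) vbundle_scheme
      \<Rightarrow> ('m, 'w::real_vector, 'z) vbundle_scheme \<Rightarrow> ('m \<Rightarrow> 'v \<Rightarrow> 'w) \<Rightarrow> bool" where
  "bundle_map M E F h \<longleftrightarrow>
     (\<forall>x. linear_on_subspace (fibre E x) (h x) \<and> h x ` fibre E x \<subseteq> fibre F x) \<and>
     (\<forall>(U, es)\<in>frames E. \<forall>e\<in>set es. (\<lambda>x. h x (e x)) \<in> sections_on M F U)"


section \<open>The tangent bundle\<close>

text \<open>Tangent vectors at \<open>p\<close> are derivations at \<open>p\<close> of the algebra of smooth functions; they take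
  the value 0 on non-smooth functions, so that a derivation is determined by its values on
  smooth functions.\<close>

definition tangent_space :: "('m, 'e::real_inner) atlas \<Rightarrow> 'm \<Rightarrow> (('m \<Rightarrow> real) \<Rightarrow> real) set" where
  "tangent_space M p =
     {v. linear_on_subspace (smooth_funs M) v \<and>
         (\<forall>f\<in>smooth_funs M. \<forall>g\<in>smooth_funs M. v (\<lambda>x. f x * g x) = f p * v g + v f * g p) \<and>
         (\<forall>f. f \<notin> smooth_funs M \<longrightarrow> v f = 0)}"

definition coord_vector ::
    "('m, 'e::real_inner) atlas \<Rightarrow> 'm set \<Rightarrow> ('m \<Rightarrow> 'e) \<Rightarrow> 'e \<Rightarrow> 'm \<Rightarrow> ('m \<Rightarrow> real) \<Rightarrow> real" where
  "coord_vector M U \<phi> b p =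
     (\<lambda>f. if f \<in> smooth_funs M
          then frechet_derivative (f \<circ> inv_into U \<phi>) (at (\<phi> p)) b else 0)"

definition tangent_bundle ::
    "('m, 'e::real_inner) atlas \<Rightarrow> ('m, ('m \<Rightarrow> real) \<Rightarrow> real) vbundle" where
  "tangent_bundle M =
     \<lparr> fibre = tangent_space M,
       frames = {(U, map (coord_vector M U \<phi>) bs) | U \<phi> bs. (U, \<phi>) \<in> M \<and> is_basis_of UNIV bs} \<rparr>"


section \<open>Exterior powers\<close>

text \<open>For a finite-dimensional subspace \<open>V\<close>, the k-th exterior power of \<open>V\<close> is realised as the
  space of alternating k-linear forms on the dual of \<open>V\<close>. A form takes a list of covectors as
  argument, and a k-form vanishes on lists of length other than k; therefore the exterior powers
  of all degrees live in one type and form there an internal direct sum, the exterior algebra.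
  Covectors and forms are extended by 0 outside their proper domains.\<close>

type_synonym 'v ext = "('v \<Rightarrow> real) list \<Rightarrow> real"

definition dual_space :: "'v::real_vector set \<Rightarrow> ('v \<Rightarrow> real) set" where
  "dual_space V = {\<xi>. linear_on_subspace V \<xi> \<and> (\<forall>v. v \<notin> V \<longrightarrow> \<xi> v = 0)}"

definition ext_power_space :: "nat \<Rightarrow> 'v::real_vector set \<Rightarrow> 'v ext set" where
  "ext_power_space k V =
     {\<omega>. (\<forall>\<xi>s. \<not> (length \<xi>s = k \<and> set \<xi>s \<subseteq> dual_space V) \<longrightarrow> \<omega> \<xi>s = 0) \<and>
         (\<forall>\<xi>s i. length \<xi>s = k \<and> set \<xi>s \<subseteq> dual_space V \<and> i < k \<longrightarrow>
            linear_on_subspace (dual_space V) (\<lambda>\<xi>. \<omega> (\<xi>s[i := \<xi>]))) \<and>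
         (\<forall>\<xi>s. \<not> distinct \<xi>s \<longrightarrow> \<omega> \<xi>s = 0)}"

text \<open>The sign of the shuffle that moves the positions in \<open>S\<close> to the front.\<close>

definition shuffle_sign :: "nat set \<Rightarrow> real" where
  "shuffle_sign S = (-1) ^ card {(i, j). i \<in> S \<and> j \<notin> S \<and> j < i}"

text \<open>Sum over shuffles, without factorials: \<open>v \<wedge> w\<close> maps \<open>[\<xi>, \<eta>]\<close> to \<open>\<xi> v * \<eta> w - \<eta> v * \<xi> w\<close>.\<close>

definition ext_wedge :: "'v ext \<Rightarrow> 'v ext \<Rightarrow> 'v ext" where
  "ext_wedge \<alpha> \<beta> =
     (\<lambda>\<xi>s. \<Sum>S\<in>Pow {..<length \<xi>s}. shuffle_sign S * \<alpha> (nths \<xi>s S) * \<beta> (nths \<xi>s (- S)))"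

definition ext_one :: "'v ext" where
  "ext_one = (\<lambda>\<xi>s. if \<xi>s = [] then 1 else 0)"

definition ext_vec :: "'v::real_vector set \<Rightarrow> 'v \<Rightarrow> 'v ext" where
  "ext_vec V v =
     (\<lambda>\<xi>s. if length \<xi>s = 1 \<and> set \<xi>s \<subseteq> dual_space V then (hd \<xi>s) v else 0)"

definition wedge_list :: "'v::real_vector set \<Rightarrow> 'v list \<Rightarrow> 'v ext" where
  "wedge_list V vs = foldr (\<lambda>v. ext_wedge (ext_vec V v)) vs ext_one"

text \<open>A frame \<open>e\<^sub>1, \<dots>, e\<^sub>n\<close> of \<open>E\<close> induces the frame of the k-th exterior power formed by the products
  \<open>e\<^bsub>i\<^sub>1\<^esub> \<wedge> \<dots> \<wedge> e\<^bsub>i\<^sub>k\<^esub>\<close> with \<open>i\<^sub>1 < \<dots> < i\<^sub>k\<close>.\<close>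

definition ext_power ::
    "nat \<Rightarrow> ('m, 'v::real_vector, 'z) vbundle_scheme \<Rightarrow> ('m, 'v ext) vbundle" where
  "ext_power k E =
     \<lparr> fibre = (\<lambda>x. ext_power_space k (fibre E x)),
       frames = {(U, map (\<lambda>ss x. wedge_list (fibre E x) (map (\<lambda>s. s x) ss))
                       (filter (\<lambda>ss. length ss = k) (subseqs es))) | U es. (U, es) \<in> frames E} \<rparr>"


section \<open>Lie algebroids\<close>

record ('m, 'v) algebroid = "('m, 'v) vbundle" +
  anchor :: "'m \<Rightarrow> 'v \<Rightarrow> ('m \<Rightarrow> real) \<Rightarrow> real"
  bracket :: "('m \<Rightarrow> 'v) \<Rightarrow> ('m \<Rightarrow> 'v) \<Rightarrow> ('m \<Rightarrow> 'v)"

text \<open>The action of the vector field \<open>a(X)\<close> on functions.\<close>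

definition anchor_act ::
    "('m, 'v) algebroid \<Rightarrow> ('m \<Rightarrow> 'v) \<Rightarrow> ('m \<Rightarrow> real) \<Rightarrow> ('m \<Rightarrow> real)" where
  "anchor_act A X f = (\<lambda>x. anchor A x (X x) f)"

definition lie_algebroid ::
    "('m::{t2_space,second_countable_topology}, 'e::real_inner) atlas \<Rightarrow> nat
      \<Rightarrow> ('m, 'v::real_vector) algebroid \<Rightarrow> bool" where
  "lie_algebroid M n A \<longleftrightarrow>
     vector_bundle M n A \<and>
     bundle_map M A (tangent_bundle M) (anchor A) \<and>
     (\<forall>X\<in>sections M A. \<forall>Y\<in>sections M A. bracket A X Y \<in> sections M A) \<and>
     bilinear_on_subspaces (sections M A) (sections M A) (bracket A) \<and>
     (\<forall>X\<in>sections M A. \<forall>Y\<in>sections M A. bracket A X Y = - bracket A Y X) \<and>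
     (\<forall>X\<in>sections M A. \<forall>Y\<in>sections M A. \<forall>Z\<in>sections M A.
        bracket A X (bracket A Y Z) + bracket A Y (bracket A Z X) + bracket A Z (bracket A X Y) = 0) \<and>
     (\<forall>X\<in>sections M A. \<forall>Y\<in>sections M A. \<forall>f\<in>smooth_funs M.
        bracket A X (f \<odot> Y) = f \<odot> bracket A X Y + anchor_act A X f \<odot> Y)"


section \<open>The associated Gerstenhaber algebra\<close>

text \<open>Degrees are integers, with zero homogeneous components in negative degree, so that
  "degree \<open>-1\<close>" needs no case distinctions.\<close>

definition multivec ::
    "('m, 'e::real_inner) atlas \<Rightarrow> ('m, 'v::real_vector) algebroid \<Rightarrow> int \<Rightarrow> ('m \<Rightarrow> 'v ext) set" where
  "multivec M A k = (if k < 0 then {0} else sections M (ext_power (nat k) A))"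

definition multivecs ::
    "('m, 'e::real_inner) atlas \<Rightarrow> ('m, 'v::real_vector) algebroid \<Rightarrow> ('m \<Rightarrow> 'v ext) set" where
  "multivecs M A = {(\<Sum>i<N. s i) | N s. \<forall>i<N. s i \<in> multivec M A (int i)}"

definition wedge :: "('m \<Rightarrow> 'v ext) \<Rightarrow> ('m \<Rightarrow> 'v ext) \<Rightarrow> ('m \<Rightarrow> 'v ext)"  (infixr \<open>\<and>\<^sub>w\<close> 75) where
  "a \<and>\<^sub>w b = (\<lambda>x. ext_wedge (a x) (b x))"

text \<open>The identifications of functions with multivectors of degree 0 and of sections of \<open>A\<close> with
  multivectors of degree 1.\<close>

definition of_fun :: "('m \<Rightarrow> real) \<Rightarrow> ('m \<Rightarrow> 'v ext)" where
  "of_fun f = (\<lambda>x. f x *\<^sub>R ext_one)"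

definition of_section ::
    "('m, 'v::real_vector) algebroid \<Rightarrow> ('m \<Rightarrow> 'v) \<Rightarrow> ('m \<Rightarrow> 'v ext)" where
  "of_section A X = (\<lambda>x. ext_vec (fibre A x) (X x))"

definition koszul_sign :: "int \<Rightarrow> real" where
  "koszul_sign k = (if even k then 1 else -1)"

text \<open>\<open>schouten_bracket M A br\<close>: \<open>br\<close> is the generalized Schouten bracket of the Lie algebroid \<open>A\<close>.
  On \<open>multivecs M A\<close> these properties determine \<open>br\<close> uniquely.\<close>

definition schouten_bracket ::
    "('m, 'e::real_inner) atlas \<Rightarrow> ('m, 'v::real_vector) algebroid
      \<Rightarrow> (('m \<Rightarrow> 'v ext) \<Rightarrow> ('m \<Rightarrow> 'v ext) \<Rightarrow> ('m \<Rightarrow> 'v ext)) \<Rightarrow> bool" where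
  "schouten_bracket M A br \<longleftrightarrow>
     bilinear_on_subspaces (multivecs M A) (multivecs M A) br \<and>
     (\<forall>p q. \<forall>a\<in>multivec M A p. \<forall>b\<in>multivec M A q. br a b \<in> multivec M A (p + q - 1)) \<and>
     (\<forall>p q. \<forall>a\<in>multivec M A p. \<forall>b\<in>multivec M A q.
        br a b = - (koszul_sign ((p - 1) * (q - 1)) *\<^sub>R br b a)) \<and>
     (\<forall>p q r. \<forall>a\<in>multivec M A p. \<forall>b\<in>multivec M A q. \<forall>c\<in>multivec M A r.
        br a (br b c) = br (br a b) c + koszul_sign ((p - 1) * (q - 1)) *\<^sub>R br b (br a c)) \<and>
     (\<forall>p q r. \<forall>a\<in>multivec M A p. \<forall>b\<in>multivec M A q. \<forall>c\<in>multivec M A r.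
        br a (b \<and>\<^sub>w c) = br a b \<and>\<^sub>w c + koszul_sign ((p - 1) * q) *\<^sub>R (b \<and>\<^sub>w br a c)) \<and>
     (\<forall>X\<in>sections M A. \<forall>f\<in>smooth_funs M.
        br (of_section A X) (of_fun f) = of_fun (anchor_act A X f)) \<and>
     (\<forall>X\<in>sections M A. \<forall>Y\<in>sections M A.
        br (of_section A X) (of_section A Y) = of_section A (bracket A X Y))"

definition lie_deriv ::
    "(('m \<Rightarrow> 'v ext) \<Rightarrow> ('m \<Rightarrow> 'v ext) \<Rightarrow> ('m \<Rightarrow> 'v ext)) \<Rightarrow> ('m, 'v::real_vector) algebroid
      \<Rightarrow> ('m \<Rightarrow> 'v) \<Rightarrow> ('m \<Rightarrow> 'v ext) \<Rightarrow> ('m \<Rightarrow> 'v ext)" where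
  "lie_deriv br A X \<Lambda> = br (of_section A X) \<Lambda>"


section \<open>Connections and generators\<close>

text \<open>Connections and generators are extensional functions, so that equality of connections, or of
  generators, is equality on their actual domains.\<close>

definition connections ::
    "('m, 'e::real_inner) atlas \<Rightarrow> ('m, 'v::real_vector) algebroid
      \<Rightarrow> ('m, 'w::real_vector, 'z) vbundle_scheme \<Rightarrow> (('m \<Rightarrow> 'v) \<Rightarrow> ('m \<Rightarrow> 'w) \<Rightarrow> ('m \<Rightarrow> 'w)) set"
  where
  "connections M A E =
     {nabla. nabla \<in> (\<Pi>\<^sub>E X\<in>sections M A. \<Pi>\<^sub>E s\<in>sections M E. sections M E) \<and>
        bilinear_on_subspaces (sections M A) (sections M E) nabla \<and>
        (\<forall>f\<in>smooth_funs M. \<forall>X\<in>sections M A. \<forall>s\<in>sections M E.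
           nabla (f \<odot> X) s = f \<odot> nabla X s \<and>
           nabla X (f \<odot> s) = anchor_act A X f \<odot> s + f \<odot> nabla X s)}"

definition curvature ::
    "('m, 'v) algebroid \<Rightarrow> (('m \<Rightarrow> 'v) \<Rightarrow> ('m \<Rightarrow> 'w::real_vector) \<Rightarrow> ('m \<Rightarrow> 'w))
      \<Rightarrow> ('m \<Rightarrow> 'v) \<Rightarrow> ('m \<Rightarrow> 'v) \<Rightarrow> ('m \<Rightarrow> 'w) \<Rightarrow> ('m \<Rightarrow> 'w)" where
  "curvature A nabla X Y s = nabla X (nabla Y s) - nabla Y (nabla X s) - nabla (bracket A X Y) s"

definition flat ::
    "('m, 'e::real_inner) atlas \<Rightarrow> ('m, 'v::real_vector) algebroid
      \<Rightarrow> ('m, 'w::real_vector, 'z) vbundle_scheme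
      \<Rightarrow> (('m \<Rightarrow> 'v) \<Rightarrow> ('m \<Rightarrow> 'w) \<Rightarrow> ('m \<Rightarrow> 'w)) \<Rightarrow> bool" where
  "flat M A E nabla \<longleftrightarrow>
     (\<forall>X\<in>sections M A. \<forall>Y\<in>sections M A. \<forall>s\<in>sections M E. curvature A nabla X Y s = 0)"

definition gerstenhaber_generators ::
    "('m, 'e::real_inner) atlas \<Rightarrow> ('m, 'v::real_vector) algebroid
      \<Rightarrow> (('m \<Rightarrow> 'v ext) \<Rightarrow> ('m \<Rightarrow> 'v ext) \<Rightarrow> ('m \<Rightarrow> 'v ext))
      \<Rightarrow> (('m \<Rightarrow> 'v ext) \<Rightarrow> ('m \<Rightarrow> 'v ext)) set" where
  "gerstenhaber_generators M A br =
     {D. D \<in> (\<Pi>\<^sub>E a\<in>multivecs M A. multivecs M A) \<and>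
        linear_on_subspace (multivecs M A) D \<and>
        (\<forall>p. \<forall>a\<in>multivec M A p. D a \<in> multivec M A (p - 1)) \<and>
        (\<forall>p. \<forall>a\<in>multivec M A p. \<forall>b\<in>multivecs M A.
           br a b = koszul_sign p *\<^sub>R (D (a \<and>\<^sub>w b) - D a \<and>\<^sub>w b - koszul_sign p *\<^sub>R (a \<and>\<^sub>w D b)))}"

definition BV_generators ::
    "('m, 'e::real_inner) atlas \<Rightarrow> ('m, 'v::real_vector) algebroid
      \<Rightarrow> (('m \<Rightarrow> 'v ext) \<Rightarrow> ('m \<Rightarrow> 'v ext) \<Rightarrow> ('m \<Rightarrow> 'v ext))
      \<Rightarrow> (('m \<Rightarrow> 'v ext) \<Rightarrow> ('m \<Rightarrow> 'v ext)) set" where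
  "BV_generators M A br =
     {D \<in> gerstenhaber_generators M A br. \<forall>a\<in>multivecs M A. D (D a) = 0}"

text \<open>\<open>D\<close> is a Gerstenhaber generator extending the operator that a connection \<open>nabla\<close> on the top
  exterior power defines on functions and on sections of \<open>A\<close>.\<close>

definition generator_of_connection ::
    "('m, 'e::real_inner) atlas \<Rightarrow> nat \<Rightarrow> ('m, 'v::real_vector) algebroid
      \<Rightarrow> (('m \<Rightarrow> 'v ext) \<Rightarrow> ('m \<Rightarrow> 'v ext) \<Rightarrow> ('m \<Rightarrow> 'v ext))
      \<Rightarrow> (('m \<Rightarrow> 'v) \<Rightarrow> ('m \<Rightarrow> 'v ext) \<Rightarrow> ('m \<Rightarrow> 'v ext))
      \<Rightarrow> (('m \<Rightarrow> 'v ext) \<Rightarrow> ('m \<Rightarrow> 'v ext)) \<Rightarrow> bool" where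
  "generator_of_connection M n A br nabla D \<longleftrightarrow>
     D \<in> gerstenhaber_generators M A br \<and>
     (\<forall>f\<in>smooth_funs M. D (of_fun f) = 0) \<and>
     (\<forall>X\<in>sections M A. \<exists>g\<in>smooth_funs M. D (of_section A X) = of_fun g \<and>
        (\<forall>\<Lambda>\<in>sections M (ext_power n A). g \<odot> \<Lambda> = lie_deriv br A X \<Lambda> - nabla X \<Lambda>))"

text \<open>Meaningful once existence and uniqueness of such a \<open>D\<close> are known.\<close>

definition associated_generator ::
    "('m, 'e::real_inner) atlas \<Rightarrow> nat \<Rightarrow> ('m, 'v::real_vector) algebroid
      \<Rightarrow> (('m \<Rightarrow> 'v ext) \<Rightarrow> ('m \<Rightarrow> 'v ext) \<Rightarrow> ('m \<Rightarrow> 'v ext))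
      \<Rightarrow> (('m \<Rightarrow> 'v) \<Rightarrow> ('m \<Rightarrow> 'v ext) \<Rightarrow> ('m \<Rightarrow> 'v ext))
      \<Rightarrow> (('m \<Rightarrow> 'v ext) \<Rightarrow> ('m \<Rightarrow> 'v ext))" where
  "associated_generator M n A br nabla = (THE D. generator_of_connection M n A br nabla D)"

end

theory Submission
  imports Defs
begin

text \<open>
  Let \<open>\<Lambda>\<close> be a section of the top exterior power and \<open>X\<close> a section of \<open>A\<close>. The Lie derivative
  \<open>L\<^sub>X \<Lambda>\<close> obeys the Leibniz rule in \<open>\<Lambda>\<close>, but it is not linear over functions in \<open>X\<close>. The function
  \<open>D X\<close> in \<open>\<nabla>\<^sub>X \<Lambda> = L\<^sub>X \<Lambda> - (D X) \<Lambda>\<close> compensates this because of \<open>D (f X) = f D X + [f, X]\<close>, which is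
  the generator identity for the product of \<open>f\<close> and \<open>X\<close>. So a generator yields a connection
  (\<open>connection_of_generator\<close>). It is determined by this connection, because the
  difference of two generators is a derivation of the exterior product of degree \<open>-1\<close>, and such a
  derivation vanishes if it kills the sections of \<open>A\<close> (\<open>derivation_eq_0\<close>).

  The main point is the existence of a generator for a given connection. The generator identity
  forces its values on products \<open>X\<^sub>1 \<and> \<dots> \<and> X\<^sub>k\<close> of sections (\<open>koszul_op\<close>), but different sums
  of products may agree. The forced value is alternating in the sections. On \<open>n + 1\<close> sections
  the definition of \<open>D X\<close> turns it into an expression that is moreover linear over functions in
  each section, hence it is zero (\<open>koszul_op_above_rank\<close>). Therefore, whenever \<open>s\<close> has degree \<open>k\<close> and \<open>Y\<close> is a product of
  \<open>n + 1 - k\<close> sections, the generator identity for \<open>Y \<and> s = 0\<close> expresses \<open>Y \<and> D s\<close> by \<open>s\<close> alone.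
  As the wedge pairing into the top degree is nondegenerate, this defines \<open>D s\<close> without
  reference to a representation of \<open>s\<close> by products (\<open>gen_rel_unique\<close>, \<open>gen_rel_exists\<close>). The failure of
  the generator identity is bilinear over functions and vanishes on products of sections, hence it
  vanishes (\<open>failure_eq_0\<close>).

  For flatness, let \<open>\<kappa> = D [X, Y] - L\<^sub>X (D Y) + L\<^sub>Y (D X)\<close>. A direct computation shows that the curvature
  is multiplication by \<open>\<kappa>\<close> and that \<open>D (D (X \<and> Y)) = - \<kappa>\<close>. Thus \<open>D\<^sup>2 = 0\<close> implies flatness.
  Conversely, if \<open>\<kappa>\<close> vanishes, then \<open>w \<mapsto> D [X, w] - [X, D w] - [D X, w]\<close> is a derivation of degree
  \<open>-1\<close> that kills sections, hence is zero; by induction on the number of factors \<open>D\<^sup>2\<close> vanishes on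
  products of sections (\<open>square_W\<close>), and then everywhere (\<open>square_eq_0\<close>).

  All passages from local to global use the same device: for each point \<open>x\<close> there is a smooth
  function \<open>\<rho>\<close> with \<open>\<rho> x \<noteq> 0\<close> such that \<open>\<rho> s\<close> is a sum of products of global sections
  (\<open>local_wedges\<close>). An identity that behaves well under multiplication by functions can be divided
  by \<open>\<rho>\<close> at \<open>x\<close>, and in the same way \<open>s\<close> is smooth if each \<open>\<rho> s\<close> is (\<open>ext_sections_local\<close>). Exterior
  powers are handled through the contraction rule for the shuffle product (\<open>ext_wedge_Cons\<close>).
\<close>


section \<open>Calculus of iterated directional derivatives\<close>

lemma Ck_on_open_cong:
  assumes "open S" "\<And>x. x \<in> S \<Longrightarrow> f x = g x" "Ck_on k f S"
  shows "Ck_on k g S"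
  using assms(2,3)
proof (induction k arbitrary: f g)
  case 0
  then show ?case by (simp cong: continuous_on_cong)
next
  case (Suc k)
  have "g differentiable (at x)" if "x \<in> S" for x
  proof -
    have "(f has_derivative frechet_derivative f (at x)) (at x)"
      using Suc.prems(2) that by (simp add: frechet_derivative_works)
    then have "(g has_derivative frechet_derivative f (at x)) (at x)"
      using has_derivative_transform_within_open[OF _ assms(1) that] Suc.prems(1) by blast
    then show ?thesis by (auto simp: differentiable_def)
  qed
  moreover have "Ck_on k (\<lambda>x. frechet_derivative g (at x) v) S" for v
  proof (rule Suc.IH)
    show "Ck_on k (\<lambda>x. frechet_derivative f (at x) v) S" using Suc.prems(2) by simp
    show "frechet_derivative f (at x) v = frechet_derivative g (at x) v" if "x \<in> S" for x
      using frechet_derivative_transform_within_open[of f x S g] assms(1) that Suc.prems by simp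
  qed
  ultimately show ?case by simp
qed

lemma Ck_on_subset: "Ck_on k f S \<Longrightarrow> T \<subseteq> S \<Longrightarrow> Ck_on k f T"
  by (induction k arbitrary: f) (auto intro: continuous_on_subset)

lemma Ck_on_local:
  assumes "\<And>x. x \<in> S \<Longrightarrow> \<exists>T. open T \<and> x \<in> T \<and> Ck_on k f T"
  shows "Ck_on k f S"
  using assms
proof (induction k arbitrary: f)
  case 0
  then show ?case
    by (simp add: continuous_on_eq_continuous_within)
      (meson continuous_at_imp_continuous_at_within continuous_on_eq_continuous_at
        continuous_on_eq_continuous_within)
next
  case (Suc k)
  then show ?case by (simp) metis
qed

lemma Ck_on_Suc_imp: "Ck_on (Suc k) f S \<Longrightarrow> Ck_on k f S"
proof (induction k arbitrary: f)
  case 0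
  then show ?case
    by (auto intro!: continuous_at_imp_continuous_on differentiable_imp_continuous_within)
qed simp

lemma Ck_on_const: "Ck_on k (\<lambda>x. c) S"
  by (induction k arbitrary: c) (simp_all add: frechet_derivative_const)

lemma Ck_on_add:
  assumes "open S" "Ck_on k f S" "Ck_on k g S"
  shows "Ck_on k (\<lambda>x. f x + g x) S"
  using assms(2,3)
proof (induction k arbitrary: f g)
  case (Suc k)
  have der: "((\<lambda>x. f x + g x) has_derivative
      (\<lambda>v. frechet_derivative f (at x) v + frechet_derivative g (at x) v)) (at x)"
    if "x \<in> S" for x
    using Suc.prems that by (intro has_derivative_add) (auto simp: frechet_derivative_works)
  have "Ck_on k (\<lambda>x. frechet_derivative (\<lambda>x. f x + g x) (at x) v) S" for v
  proof (rule Ck_on_open_cong[OF assms(1)])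
    show "Ck_on k (\<lambda>x. frechet_derivative f (at x) v + frechet_derivative g (at x) v) S"
      using Suc.prems by (intro Suc.IH) auto
  qed (simp flip: frechet_derivative_at[OF der])
  with Suc show ?case by auto
qed (auto intro: continuous_intros)

lemma Ck_on_bilinear:
  assumes "open S" "bounded_bilinear B" "Ck_on k f S" "Ck_on k g S"
  shows "Ck_on k (\<lambda>x. B (f x) (g x)) S"
  using assms(3,4)
proof (induction k arbitrary: f g)
  case 0
  then show ?case by (simp add: bounded_bilinear.continuous_on[OF assms(2)])
next
  case (Suc k)
  have der: "((\<lambda>x. B (f x) (g x)) has_derivative
      (\<lambda>v. B (f x) (frechet_derivative g (at x) v) + B (frechet_derivative f (at x) v) (g x))) (at x)"
    if "x \<in> S" for x
    using Suc.prems that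
    by (intro bounded_bilinear.FDERIV[OF assms(2)]) (auto simp: frechet_derivative_works)
  have "Ck_on k (\<lambda>x. frechet_derivative (\<lambda>x. B (f x) (g x)) (at x) v) S" for v
  proof (rule Ck_on_open_cong[OF assms(1)])
    show "Ck_on k (\<lambda>x. B (f x) (frechet_derivative g (at x) v) + B (frechet_derivative f (at x) v) (g x)) S"
      using Suc.prems Ck_on_Suc_imp[OF Suc.prems(1)] Ck_on_Suc_imp[OF Suc.prems(2)]
      by (intro Ck_on_add[OF assms(1)] Suc.IH) auto
  qed (simp flip: frechet_derivative_at[OF der])
  moreover have "(\<lambda>x. B (f x) (g x)) differentiable at x" if "x \<in> S" for x
    using der[OF that] by (auto simp: differentiable_def)
  ultimately show ?case by simp
qed

text \<open>The derivative of \<open>1/f\<close> is \<open>- f' / f\<^sup>2\<close>, so that each further order of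
  differentiability reduces to the product rule and the previous order.\<close>

lemma Ck_on_inverse:
  fixes f :: "'a::real_normed_vector \<Rightarrow> real"
  assumes "open S" "\<And>x. x \<in> S \<Longrightarrow> f x \<noteq> 0" "Ck_on k f S"
  shows "Ck_on k (\<lambda>x. inverse (f x)) S"
  using assms(3)
proof (induction k)
  case 0
  then show ?case using assms(2) by (auto intro: continuous_intros)
next
  case (Suc k)
  have IH: "Ck_on k (\<lambda>x. inverse (f x)) S" using Suc Ck_on_Suc_imp by blast
  have der: "((\<lambda>x. inverse (f x)) has_derivative
      (\<lambda>v. - (inverse (f x) * frechet_derivative f (at x) v * inverse (f x)))) (at x)"
    if "x \<in> S" for x
    using Suc.prems that assms(2)
    by (intro Deriv.has_derivative_inverse) (auto simp: frechet_derivative_works)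
  have "Ck_on k (\<lambda>x. frechet_derivative (\<lambda>x. inverse (f x)) (at x) v) S" for v
  proof (rule Ck_on_open_cong[OF assms(1)])
    show "Ck_on k (\<lambda>x. (-1) * (inverse (f x) * (inverse (f x) * frechet_derivative f (at x) v))) S"
      using Suc.prems IH
      by (intro Ck_on_bilinear[OF assms(1) bounded_bilinear_mult] Ck_on_const) auto
  qed (simp flip: frechet_derivative_at[OF der])
  moreover have "(\<lambda>x. inverse (f x)) differentiable at x" if "x \<in> S" for x
    using der[OF that] by (auto simp: differentiable_def)
  ultimately show ?case by simp
qed

text \<open>The functions \<open>t\<^bsup>-m\<^esup> exp (-1/t)\<close>, extended by 0 to \<open>t \<le> 0\<close>. The flat
  function is the case \<open>m = 0\<close>; its derivatives are linear combinations of the others, so that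
  the family is closed under differentiation.\<close>

definition flat_exp :: "nat \<Rightarrow> real \<Rightarrow> real" where
  "flat_exp m t = (if t > 0 then exp (- inverse t) * inverse t ^ m else 0)"

lemma flat_exp_deriv:
  "(flat_exp m has_real_derivative flat_exp (m + 2) t - real m * flat_exp (m + 1) t) (at t)"
proof -
  consider "t > 0" | "t < 0" | "t = 0" by linarith
  then show ?thesis
  proof cases
    case 1
    have "((\<lambda>t. exp (- inverse t) * inverse t ^ m) has_real_derivative
        flat_exp (m + 2) t - real m * flat_exp (m + 1) t) (at t)"
    proof (cases m)
      case 0
      then show ?thesis using 1
        by (auto intro!: derivative_eq_intros simp: flat_exp_def power2_eq_square)
    next
      case (Suc k)
      then show ?thesis using 1
        by (auto intro!: derivative_eq_intros simp: flat_exp_def field_simps power2_eq_square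
            power_eq_if[of t k])
    qed
    then show ?thesis
      by (rule has_field_derivative_transform_within_open[of _ _ _ "{0<..}"])
        (use 1 in \<open>auto simp: flat_exp_def\<close>)
  next
    case 2
    have "((\<lambda>t. 0) has_real_derivative 0) (at t)" by simp
    then have "(flat_exp m has_real_derivative 0) (at t)"
      by (rule has_field_derivative_transform_within_open[of _ _ _ "{..<0}"])
        (use 2 in \<open>auto simp: flat_exp_def\<close>)
    then show ?thesis using 2 by (simp add: flat_exp_def)
  next
    case 3
    have r: "((\<lambda>h. flat_exp m h / h) \<longlongrightarrow> 0) (at_right 0)"
    proof (rule tendsto_cong[THEN iffD1])
      have "((\<lambda>u::real. u ^ (m + 1) / exp u) \<longlongrightarrow> 0) at_top"
        by (rule tendsto_power_div_exp_0)
      then show "((\<lambda>h. (inverse h) ^ (m + 1) / exp (inverse h)) \<longlongrightarrow> (0::real)) (at_right 0)"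
        using filterlim_compose filterlim_inverse_at_top_right by blast
      show "eventually (\<lambda>h. (inverse h) ^ (m + 1) / exp (inverse h) = flat_exp m h / h) (at_right 0)"
        by (auto simp: eventually_at_right_less[of 0] flat_exp_def field_simps exp_minus
            intro!: eventually_mono[OF eventually_at_right_less[of 0]])
    qed
    \<comment> \<open>The difference quotient is zero on the left.\<close>
    have l: "((\<lambda>h. flat_exp m h / h) \<longlongrightarrow> 0) (at_left 0)"
      by (rule tendsto_cong[THEN iffD1, OF _ tendsto_const[of 0]])
        (auto intro!: eventually_mono[OF eventually_at_left_real[of "-1" 0]] simp: flat_exp_def)
    have "((\<lambda>h. flat_exp m h / h) \<longlongrightarrow> 0) (at 0)"
      using l r by (simp add: filterlim_at_split)
    then show ?thesis using 3
      by (simp add: has_field_derivative_iff) (simp add: flat_exp_def)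
  qed
qed

lemma Ck_on_flat_exp:
  assumes "open S" "Ck_on k f S"
  shows "Ck_on k (\<lambda>x. flat_exp m (f x)) S"
  using assms(2)
proof (induction k arbitrary: m)
  case 0
  have "continuous_on UNIV (flat_exp m)"
    using flat_exp_deriv DERIV_isCont by (blast intro: continuous_at_imp_continuous_on)
  with 0 show ?case using continuous_on_compose2[of UNIV] by auto
next
  case (Suc k)
  have IH: "Ck_on k (\<lambda>x. flat_exp m (f x)) S" for m using Suc Ck_on_Suc_imp by blast
  have der: "((\<lambda>x. flat_exp m (f x)) has_derivative
      (\<lambda>v. (flat_exp (m + 2) (f x) - real m * flat_exp (m + 1) (f x)) * frechet_derivative f (at x) v)) (at x)"
    if "x \<in> S" for x
  proof -
    have "(f has_derivative frechet_derivative f (at x)) (at x)"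
      using Suc.prems that by (simp add: frechet_derivative_works)
    from has_derivative_compose[OF this flat_exp_deriv[unfolded has_field_derivative_def]]
    show ?thesis .
  qed
  have "Ck_on k (\<lambda>x. frechet_derivative (\<lambda>x. flat_exp m (f x)) (at x) v) S" for v
  proof (rule Ck_on_open_cong[OF assms(1)])
    show "Ck_on k (\<lambda>x. (flat_exp (m + 2) (f x) + (- real m) * flat_exp (m + 1) (f x)) *
        frechet_derivative f (at x) v) S"
      using Suc.prems IH
      by (intro Ck_on_bilinear[OF assms(1) bounded_bilinear_mult] Ck_on_const Ck_on_add[OF assms(1)]) auto
  qed (simp flip: frechet_derivative_at[OF der])
  moreover have "(\<lambda>x. flat_exp m (f x)) differentiable at x" if "x \<in> S" for x
    using der[OF that] by (auto simp: differentiable_def)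
  ultimately show ?case by simp
qed


section \<open>Smooth functions on a manifold\<close>

text \<open>The dimension of \<open>'e\<close> may be 0, so the Heine-Borel property is derived here from an
  orthogonal spanning set instead of the type class for Euclidean spaces.\<close>

lemma compact_cball_finite_dim:
  fixes B :: "'e::real_inner set" and y :: 'e
  assumes "finite B" "span B = UNIV"
  shows "compact (cball y r)"
proof -
  obtain C where C: "finite C" "span C = (UNIV :: 'e set)" "pairwise orthogonal C"
    using basis_orthogonal[OF assms(1)] assms(2) by metis
  define box where "box C R = (\<lambda>(t::'e \<Rightarrow> real). \<Sum>c\<in>C. t c *\<^sub>R c) ` {t. \<forall>c\<in>C. \<bar>t c\<bar> \<le> R c}"
    for C :: "'e set" and R :: "'e \<Rightarrow> real"
  have comp: "compact (box C R)" if "finite C" for C R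
    using that
  proof (induction C)
    case empty
    have "box {} R = {0}" by (auto simp: box_def)
    then show ?case by simp
  next
    case (insert c C)
    have eq: "box (insert c C) R = {x + y | x y. x \<in> (\<lambda>s. s *\<^sub>R c) ` {- R c..R c} \<and> y \<in> box C R}"
    proof (intro equalityI subsetI)
      fix z assume "z \<in> box (insert c C) R"
      then show "z \<in> {x + y | x y. x \<in> (\<lambda>s. s *\<^sub>R c) ` {- R c..R c} \<and> y \<in> box C R}"
        using insert by (fastforce simp: box_def abs_le_iff)
    next
      fix z assume "z \<in> {x + y | x y. x \<in> (\<lambda>s. s *\<^sub>R c) ` {- R c..R c} \<and> y \<in> box C R}"
      then obtain s t where st: "s \<in> {- R c..R c}" "\<forall>c\<in>C. \<bar>t c\<bar> \<le> R c"
        "z = s *\<^sub>R c + (\<Sum>c\<in>C. t c *\<^sub>R c)" by (auto simp: box_def)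
      have "(\<Sum>d\<in>insert c C. (t(c := s)) d *\<^sub>R d) = z"
        using insert st(3) by (simp, intro sum.cong) auto
      moreover have "\<forall>d\<in>insert c C. \<bar>(t(c := s)) d\<bar> \<le> R d" using st by auto
      ultimately show "z \<in> box (insert c C) R"
        unfolding box_def by (intro image_eqI[of _ _ "t(c := s)"]) auto
    qed
    have "compact ((\<lambda>s. s *\<^sub>R c) ` {- R c..R c})"
      by (intro compact_continuous_image continuous_intros) simp
    then show ?case unfolding eq using insert.IH by (rule compact_sums)
  qed
  define R where "R c = (norm y + r) / norm c" for c :: 'e
  \<comment> \<open>By orthogonality each coefficient is bounded separately, with the Cauchy-Schwarz inequality.\<close>
  have "cball y r \<subseteq> box C R"
  proof
    fix x assume x: "x \<in> cball y r"
    then have nx: "norm x \<le> norm y + r"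
      using norm_triangle_ineq[of "x - y" y] by (simp add: dist_norm norm_minus_commute)
    obtain t where t: "x = (\<Sum>c\<in>C. t c *\<^sub>R c)"
      using C span_finite[OF C(1)] by blast
    \<comment> \<open>The coefficient of a zero vector in \<open>C\<close> is arbitrary and is normalised to 0.\<close>
    define u where "u c = (if c = 0 then 0 else t c)" for c
    have u: "x = (\<Sum>c\<in>C. u c *\<^sub>R c)" unfolding t by (rule sum.cong) (auto simp: u_def)
    have "\<bar>u c\<bar> \<le> R c" if c: "c \<in> C" for c
    proof (cases "c = 0")
      case True
      then show ?thesis by (simp add: u_def R_def)
    next
      case False
      have "inner x c = (\<Sum>d\<in>C. if d = c then u c * (norm c)\<^sup>2 else 0)"
        unfolding u inner_sum_left
      proof (rule sum.cong)
        show "inner (u d *\<^sub>R d) c = (if d = c then u c * (norm c)\<^sup>2 else 0)" if "d \<in> C" for d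
          using C(3) c that by (auto simp: pairwise_def orthogonal_def dot_square_norm)
      qed simp
      then have "inner x c = u c * (norm c)\<^sup>2" using C(1) c by simp
      then have "\<bar>u c\<bar> * (norm c)\<^sup>2 \<le> norm x * norm c"
        using Cauchy_Schwarz_ineq2[of x c] by (simp add: abs_mult)
      then have "\<bar>u c\<bar> * norm c \<le> norm x" using False by (simp add: power2_eq_square)
      then show ?thesis using False nx by (simp add: R_def field_simps)
    qed
    with u show "x \<in> box C R" unfolding box_def by blast
  qed
  moreover have "compact (box C R)" by (rule comp[OF C(1)])
  ultimately show ?thesis
    by (metis compact_Int_closed closed_cball inf.absorb_iff2)
qed

context
  fixes M :: "('m::{t2_space,second_countable_topology}, 'e::real_inner) atlas"
  assumes M: "smooth_manifold M"
begin

lemma is_chart_atlas: "(U, \<phi>) \<in> M \<Longrightarrow> is_chart U \<phi>"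
  using M by (auto simp: smooth_manifold_def)

lemma chart_at: obtains U \<phi> where "(U, \<phi>) \<in> M" "x \<in> U"
proof -
  have "x \<in> (\<Union>(U, \<phi>)\<in>M. U)" using M unfolding smooth_manifold_def by (metis UNIV_I)
  then show thesis using that by auto
qed

lemma chart_transition:
  "(U, \<phi>) \<in> M \<Longrightarrow> (V, \<psi>) \<in> M \<Longrightarrow> smooth_on (\<phi> ` (U \<inter> V)) (\<psi> \<circ> inv_into U \<phi>)"
  using M unfolding smooth_manifold_def by (metis (no_types, lifting) case_prodD)

lemma chartD:
  assumes "(U, \<phi>) \<in> M"
  shows "open U" "open (\<phi> ` U)" "inj_on \<phi> U"
    "homeomorphism U (\<phi> ` U) \<phi> (inv_into U \<phi>)"
proof -
  have "is_chart U \<phi>" by (rule is_chart_atlas[OF assms])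
  then obtain \<psi> where *: "open U" "open (\<phi> ` U)" "homeomorphism U (\<phi> ` U) \<phi> \<psi>"
    by (auto simp: is_chart_def)
  show "open U" "open (\<phi> ` U)" by (rule *)+
  show inj: "inj_on \<phi> U" using *(3) by (metis homeomorphism_apply1 inj_on_inverseI)
  have "inv_into U \<phi> y = \<psi> y" if "y \<in> \<phi> ` U" for y
    using *(3) inj that by (auto simp: homeomorphism_def)
  then show "homeomorphism U (\<phi> ` U) \<phi> (inv_into U \<phi>)"
    by (intro homeomorphism_cong[OF *(3)]) auto
qed

lemma open_chart_image:
  assumes "(U, \<phi>) \<in> M" "open W"
  shows "open (\<phi> ` (U \<inter> W))"
proof -
  have "openin (top_of_set (\<phi> ` U)) (\<phi> ` (U \<inter> W))"
    using homeomorphism_imp_open_map[OF chartD(4)[OF assms(1)]] assms(2)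
    by (simp add: openin_open_Int)
  then show ?thesis using chartD(2)[OF assms(1)] by (simp add: openin_open_eq)
qed

lemma smooth_fun_onI:
  assumes "\<And>U \<phi> k. (U, \<phi>) \<in> M \<Longrightarrow> Ck_on k (f \<circ> inv_into U \<phi>) (\<phi> ` (U \<inter> W))"
  shows "smooth_fun_on M W f"
  using assms unfolding smooth_fun_on_def smooth_on_def by blast

lemma smooth_fun_onD:
  "smooth_fun_on M W f \<Longrightarrow> (U, \<phi>) \<in> M \<Longrightarrow> Ck_on k (f \<circ> inv_into U \<phi>) (\<phi> ` (U \<inter> W))"
  unfolding smooth_fun_on_def smooth_on_def by blast

lemma inv_chart_in: "(U, \<phi>) \<in> M \<Longrightarrow> z \<in> \<phi> ` (U \<inter> W) \<Longrightarrow> inv_into U \<phi> z \<in> U \<inter> W"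
  using chartD(3) by (fastforce simp: inv_into_f_f)

lemma smooth_fun_on_cong:
  assumes "open W" "\<And>x. x \<in> W \<Longrightarrow> f x = g x" "smooth_fun_on M W f"
  shows "smooth_fun_on M W g"
proof (rule smooth_fun_onI)
  fix U \<phi> k assume U: "(U, \<phi>) \<in> M"
  show "Ck_on k (g \<circ> inv_into U \<phi>) (\<phi> ` (U \<inter> W))"
    by (rule Ck_on_open_cong[OF open_chart_image[OF U assms(1)] _ smooth_fun_onD[OF assms(3) U]])
      (use inv_chart_in[OF U] assms(2) in auto)
qed

lemma smooth_fun_on_subset: "smooth_fun_on M W f \<Longrightarrow> T \<subseteq> W \<Longrightarrow> smooth_fun_on M T f"
  by (rule smooth_fun_onI, rule Ck_on_subset[OF smooth_fun_onD]) auto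

lemma smooth_fun_on_local:
  assumes "\<And>x. x \<in> W \<Longrightarrow> \<exists>T. open T \<and> x \<in> T \<and> smooth_fun_on M T f"
  shows "smooth_fun_on M W f"
proof (rule smooth_fun_onI, rule Ck_on_local)
  fix U \<phi> k z assume U: "(U, \<phi>) \<in> M" and z: "z \<in> \<phi> ` (U \<inter> W)"
  then obtain x where x: "x \<in> U" "x \<in> W" "z = \<phi> x" by auto
  obtain T where T: "open T" "x \<in> T" "smooth_fun_on M T f" using assms x by blast
  show "\<exists>S. open S \<and> z \<in> S \<and> Ck_on k (f \<circ> inv_into U \<phi>) S"
    using open_chart_image[OF U T(1)] smooth_fun_onD[OF T(3) U] x T by blast
qed

lemma smooth_fun_on_const: "smooth_fun_on M W (\<lambda>x. c)"
  by (rule smooth_fun_onI) (simp add: comp_def Ck_on_const)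

lemma smooth_fun_on_add:
  assumes "open W" "smooth_fun_on M W f" "smooth_fun_on M W g"
  shows "smooth_fun_on M W (\<lambda>x. f x + g x)"
proof (rule smooth_fun_onI)
  fix U \<phi> k assume U: "(U, \<phi>) \<in> M"
  show "Ck_on k ((\<lambda>x. f x + g x) \<circ> inv_into U \<phi>) (\<phi> ` (U \<inter> W))"
    using Ck_on_add[OF open_chart_image[OF U assms(1)] smooth_fun_onD[OF assms(2) U]
        smooth_fun_onD[OF assms(3) U]] by (simp add: comp_def)
qed

lemma smooth_fun_on_mult:
  assumes "open W" "smooth_fun_on M W f" "smooth_fun_on M W g"
  shows "smooth_fun_on M W (\<lambda>x. f x * g x)"
proof (rule smooth_fun_onI)
  fix U \<phi> k assume U: "(U, \<phi>) \<in> M"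
  show "Ck_on k ((\<lambda>x. f x * g x) \<circ> inv_into U \<phi>) (\<phi> ` (U \<inter> W))"
    using Ck_on_bilinear[OF open_chart_image[OF U assms(1)] bounded_bilinear_mult
        smooth_fun_onD[OF assms(2) U] smooth_fun_onD[OF assms(3) U]] by (simp add: comp_def)
qed

lemma smooth_fun_on_inverse:
  assumes "open W" "\<And>x. x \<in> W \<Longrightarrow> f x \<noteq> 0" "smooth_fun_on M W f"
  shows "smooth_fun_on M W (\<lambda>x. inverse (f x))"
proof (rule smooth_fun_onI)
  fix U \<phi> k assume U: "(U, \<phi>) \<in> M"
  show "Ck_on k ((\<lambda>x. inverse (f x)) \<circ> inv_into U \<phi>) (\<phi> ` (U \<inter> W))"
    using Ck_on_inverse[OF open_chart_image[OF U assms(1)] _ smooth_fun_onD[OF assms(3) U]]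
      inv_chart_in[OF U] assms(2) by (auto simp: comp_def)
qed

lemma smooth_fun_on_sum:
  assumes "open W" "\<And>i. i \<in> I \<Longrightarrow> smooth_fun_on M W (f i)"
  shows "smooth_fun_on M W (\<lambda>x. \<Sum>i\<in>I. f i x)"
  using assms(2)
  by (induction I rule: infinite_finite_induct)
    (auto intro: smooth_fun_on_const smooth_fun_on_add[OF assms(1)])

lemma smooth_fun_on_power:
  assumes "open W" "smooth_fun_on M W f"
  shows "smooth_fun_on M W (\<lambda>x. f x ^ k)"
  by (induction k) (auto intro: smooth_fun_on_const smooth_fun_on_mult[OF assms(1)] assms(2))

lemma smooth_funs_on: "f \<in> smooth_funs M \<Longrightarrow> smooth_fun_on M W f"
  unfolding smooth_funs_def using smooth_fun_on_subset by blast

lemma smooth_fun_continuous: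
  assumes "f \<in> smooth_funs M"
  shows "continuous_on UNIV f"
proof (rule continuous_at_imp_continuous_on, rule ballI)
  fix x
  obtain U \<phi> where U: "(U, \<phi>) \<in> M" "x \<in> U" by (rule chart_at)
  have "continuous_on (\<phi> ` U) (f \<circ> inv_into U \<phi>)"
    using smooth_fun_onD[OF smooth_funs_on[OF assms] U(1), where k = 0 and W = UNIV] by simp
  moreover have "continuous_on U \<phi>" using chartD(4)[OF U(1)] by (simp add: homeomorphism_def)
  ultimately have "continuous_on U ((f \<circ> inv_into U \<phi>) \<circ> \<phi>)" by (rule continuous_on_compose[rotated])
  then have "continuous_on U f"
    using chartD(3)[OF U(1)] by (auto simp: inv_into_f_f cong: continuous_on_cong)
  then show "isCont f x" using U chartD(1) continuous_on_eq_continuous_at by blast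
qed

text \<open>The closed set \<open>C\<close> controls the boundary of \<open>W\<close>, where \<open>f\<close> may be unbounded: there the
  product is zero on the open complement of \<open>C\<close>. Vanishing of \<open>\<rho>\<close> outside of \<open>W\<close> would not do.\<close>

lemma smooth_extend_by_zero:
  assumes W: "open W" and T: "open T" and C: "closed C" "C \<subseteq> W"
    and \<rho>: "\<rho> \<in> smooth_funs M" "\<And>y. y \<notin> C \<Longrightarrow> \<rho> y = 0" and f: "smooth_fun_on M (T \<inter> W) f"
  shows "smooth_fun_on M T (\<lambda>y. if y \<in> W then \<rho> y * f y else 0)"
proof (rule smooth_fun_on_local)
  fix x assume x: "x \<in> T"
  show "\<exists>S. open S \<and> x \<in> S \<and> smooth_fun_on M S (\<lambda>y. if y \<in> W then \<rho> y * f y else 0)"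
  proof (cases "x \<in> W")
    case True
    have TW: "open (T \<inter> W)" using T W by blast
    have "smooth_fun_on M (T \<inter> W) (\<lambda>y. if y \<in> W then \<rho> y * f y else 0)"
      by (rule smooth_fun_on_cong[OF TW _ smooth_fun_on_mult[OF TW smooth_funs_on[OF \<rho>(1)] f]]) simp
    with True TW x show ?thesis by blast
  next
    case False
    have "smooth_fun_on M (- C) (\<lambda>y. if y \<in> W then \<rho> y * f y else 0)"
      by (rule smooth_fun_on_cong[OF _ _ smooth_fun_on_const[of _ 0]]) (use C \<rho> in auto)
    with False C show ?thesis by (meson ComplI closed_def subsetD)
  qed
qed

text \<open>The Hausdorff property makes a compact coordinate ball closed in \<open>M\<close>; this is what permits
  the extension of the bump by zero beyond its chart.\<close>

lemma bump_function:
  assumes W: "open W" "x \<in> W"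
  obtains \<rho> C where "\<rho> \<in> smooth_funs M" "closed C" "C \<subseteq> W" "\<And>y. y \<notin> C \<Longrightarrow> \<rho> y = 0" "\<rho> x \<noteq> 0"
proof -
  obtain U \<phi> where U: "(U, \<phi>) \<in> M" "x \<in> U" by (rule chart_at)
  let ?inv = "inv_into U \<phi>"
  have hom: "homeomorphism U (\<phi> ` U) \<phi> ?inv" by (rule chartD(4)[OF U(1)])
  have "open (\<phi> ` (U \<inter> W))" "\<phi> x \<in> \<phi> ` (U \<inter> W)" using open_chart_image[OF U(1) W(1)] U W by auto
  then obtain r where r: "r > 0" "cball (\<phi> x) r \<subseteq> \<phi> ` (U \<inter> W)"
    by (meson open_contains_cball)
  define C where "C = ?inv ` cball (\<phi> x) r"
  have "compact (cball (\<phi> x) r)"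
    using M compact_cball_finite_dim by (auto simp: smooth_manifold_def)
  moreover have "continuous_on (cball (\<phi> x) r) ?inv"
  proof (rule continuous_on_subset)
    show "continuous_on (\<phi> ` U) ?inv" using hom by (simp add: homeomorphism_def)
    show "cball (\<phi> x) r \<subseteq> \<phi> ` U" using r(2) by (meson image_mono inf_le1 subset_trans)
  qed
  ultimately have C: "closed C" unfolding C_def by (intro compact_imp_closed compact_continuous_image)
  have CW: "C \<subseteq> U \<inter> W" unfolding C_def using r(2) inv_chart_in[OF U(1)] by blast
  define \<rho> where "\<rho> y = (if y \<in> U then flat_exp 0 (r\<^sup>2 - (norm (\<phi> y - \<phi> x))\<^sup>2) else 0)" for y
  have \<rho>0: "\<rho> y = 0" if "y \<notin> C" for y
  proof (cases "y \<in> U")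
    case True
    have "\<phi> y \<notin> cball (\<phi> x) r"
      using that True chartD(3)[OF U(1)] unfolding C_def by (metis image_eqI inv_into_f_f)
    then have "r < norm (\<phi> y - \<phi> x)" by (simp add: dist_norm norm_minus_commute)
    then have "r\<^sup>2 < (norm (\<phi> y - \<phi> x))\<^sup>2" using r(1) by (intro power_strict_mono) auto
    then show ?thesis by (simp add: \<rho>_def flat_exp_def)
  qed (simp add: \<rho>_def)
  have "smooth_fun_on M UNIV \<rho>"
  proof (rule smooth_fun_on_local)
    fix z
    show "\<exists>T. open T \<and> z \<in> T \<and> smooth_fun_on M T \<rho>"
    proof (cases "z \<in> U")
      case True
      have "smooth_fun_on M U \<rho>"
      proof (rule smooth_fun_onI)
        fix V \<psi> k assume V: "(V, \<psi>) \<in> M"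
        let ?S = "\<psi> ` (V \<inter> U)" and ?h = "\<lambda>w. \<phi> (inv_into V \<psi> w) + - \<phi> x"
        have S: "open ?S" by (rule open_chart_image[OF V chartD(1)[OF U(1)]])
        have "smooth_on ?S (\<phi> \<circ> inv_into V \<psi>)"
          by (rule chart_transition[OF V U(1)])
        then have h: "Ck_on k ?h ?S"
          unfolding smooth_on_def comp_def by (rule Ck_on_add[OF S spec[of _ k] Ck_on_const])
        have "Ck_on k (\<lambda>w. flat_exp 0 (r\<^sup>2 + (-1) * inner (?h w) (?h w))) ?S"
          by (rule Ck_on_flat_exp[OF S Ck_on_add[OF S Ck_on_const
              Ck_on_bilinear[OF S bounded_bilinear_mult Ck_on_const
                Ck_on_bilinear[OF S bounded_bilinear_inner h h]]]])
        then show "Ck_on k (\<rho> \<circ> inv_into V \<psi>) ?S"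
          by (rule Ck_on_open_cong[OF S, rotated])
            (use inv_chart_in[OF V, of _ U] in \<open>auto simp: \<rho>_def dot_square_norm\<close>)
      qed
      with True show ?thesis using chartD(1)[OF U(1)] by blast
    next
      case False
      have "smooth_fun_on M (- C) \<rho>"
        by (rule smooth_fun_on_cong[OF _ _ smooth_fun_on_const[of _ 0]]) (use C \<rho>0 in auto)
      moreover have "open (- C)" "z \<in> - C" using False C CW by auto
      ultimately show ?thesis by blast
    qed
  qed
  then have "\<rho> \<in> smooth_funs M" by (simp add: smooth_funs_def)
  moreover have "\<rho> x \<noteq> 0" using U(2) r(1) by (simp add: \<rho>_def flat_exp_def)
  ultimately show thesis using that[of \<rho> C] C CW \<rho>0 by blast
qed

lemma smooth_funs_closed:
  shows "(\<lambda>x. c) \<in> smooth_funs M"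
    and "f \<in> smooth_funs M \<Longrightarrow> g \<in> smooth_funs M \<Longrightarrow> (\<lambda>x. f x + g x) \<in> smooth_funs M"
    and "f \<in> smooth_funs M \<Longrightarrow> g \<in> smooth_funs M \<Longrightarrow> (\<lambda>x. f x * g x) \<in> smooth_funs M"
    and "f \<in> smooth_funs M \<Longrightarrow> (\<lambda>x. f x ^ k) \<in> smooth_funs M"
  by (simp_all add: smooth_funs_def smooth_fun_on_const smooth_fun_on_add smooth_fun_on_mult
      smooth_fun_on_power)

text \<open>A bump function is nonzero near its base point, hence can be divided out there. Locally
  constructed objects are recognised as smooth in this way.\<close>

lemma smooth_fun_on_divide_local:
  assumes W: "open W"
    and loc: "\<And>x. x \<in> W \<Longrightarrow> \<exists>\<rho>\<in>smooth_funs M. \<rho> x \<noteq> 0 \<and> smooth_fun_on M W (\<lambda>y. \<rho> y * f y)"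
  shows "smooth_fun_on M W f"
proof (rule smooth_fun_on_local)
  fix x assume "x \<in> W"
  then obtain \<rho> where \<rho>: "\<rho> \<in> smooth_funs M" "\<rho> x \<noteq> 0" "smooth_fun_on M W (\<lambda>y. \<rho> y * f y)"
    using loc by blast
  define T where "T = W \<inter> {y. \<rho> y \<noteq> 0}"
  have "open {y. \<rho> y \<noteq> 0}"
    using smooth_fun_continuous[OF \<rho>(1)] by (intro open_Collect_neq continuous_intros)
  then have T: "open T" unfolding T_def using W by blast
  have "smooth_fun_on M T (\<lambda>y. inverse (\<rho> y) * (\<rho> y * f y))"
    using smooth_fun_on_inverse[OF T _ smooth_funs_on[OF \<rho>(1)]]
    by (intro smooth_fun_on_mult[OF T] smooth_fun_on_subset[OF \<rho>(3)]) (auto simp: T_def)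
  then have "smooth_fun_on M T f"
    by (rule smooth_fun_on_cong[OF T, rotated]) (auto simp: T_def)
  then show "\<exists>T. open T \<and> x \<in> T \<and> smooth_fun_on M T f"
    using T \<open>x \<in> W\<close> \<rho>(2) by (auto simp: T_def)
qed

end


section \<open>Linear maps on subspaces\<close>

lemma fun_sum_apply: "(\<Sum>i\<in>I. f i) x = (\<Sum>i\<in>I. f i x)" for f :: "'i \<Rightarrow> 'a \<Rightarrow> 'b::comm_monoid_add"
  by (induction I rule: infinite_finite_induct) auto

lemma linear_on_subspace_0: "subspace V \<Longrightarrow> linear_on_subspace V f \<Longrightarrow> f 0 = 0"
  unfolding linear_on_subspace_def subspace_def by (metis scaleR_zero_left)

lemma linear_on_subspace_sum:
  assumes V: "subspace V" and f: "linear_on_subspace V f" and g: "\<And>i. i \<in> I \<Longrightarrow> g i \<in> V"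
  shows "f (\<Sum>i\<in>I. c i *\<^sub>R g i) = (\<Sum>i\<in>I. c i *\<^sub>R f (g i))"
  using g
proof (induction I rule: infinite_finite_induct)
  case (insert i I)
  have v: "c i *\<^sub>R g i \<in> V" "(\<Sum>i\<in>I. c i *\<^sub>R g i) \<in> V"
    using insert.prems V by (auto intro!: subspace_sum subspace_scale)
  have "f (c i *\<^sub>R g i + (\<Sum>i\<in>I. c i *\<^sub>R g i)) = c i *\<^sub>R f (g i) + f (\<Sum>i\<in>I. c i *\<^sub>R g i)"
    using f v insert.prems unfolding linear_on_subspace_def by (metis insertI1)
  moreover have "f (\<Sum>i\<in>I. c i *\<^sub>R g i) = (\<Sum>i\<in>I. c i *\<^sub>R f (g i))"
    using insert.IH insert.prems by blast
  ultimately show ?case unfolding sum.insert[OF insert.hyps(1,2)] by (simp only:)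
next
  case empty
  show ?case unfolding sum.empty by (rule linear_on_subspace_0[OF V f])
next
  case (infinite I)
  show ?case unfolding sum.infinite[OF infinite(1)] by (rule linear_on_subspace_0[OF V f])
qed


section \<open>The shuffle product\<close>

definition contr :: "('v \<Rightarrow> real) \<Rightarrow> 'v ext \<Rightarrow> 'v ext" where
  "contr \<xi> \<alpha> = (\<lambda>l. \<alpha> (\<xi> # l))"

definition grade_inv :: "'v ext \<Rightarrow> 'v ext" where
  "grade_inv \<alpha> = (\<lambda>l. (-1) ^ length l * \<alpha> l)"

lemma length_nths_compl: "length (nths l S) + length (nths l (- S)) = length l"
proof (induction l arbitrary: S)
  case (Cons x l)
  have "{j. Suc j \<in> - S} = - {j. Suc j \<in> S}" by auto
  with Cons[of "{j. Suc j \<in> S}"] show ?case by (simp add: nths_Cons)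
qed simp

text \<open>Prefixing a position shifts all others. If the new position is moved to the front, no inversion
  arises; if it stays behind, it is overtaken by each of the selected positions.\<close>

lemma shuffle_sign_Suc:
  assumes "finite T"
  shows "shuffle_sign (Suc ` T) = (-1) ^ card T * shuffle_sign T"
    and "shuffle_sign (insert 0 (Suc ` T)) = shuffle_sign T"
proof -
  let ?P = "{(i, j). i \<in> T \<and> j \<notin> T \<and> j < i}" and ?s = "map_prod Suc Suc"
  have fin: "finite ?P"
    by (rule finite_subset[of _ "T \<times> {..Max T}"]) (use assms in \<open>auto intro: le_trans[OF less_imp_le Max_ge]\<close>)
  have c: "card (?s ` ?P) = card ?P" by (rule card_image) (auto intro: inj_on_subset[OF prod.inj_map])
  have "{(i, j). i \<in> Suc ` T \<and> j \<notin> Suc ` T \<and> j < i} = (\<lambda>i. (Suc i, 0)) ` T \<union> ?s ` ?P"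
    (is "?Q = _")
  proof (intro equalityI subsetI)
    fix p assume "p \<in> ?Q"
    then show "p \<in> (\<lambda>i. (Suc i, 0)) ` T \<union> ?s ` ?P"
      by (cases "snd p") (auto simp: image_iff)
  qed auto
  moreover have "card ((\<lambda>i. (Suc i, 0::nat)) ` T \<union> ?s ` ?P) = card T + card ?P"
    by (subst card_Un_disjoint) (use fin assms c in \<open>auto simp: card_image inj_on_def\<close>)
  ultimately show "shuffle_sign (Suc ` T) = (-1) ^ card T * shuffle_sign T"
    by (simp add: shuffle_sign_def power_add)
  have "{(i, j). i \<in> insert 0 (Suc ` T) \<and> j \<notin> insert 0 (Suc ` T) \<and> j < i} = ?s ` ?P"
    (is "?Q = _")
  proof (intro equalityI subsetI)
    fix p assume "p \<in> ?Q"
    then show "p \<in> ?s ` ?P" by (cases "snd p") (auto simp: image_iff)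
  qed auto
  then show "shuffle_sign (insert 0 (Suc ` T)) = shuffle_sign T"
    by (simp add: shuffle_sign_def c)
qed

lemma ext_wedge_Nil [simp]: "ext_wedge \<alpha> \<beta> [] = \<alpha> [] * \<beta> []"
  by (simp add: ext_wedge_def shuffle_sign_def)

text \<open>Contraction is an antiderivation of the shuffle product. Together with the value at the
  empty list this is a recursion for the product, from which all its algebraic properties follow
  by induction on the list of covectors, for arbitrary functions in place of forms.\<close>

lemma ext_wedge_Cons:
  "ext_wedge \<alpha> \<beta> (\<xi> # l) = ext_wedge (contr \<xi> \<alpha>) \<beta> l + ext_wedge (grade_inv \<alpha>) (contr \<xi> \<beta>) l"
proof -
  let ?n = "length l" and ?L = "\<xi> # l"
  let ?f = "\<lambda>S. shuffle_sign S * \<alpha> (nths ?L S) * \<beta> (nths ?L (- S))"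
  have P: "Pow {..<Suc ?n} = (\<lambda>T. insert 0 (Suc ` T)) ` Pow {..<?n} \<union> image Suc ` Pow {..<?n}"
  proof (intro equalityI subsetI)
    fix S assume S: "S \<in> Pow {..<Suc ?n}"
    define T where "T = {j. Suc j \<in> S}"
    have T: "T \<in> Pow {..<?n}" using S by (auto simp: T_def)
    have "S = (if 0 \<in> S then insert 0 (Suc ` T) else Suc ` T)"
      unfolding T_def by (auto simp: image_iff) (metis not0_implies_Suc)+
    then show "S \<in> (\<lambda>T. insert 0 (Suc ` T)) ` Pow {..<?n} \<union> image Suc ` Pow {..<?n}"
      using T by (metis (no_types, lifting) UnCI image_eqI)
  qed auto
  have i1: "inj_on (\<lambda>T. insert 0 (Suc ` T)) (Pow {..<?n})"
    by (rule inj_on_inverseI[of _ "\<lambda>S. {j. Suc j \<in> S}"]) auto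
  have i2: "inj_on (image Suc) (Pow {..<?n})"
    by (rule inj_on_inverseI[of _ "\<lambda>S. {j. Suc j \<in> S}"]) auto
  have fin: "finite T" if "T \<in> Pow {..<?n}" for T using that finite_subset by blast
  have s1: "{j. Suc j \<in> insert 0 (Suc ` T)} = T" "{j. Suc j \<in> - insert 0 (Suc ` T)} = - T"
      "{j. Suc j \<in> Suc ` T} = T" "{j. Suc j \<in> - Suc ` T} = - T" "{j. Suc j \<notin> Suc ` T} = - T"
      "{j. Suc j \<notin> insert 0 (Suc ` T)} = - T" for T by auto
  have len: "length (nths l T) = card T" if "T \<in> Pow {..<?n}" for T
  proof -
    have "{i. i < ?n \<and> i \<in> T} = T" using that by auto
    then show ?thesis by (simp add: length_nths)
  qed
  have "ext_wedge \<alpha> \<beta> ?L = (\<Sum>S\<in>(\<lambda>T. insert 0 (Suc ` T)) ` Pow {..<?n}. ?f S)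
      + (\<Sum>S\<in>image Suc ` Pow {..<?n}. ?f S)"
    unfolding ext_wedge_def length_Cons P by (rule sum.union_disjoint) auto
  also have "(\<Sum>S\<in>(\<lambda>T. insert 0 (Suc ` T)) ` Pow {..<?n}. ?f S) = ext_wedge (contr \<xi> \<alpha>) \<beta> l"
    unfolding sum.reindex[OF i1] ext_wedge_def
    by (rule sum.cong) (auto simp: contr_def nths_Cons s1 shuffle_sign_Suc fin)
  also have "(\<Sum>S\<in>image Suc ` Pow {..<?n}. ?f S) = ext_wedge (grade_inv \<alpha>) (contr \<xi> \<beta>) l"
    unfolding sum.reindex[OF i2] ext_wedge_def
    by (rule sum.cong) (auto simp: contr_def nths_Cons s1 shuffle_sign_Suc fin grade_inv_def len)
  finally show ?thesis .
qed

lemma ext_wedge_add_left: "ext_wedge (\<alpha> + \<alpha>') \<beta> = ext_wedge \<alpha> \<beta> + ext_wedge \<alpha>' \<beta>"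
  by (rule ext) (simp add: ext_wedge_def algebra_simps sum.distrib)

lemma ext_wedge_add_right: "ext_wedge \<alpha> (\<beta> + \<beta>') = ext_wedge \<alpha> \<beta> + ext_wedge \<alpha> \<beta>'"
  by (rule ext) (simp add: ext_wedge_def algebra_simps sum.distrib)

lemma ext_wedge_scale_left: "ext_wedge (c *\<^sub>R \<alpha>) \<beta> = c *\<^sub>R ext_wedge \<alpha> \<beta>"
  by (rule ext) (simp add: ext_wedge_def scaleR_fun_def sum_distrib_left mult_ac)

lemma ext_wedge_scale_right: "ext_wedge \<alpha> (c *\<^sub>R \<beta>) = c *\<^sub>R ext_wedge \<alpha> \<beta>"
  by (rule ext) (simp add: ext_wedge_def scaleR_fun_def sum_distrib_left mult_ac)

lemma ext_wedge_minus: "ext_wedge (- \<alpha>) \<beta> = - ext_wedge \<alpha> \<beta>" "ext_wedge \<alpha> (- \<beta>) = - ext_wedge \<alpha> \<beta>"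
  using ext_wedge_scale_left[of "-1"] ext_wedge_scale_right[of _ "-1"] by simp_all

lemma ext_wedge_0 [simp]: "ext_wedge 0 \<beta> = 0" "ext_wedge \<alpha> 0 = 0"
  by (auto simp: ext_wedge_def fun_eq_iff)

lemma contr_wedge:
  "contr \<xi> (ext_wedge \<alpha> \<beta>) = ext_wedge (contr \<xi> \<alpha>) \<beta> + ext_wedge (grade_inv \<alpha>) (contr \<xi> \<beta>)"
  by (rule ext) (simp add: contr_def ext_wedge_Cons[unfolded contr_def])

lemma grade_inv_wedge: "grade_inv (ext_wedge \<alpha> \<beta>) = ext_wedge (grade_inv \<alpha>) (grade_inv \<beta>)"
proof
  fix l :: "('a \<Rightarrow> real) list"
  have *: "(-1) ^ length l = (-1) ^ length (nths l S) * (-1::real) ^ length (nths l (- S))" for S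
    by (simp add: length_nths_compl flip: power_add)
  show "grade_inv (ext_wedge \<alpha> \<beta>) l = ext_wedge (grade_inv \<alpha>) (grade_inv \<beta>) l"
    unfolding grade_inv_def ext_wedge_def sum_distrib_left
    by (rule sum.cong) (simp_all add: * mult_ac)
qed

lemma contr_simps:
  "contr \<xi> (\<alpha> + \<beta>) = contr \<xi> \<alpha> + contr \<xi> \<beta>" "contr \<xi> (c *\<^sub>R \<alpha>) = c *\<^sub>R contr \<xi> \<alpha>"
  "contr \<xi> 0 = 0" "contr \<xi> ext_one = 0" "contr \<xi> (grade_inv \<alpha>) = (-1) *\<^sub>R grade_inv (contr \<xi> \<alpha>)"
  by (auto simp: contr_def fun_eq_iff scaleR_fun_def ext_one_def grade_inv_def)

lemma grade_inv_simps [simp]: "grade_inv (grade_inv \<alpha>) = \<alpha>" "grade_inv ext_one = ext_one"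
    "grade_inv \<alpha> [] = \<alpha> []" "grade_inv 0 = 0"
  by (auto simp: fun_eq_iff grade_inv_def ext_one_def simp flip: power_add mult_2)

lemma ext_wedge_assoc: "ext_wedge (ext_wedge \<alpha> \<beta>) \<gamma> = ext_wedge \<alpha> (ext_wedge \<beta> \<gamma>)"
proof
  show "ext_wedge (ext_wedge \<alpha> \<beta>) \<gamma> l = ext_wedge \<alpha> (ext_wedge \<beta> \<gamma>) l" for l
  proof (induction l arbitrary: \<alpha> \<beta> \<gamma>)
    case (Cons \<xi> l)
    then show ?case
      by (simp add: ext_wedge_Cons contr_wedge grade_inv_wedge ext_wedge_add_left ext_wedge_add_right)
  qed simp
qed

lemma ext_wedge_one [simp]: "ext_wedge ext_one \<alpha> = \<alpha>" "ext_wedge \<alpha> ext_one = \<alpha>"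
proof -
  have "ext_wedge ext_one \<alpha> l = \<alpha> l" for l
    by (induction l arbitrary: \<alpha>) (simp_all add: ext_wedge_Cons contr_simps, simp_all add: ext_one_def contr_def)
  then show "ext_wedge ext_one \<alpha> = \<alpha>" by (rule ext)
  have "ext_wedge \<alpha> ext_one l = \<alpha> l" for l
    by (induction l arbitrary: \<alpha>) (simp_all add: ext_wedge_Cons contr_simps, simp_all add: ext_one_def contr_def)
  then show "ext_wedge \<alpha> ext_one = \<alpha>" by (rule ext)
qed


section \<open>Alternating forms\<close>

definition homog :: "nat \<Rightarrow> 'v ext \<Rightarrow> bool" where
  "homog k \<omega> \<longleftrightarrow> (\<forall>l. length l \<noteq> k \<longrightarrow> \<omega> l = 0)"

lemma homog_contr: "homog (Suc k) \<alpha> \<Longrightarrow> homog k (contr \<xi> \<alpha>)"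
  by (auto simp: homog_def contr_def)

lemma contr_homog_0: "homog 0 \<alpha> \<Longrightarrow> contr \<xi> \<alpha> = 0"
  by (auto simp: homog_def contr_def fun_eq_iff)

lemma grade_inv_homog: "homog k \<alpha> \<Longrightarrow> grade_inv \<alpha> = (-1) ^ k *\<^sub>R \<alpha>"
  by (rule ext) (auto simp: homog_def grade_inv_def scaleR_fun_def)

lemma homog_wedge:
  assumes "homog p \<alpha>" "homog q \<beta>"
  shows "homog (p + q) (ext_wedge \<alpha> \<beta>)"
  unfolding homog_def
proof (intro allI impI)
  fix l :: "('a \<Rightarrow> real) list" assume l: "length l \<noteq> p + q"
  have "\<alpha> (nths l S) = 0 \<or> \<beta> (nths l (- S)) = 0" for S
    using assms length_nths_compl[of l S] l unfolding homog_def by metis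
  then show "ext_wedge \<alpha> \<beta> l = 0" unfolding ext_wedge_def by (intro sum.neutral) auto
qed

text \<open>Contraction lowers one of the two degrees, so induction on the list of covectors applies; the
  sign bookkeeping is \<open>(p - 1) q + q = p q\<close> and \<open>p + p (q - 1) = p q\<close>.\<close>

lemma ext_wedge_commute:
  assumes "homog p \<alpha>" "homog q \<beta>"
  shows "ext_wedge \<alpha> \<beta> = (-1) ^ (p * q) *\<^sub>R ext_wedge \<beta> \<alpha>"
proof
  show "ext_wedge \<alpha> \<beta> l = ((-1) ^ (p * q) *\<^sub>R ext_wedge \<beta> \<alpha>) l" for l
    using assms
  proof (induction l arbitrary: \<alpha> \<beta> p q)
    case Nil
    have "p \<noteq> 0 \<Longrightarrow> \<alpha> [] = 0" "q \<noteq> 0 \<Longrightarrow> \<beta> [] = 0" using Nil by (auto simp: homog_def)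
    then show ?case by (cases "p = 0"; cases "q = 0") (auto simp: scaleR_fun_def)
  next
    case (Cons \<xi> l)
    have 1: "ext_wedge (contr \<xi> \<alpha>) \<beta> l = (-1) ^ (p * q) * ext_wedge (grade_inv \<beta>) (contr \<xi> \<alpha>) l"
    proof (cases p)
      case 0
      then show ?thesis using Cons.prems by (simp add: contr_homog_0)
    next
      case (Suc p')
      have s: "(-1) ^ q * ((-1) ^ q * r) = r" for r :: real
        by (simp flip: power_add mult.assoc mult_2)
      show ?thesis
        using Cons.IH[OF homog_contr Cons.prems(2), of p' \<alpha> \<xi>] Cons.prems Suc
        by (simp add: grade_inv_homog[OF Cons.prems(2)] ext_wedge_scale_left power_add)
          (simp add: scaleR_fun_def power_add mult_ac s)
    qed
    have 2: "ext_wedge (grade_inv \<alpha>) (contr \<xi> \<beta>) l = (-1) ^ (p * q) * ext_wedge (contr \<xi> \<beta>) \<alpha> l"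
    proof (cases q)
      case 0
      then show ?thesis using Cons.prems by (simp add: contr_homog_0)
    next
      case (Suc q')
      have s: "(-1) ^ p * ((-1) ^ p * r) = r" for r :: real
        by (simp flip: power_add mult.assoc mult_2)
      show ?thesis
        using Cons.IH[OF Cons.prems(1) homog_contr, of q' \<beta> \<xi>] Cons.prems Suc
        by (simp add: grade_inv_homog[OF Cons.prems(1)] ext_wedge_scale_left power_add)
          (simp add: scaleR_fun_def power_add mult_ac s)
    qed
    show ?case by (simp add: ext_wedge_Cons 1 2 scaleR_fun_def algebra_simps)
  qed
qed

text \<open>Here and below \<open>Z l\<close> stands for the vanishing of an alternating expression at \<open>l\<close>. Only
  vanishing is tracked, and so the signs of permutations disappear.\<close>

lemma zero_closed_under_perm:
  assumes swap: "\<And>l1 a b l2. Z (l1 @ a # b # l2) \<Longrightarrow> Z (l1 @ b # a # l2)"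
    and "mset xs = mset ys" "Z (l1 @ xs)"
  shows "Z (l1 @ ys)"
  using assms(2,3)
proof (induction xs arbitrary: ys l1)
  case (Cons x xs)
  have "x \<in> set ys" using Cons.prems(1) by (metis list.set_intros(1) mset_eq_setD)
  then obtain y1 y2 where y: "ys = y1 @ x # y2" by (auto dest: split_list)
  then have "mset xs = mset (y1 @ y2)" using Cons.prems(1) by simp
  from Cons.IH[OF this, of "l1 @ [x]"] Cons.prems(2) have "Z (l1 @ x # y1 @ y2)" by simp
  moreover have "Z (l @ x # y1 @ y2) \<Longrightarrow> Z (l @ y1 @ x # y2)" for l
  proof (induction y1 arbitrary: l)
    case (Cons y y1)
    then show ?case using swap[of l x y "y1 @ y2"] Cons.IH[of "l @ [y]"] by simp
  qed simp
  ultimately show ?case unfolding y by blast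
qed simp

lemma zero_of_not_distinct:
  assumes swap: "\<And>l1 a b l2. Z (l1 @ a # b # l2) \<Longrightarrow> Z (l1 @ b # a # l2)"
    and "\<And>x r. set (x # r) \<subseteq> G \<Longrightarrow> Z (x # x # r)" "\<not> distinct l" "set l \<subseteq> G"
  shows "Z l"
proof -
  obtain a x b c where l: "l = a @ [x] @ b @ [x] @ c" using not_distinct_decomp[OF assms(3)] by blast
  have "Z ([] @ l)"
    by (rule zero_closed_under_perm[of Z "x # x # a @ b @ c"])
      (use assms swap l in \<open>auto simp: ac_simps\<close>)
  then show ?thesis by simp
qed

text \<open>Multilinearity enters only through the hypothesis \<open>slot\<close>: vanishing on generators in one slot
  implies vanishing on everything in that slot.\<close>

lemma zero_by_slots:
  assumes "B \<subseteq> G"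
    and slot: "\<And>l1 z l2. set l1 \<subseteq> G \<Longrightarrow> set l2 \<subseteq> G \<Longrightarrow> z \<in> G \<Longrightarrow>
        (\<And>b. b \<in> B \<Longrightarrow> Z (l1 @ b # l2)) \<Longrightarrow> Z (l1 @ z # l2)"
    and base: "\<And>l. length l = k \<Longrightarrow> set l \<subseteq> B \<Longrightarrow> Z l"
    and "length l = k" "set l \<subseteq> G"
  shows "Z l"
proof -
  have "Z (l1 @ l2)" if "set l1 \<subseteq> B" "set l2 \<subseteq> G" "length (l1 @ l2) = k" for l1 l2
    using that
  proof (induction l2 arbitrary: l1)
    case (Cons z l2)
    show ?case
    proof (rule slot)
      show "Z (l1 @ b # l2)" if "b \<in> B" for b
        using Cons.IH[of "l1 @ [b]"] Cons.prems that by simp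
    qed (use Cons.prems assms(1) in auto)
  qed (use base in simp)
  from this[of "[]" l] assms show ?thesis by simp
qed

text \<open>Alternating forms of unspecified degree. Alternation is required only for adjacent equal
  arguments, a condition that contraction visibly preserves; together with multilinearity it
  implies vanishing on all lists with a repetition.\<close>

definition alt_form :: "'v::real_vector set \<Rightarrow> 'v ext \<Rightarrow> bool" where
  "alt_form V \<omega> \<longleftrightarrow>
     (\<forall>l. \<not> set l \<subseteq> dual_space V \<longrightarrow> \<omega> l = 0) \<and>
     (\<forall>l1 l2. set l1 \<subseteq> dual_space V \<longrightarrow> set l2 \<subseteq> dual_space V \<longrightarrow>
        linear_on_subspace (dual_space V) (\<lambda>\<xi>. \<omega> (l1 @ \<xi> # l2))) \<and>
     (\<forall>l1 \<xi> l2. \<omega> (l1 @ \<xi> # \<xi> # l2) = 0)"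

lemma alt_formD:
  assumes "alt_form V \<omega>"
  shows "\<not> set l \<subseteq> dual_space V \<Longrightarrow> \<omega> l = 0"
    and "set l1 \<subseteq> dual_space V \<Longrightarrow> set l2 \<subseteq> dual_space V \<Longrightarrow>
        linear_on_subspace (dual_space V) (\<lambda>\<xi>. \<omega> (l1 @ \<xi> # l2))"
    and "\<omega> (l1 @ \<xi> # \<xi> # l2) = 0"
  using assms unfolding alt_form_def by blast+

lemma dual_space_add: "\<xi> \<in> dual_space V \<Longrightarrow> \<eta> \<in> dual_space V \<Longrightarrow> \<xi> + \<eta> \<in> dual_space V"
  and dual_space_scale: "\<xi> \<in> dual_space V \<Longrightarrow> c *\<^sub>R \<xi> \<in> dual_space V"
  and dual_space_0: "0 \<in> dual_space V"
  by (auto simp: dual_space_def linear_on_subspace_def scaleR_fun_def algebra_simps)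

lemma subspace_dual_space: "subspace (dual_space V)"
  unfolding subspace_def using dual_space_add dual_space_scale dual_space_0 by blast

lemma alt_form_swap:
  assumes "alt_form V \<omega>"
  shows "\<omega> (l1 @ a # b # l2) = - \<omega> (l1 @ b # a # l2)"
proof (cases "set (l1 @ a # b # l2) \<subseteq> dual_space V")
  case False
  have *: "\<omega> l = 0" if "\<not> set l \<subseteq> dual_space V" for l
    using assms that unfolding alt_form_def by blast
  have "\<omega> (l1 @ a # b # l2) = 0" by (rule *[OF False])
  moreover have "\<omega> (l1 @ b # a # l2) = 0" by (rule *) (use False in auto)
  ultimately show ?thesis by simp
next
  case True
  note W = True[simplified]
  have l: "\<omega> (l1 @ (\<xi> + \<eta>) # l2) = \<omega> (l1 @ \<xi> # l2) + \<omega> (l1 @ \<eta> # l2)"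
    if "set l1 \<subseteq> dual_space V" "set l2 \<subseteq> dual_space V" "\<xi> \<in> dual_space V" "\<eta> \<in> dual_space V"
    for l1 l2 \<xi> \<eta>
    using assms that unfolding alt_form_def linear_on_subspace_def by blast
  have z: "\<omega> (l1 @ \<xi> # \<xi> # l2) = 0" for \<xi> using assms by (simp add: alt_form_def)
  have "\<omega> (l1 @ (a + b) # (a + b) # l2) = \<omega> (l1 @ a # (a + b) # l2) + \<omega> (l1 @ b # (a + b) # l2)"
    using W by (intro l) (auto intro: dual_space_add)
  moreover have "\<omega> (l1 @ c # (a + b) # l2) = \<omega> (l1 @ c # a # l2) + \<omega> (l1 @ c # b # l2)"
    if "c \<in> dual_space V" for c
    using l[of "l1 @ [c]" l2 a b] W that by simp
  ultimately show ?thesis using W z[of a] z[of b] z[of "a + b"] by (metis add.right_neutral add.left_neutral eq_neg_iff_add_eq_0)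
qed

lemma alt_form_perm:
  assumes "alt_form V \<omega>" "mset xs = mset ys" "\<omega> xs = 0"
  shows "\<omega> ys = 0"
proof -
  have "\<omega> ([] @ ys) = 0"
  proof (rule zero_closed_under_perm[of "\<lambda>l. \<omega> l = 0"])
    show "\<omega> (l1 @ b # a # l2) = 0" if "\<omega> (l1 @ a # b # l2) = 0" for l1 a b l2
      using that alt_form_swap[OF assms(1), of l1 a b l2] by simp
  qed (use assms in auto)
  then show ?thesis by simp
qed

lemma alt_form_not_distinct:
  assumes "alt_form V \<omega>" "\<not> distinct l"
  shows "\<omega> l = 0"
proof (rule zero_of_not_distinct[of "\<lambda>l. \<omega> l = 0" UNIV])
  show "\<omega> (x # x # r) = 0" for x r
    using alt_formD(3)[OF assms(1), of "[]" x r] by simp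
  show "\<omega> (l1 @ b # a # l2) = 0" if "\<omega> (l1 @ a # b # l2) = 0" for l1 a b l2
    using that alt_form_swap[OF assms(1), of l1 a b l2] by simp
qed (use assms in auto)

lemma ext_power_space_iff: "\<omega> \<in> ext_power_space k V \<longleftrightarrow> alt_form V \<omega> \<and> homog k \<omega>"
proof
  assume w: "\<omega> \<in> ext_power_space k V"
  have out: "\<not> (length l = k \<and> set l \<subseteq> dual_space V) \<Longrightarrow> \<omega> l = 0" for l
    using w unfolding ext_power_space_def by blast
  have nd: "\<not> distinct l \<Longrightarrow> \<omega> l = 0" for l
    using w unfolding ext_power_space_def by blast
  have "linear_on_subspace (dual_space V) (\<lambda>\<xi>. \<omega> (l1 @ \<xi> # l2))"
    if "set l1 \<subseteq> dual_space V" "set l2 \<subseteq> dual_space V" for l1 l2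
  proof (cases "length l1 + length l2 + 1 = k")
    case True
    have "linear_on_subspace (dual_space V) (\<lambda>\<xi>. \<omega> ((l1 @ 0 # l2)[length l1 := \<xi>]))"
    proof -
      have "\<forall>\<xi>s i. length \<xi>s = k \<and> set \<xi>s \<subseteq> dual_space V \<and> i < k \<longrightarrow>
          linear_on_subspace (dual_space V) (\<lambda>\<xi>. \<omega> (\<xi>s[i := \<xi>]))"
        using w unfolding ext_power_space_def by blast
      from this[rule_format, of "l1 @ 0 # l2" "length l1"] show ?thesis
        using that True dual_space_0[of V] by simp
    qed
    then show ?thesis by simp
  next
    case False
    then have "\<omega> (l1 @ \<xi> # l2) = 0" for \<xi> by (intro out) auto
    then show ?thesis by (simp add: linear_on_subspace_def)
  qed
  then show "alt_form V \<omega> \<and> homog k \<omega>"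
    unfolding alt_form_def homog_def using out by (auto intro: nd)
next
  assume w: "alt_form V \<omega> \<and> homog k \<omega>"
  have lin: "linear_on_subspace (dual_space V) (\<lambda>\<xi>. \<omega> (l[i := \<xi>]))"
    if "set l \<subseteq> dual_space V" "i < length l" for l i
  proof -
    have "linear_on_subspace (dual_space V) (\<lambda>\<xi>. \<omega> (take i l @ \<xi> # drop (Suc i) l))"
      using w that(1) by (intro alt_formD(2)) (auto dest: in_set_takeD in_set_dropD)
    then show ?thesis using that by (simp add: upd_conv_take_nth_drop)
  qed
  then show "\<omega> \<in> ext_power_space k V"
    unfolding ext_power_space_def mem_Collect_eq
  proof (intro conjI allI impI)
    show "\<omega> l = 0" if "\<not> (length l = k \<and> set l \<subseteq> dual_space V)" for l
      using that w alt_formD(1)[of V \<omega> l] unfolding homog_def by blast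
  qed (use w lin alt_form_not_distinct[of V \<omega>] in blast)+
qed

lemma alt_form_0: "alt_form V 0"
  by (simp add: alt_form_def linear_on_subspace_def)

lemma alt_form_add: "alt_form V \<alpha> \<Longrightarrow> alt_form V \<beta> \<Longrightarrow> alt_form V (\<alpha> + \<beta>)"
  by (simp add: alt_form_def linear_on_subspace_def algebra_simps)

lemma alt_form_scale: "alt_form V \<alpha> \<Longrightarrow> alt_form V (c *\<^sub>R \<alpha>)"
  by (simp add: alt_form_def linear_on_subspace_def algebra_simps scaleR_fun_def)

lemma alt_form_contr:
  assumes "alt_form V \<alpha>"
  shows "alt_form V (contr \<xi> \<alpha>)"
proof (cases "\<xi> \<in> dual_space V")
  case True
  have "linear_on_subspace (dual_space V) (\<lambda>\<eta>. \<alpha> (\<xi> # l1 @ \<eta> # l2))"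
    if "set l1 \<subseteq> dual_space V" "set l2 \<subseteq> dual_space V" for l1 l2
    using alt_formD(2)[OF assms, of "\<xi> # l1" l2] that True by simp
  moreover have "\<alpha> (\<xi> # l1 @ \<eta> # \<eta> # l2) = 0" for l1 \<eta> l2
    using alt_formD(3)[OF assms, of "\<xi> # l1" \<eta> l2] by simp
  ultimately show ?thesis using assms by (simp add: alt_form_def contr_def)
next
  case False
  then have "contr \<xi> \<alpha> = 0" using assms by (auto simp: alt_form_def contr_def fun_eq_iff)
  then show ?thesis by (simp add: alt_form_0)
qed

lemma alt_form_grade_inv: "alt_form V \<alpha> \<Longrightarrow> alt_form V (grade_inv \<alpha>)"
  by (simp add: alt_form_def linear_on_subspace_def grade_inv_def algebra_simps)

lemma alt_form_contr_add:
  assumes "alt_form V \<alpha>" "\<xi> \<in> dual_space V" "\<eta> \<in> dual_space V"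
  shows "contr (\<xi> + \<eta>) \<alpha> = contr \<xi> \<alpha> + contr \<eta> \<alpha>" "contr (c *\<^sub>R \<xi>) \<alpha> = c *\<^sub>R contr \<xi> \<alpha>"
proof -
  have "contr (\<xi> + \<eta>) \<alpha> l = (contr \<xi> \<alpha> + contr \<eta> \<alpha>) l \<and> contr (c *\<^sub>R \<xi>) \<alpha> l = (c *\<^sub>R contr \<xi> \<alpha>) l" for l
  proof (cases "set l \<subseteq> dual_space V")
    case True
    then have "linear_on_subspace (dual_space V) (\<lambda>\<xi>. \<alpha> ([] @ \<xi> # l))"
      by (intro alt_formD(2)[OF assms(1)]) auto
    then show ?thesis using assms(2,3) by (simp add: contr_def linear_on_subspace_def scaleR_fun_def)
  next
    case False
    then have "\<alpha> (\<xi> # l) = 0" for \<xi> using assms(1) by (auto simp: alt_form_def)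
    then show ?thesis by (simp add: contr_def scaleR_fun_def)
  qed
  then show "contr (\<xi> + \<eta>) \<alpha> = contr \<xi> \<alpha> + contr \<eta> \<alpha>" "contr (c *\<^sub>R \<xi>) \<alpha> = c *\<^sub>R contr \<xi> \<alpha>"
    by blast+
qed

lemma alt_form_contr_contr: "alt_form V \<alpha> \<Longrightarrow> contr \<xi> (contr \<xi> \<alpha>) = 0"
  using alt_formD(3)[of V \<alpha> "[]"] by (auto simp: contr_def fun_eq_iff)

text \<open>For the alternating property: two contractions by the same covector annihilate each factor, and
  in the product the two mixed terms cancel, for contraction anticommutes with the grading
  involution. Covectors further to the left only replace the factors by their contractions.\<close>

lemma alt_form_wedge:
  assumes "alt_form V \<alpha>" "alt_form V \<beta>"
  shows "alt_form V (ext_wedge \<alpha> \<beta>)"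
proof -
  have out: "ext_wedge \<alpha> \<beta> l = 0" if "\<not> set l \<subseteq> dual_space V" for l
    using assms that
  proof (induction l arbitrary: \<alpha> \<beta>)
    case (Cons \<xi> l)
    show ?case
    proof (cases "\<xi> \<in> dual_space V")
      case True
      then show ?thesis using Cons
        by (simp add: ext_wedge_Cons alt_form_contr alt_form_grade_inv)
    next
      case False
      then have "contr \<xi> \<alpha> = 0" "contr \<xi> \<beta> = 0"
        using Cons.prems by (auto simp: alt_form_def contr_def fun_eq_iff)
      then show ?thesis by (simp add: ext_wedge_Cons)
    qed
  qed simp
  have lin: "linear_on_subspace (dual_space V) (\<lambda>\<xi>. ext_wedge \<alpha> \<beta> (l1 @ \<xi> # l2))" for l1 l2
    using assms
  proof (induction l1 arbitrary: \<alpha> \<beta>)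
    case Nil
    then show ?case
      by (simp add: linear_on_subspace_def ext_wedge_Cons alt_form_contr_add ext_wedge_add_left
          ext_wedge_add_right ext_wedge_scale_left ext_wedge_scale_right)
        (simp add: scaleR_fun_def algebra_simps)
  next
    case (Cons \<eta> l1)
    from Cons.IH[OF alt_form_contr[OF Cons.prems(1)] Cons.prems(2)]
      Cons.IH[OF alt_form_grade_inv[OF Cons.prems(1)] alt_form_contr[OF Cons.prems(2)]]
    show ?case by (simp add: linear_on_subspace_def ext_wedge_Cons algebra_simps)
  qed
  have adj: "ext_wedge \<alpha> \<beta> (l1 @ \<xi> # \<xi> # l2) = 0" for l1 \<xi> l2
    using assms
  proof (induction l1 arbitrary: \<alpha> \<beta>)
    case Nil
    then show ?case
      by (simp add: ext_wedge_Cons alt_form_contr_contr contr_simps ext_wedge_minus)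
  next
    case (Cons \<eta> l1)
    then show ?case by (simp add: ext_wedge_Cons alt_form_contr alt_form_grade_inv)
  qed
  show ?thesis unfolding alt_form_def using out lin adj by blast
qed

lemma ext_power_space_wedge:
  "\<alpha> \<in> ext_power_space p V \<Longrightarrow> \<beta> \<in> ext_power_space q V \<Longrightarrow> ext_wedge \<alpha> \<beta> \<in> ext_power_space (p + q) V"
  by (simp add: ext_power_space_iff alt_form_wedge homog_wedge)

lemma subspace_ext_power_space: "subspace (ext_power_space k V)"
  by (auto simp: subspace_def ext_power_space_iff alt_form_0 alt_form_add alt_form_scale)
    (auto simp: homog_def scaleR_fun_def)

lemma ext_one_in: "ext_one \<in> ext_power_space 0 V"
  by (auto simp: ext_power_space_iff alt_form_def homog_def ext_one_def linear_on_subspace_def)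

lemma ext_vec_in: "ext_vec V v \<in> ext_power_space 1 V"
proof -
  have "linear_on_subspace (dual_space V) (\<lambda>\<xi>. ext_vec V v (l1 @ \<xi> # l2))" for l1 l2
    unfolding linear_on_subspace_def
    by (cases l1; cases l2) (simp_all add: ext_vec_def dual_space_add dual_space_scale,
      simp add: scaleR_fun_def)
  moreover have "ext_vec V v (l1 @ \<xi> # \<xi> # l2) = 0" "\<not> set l \<subseteq> dual_space V \<Longrightarrow> ext_vec V v l = 0"
      "length l \<noteq> 1 \<Longrightarrow> ext_vec V v l = 0" for l1 l2 l \<xi>
    by (auto simp: ext_vec_def)
  ultimately show ?thesis
    unfolding ext_power_space_iff alt_form_def homog_def by blast
qed

lemma wedge_list_Cons: "wedge_list V (v # vs) = ext_wedge (ext_vec V v) (wedge_list V vs)"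
  and wedge_list_Nil: "wedge_list V [] = ext_one"
  by (simp_all add: wedge_list_def)

lemma wedge_list_append: "wedge_list V (vs @ ws) = ext_wedge (wedge_list V vs) (wedge_list V ws)"
  by (induction vs) (simp_all add: wedge_list_Cons wedge_list_Nil ext_wedge_assoc)

lemma wedge_list_in: "wedge_list V vs \<in> ext_power_space (length vs) V"
proof (induction vs)
  case (Cons v vs)
  then show ?case using ext_power_space_wedge[OF ext_vec_in[of V v] Cons] by (simp add: wedge_list_Cons)
qed (simp add: wedge_list_Nil ext_one_in)

lemma ext_vec_add: "u \<in> V \<Longrightarrow> v \<in> V \<Longrightarrow> ext_vec V (u + v) = ext_vec V u + ext_vec V v"
  and ext_vec_scale: "u \<in> V \<Longrightarrow> ext_vec V (c *\<^sub>R u) = c *\<^sub>R ext_vec V u"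
  by (auto simp: ext_vec_def fun_eq_iff scaleR_fun_def length_Suc_conv dual_space_def
      linear_on_subspace_def)

lemma contr_ext_vec: "\<xi> \<in> dual_space V \<Longrightarrow> contr \<xi> (ext_vec V v) = \<xi> v *\<^sub>R ext_one"
  by (auto simp: contr_def ext_vec_def fun_eq_iff ext_one_def scaleR_fun_def)

lemma grade_inv_ext_vec: "grade_inv (ext_vec V v) = (-1) *\<^sub>R ext_vec V v"
  using grade_inv_homog[of 1 "ext_vec V v"] ext_vec_in[of V v] by (simp add: ext_power_space_iff)

lemma contr_vec_wedge:
  "\<xi> \<in> dual_space V \<Longrightarrow>
    contr \<xi> (ext_wedge (ext_vec V v) \<omega>) = \<xi> v *\<^sub>R \<omega> + (-1) *\<^sub>R ext_wedge (ext_vec V v) (contr \<xi> \<omega>)"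
  by (simp add: contr_wedge contr_ext_vec grade_inv_ext_vec ext_wedge_scale_left ext_wedge_minus)

lemma contr_wedge_list_0:
  "\<xi> \<in> dual_space V \<Longrightarrow> (\<And>v. v \<in> set vs \<Longrightarrow> \<xi> v = 0) \<Longrightarrow> contr \<xi> (wedge_list V vs) = 0"
  by (induction vs) (simp_all add: wedge_list_Nil wedge_list_Cons contr_simps contr_vec_wedge)

lemma vec_wedge_eval_0:
  assumes "set l \<subseteq> dual_space V" "\<And>\<xi>. \<xi> \<in> set l \<Longrightarrow> \<xi> v = 0"
  shows "ext_wedge (ext_vec V v) \<omega> l = 0"
  using assms
proof (induction l arbitrary: \<omega>)
  case (Cons \<xi> l)
  have "ext_wedge (ext_vec V v) \<omega> (\<xi> # l) = contr \<xi> (ext_wedge (ext_vec V v) \<omega>) l"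
    by (simp add: contr_def)
  also have "\<dots> = - ext_wedge (ext_vec V v) (contr \<xi> \<omega>) l"
    using Cons.prems by (subst contr_vec_wedge) (auto simp: scaleR_fun_def)
  finally show ?case using Cons by simp
qed (simp add: ext_vec_def)


section \<open>Dual bases\<close>

text \<open>The extension by zero makes the coordinate function an element of the dual space as it is
  encoded here.\<close>

definition dual_cov :: "'v::real_vector set \<Rightarrow> 'v list \<Rightarrow> nat \<Rightarrow> 'v \<Rightarrow> real" where
  "dual_cov V bs i = (\<lambda>v. if v \<in> V then representation (set bs) v (bs ! i) else 0)"

context
  fixes V :: "'v::real_vector set" and bs :: "'v list"
  assumes bs: "is_basis_of V bs"
begin

lemma dual_cov_in: "dual_cov V bs i \<in> dual_space V"
proof -
  have "subspace V" using bs by (metis is_basis_of_def subspace_span)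
  then have "u + v \<in> V" "c *\<^sub>R u \<in> V" if "u \<in> V" "v \<in> V" for u v c
    using that by (auto simp: subspace_def)
  then show ?thesis
    using bs unfolding dual_cov_def dual_space_def linear_on_subspace_def is_basis_of_def
    by (auto simp: real_vector.representation_add real_vector.representation_scale)
qed

lemma basis_in: "i < length bs \<Longrightarrow> bs ! i \<in> V"
  using bs unfolding is_basis_of_def by (metis nth_mem real_vector.span_base)

lemma dual_cov_basis:
  assumes "i < length bs" "j < length bs"
  shows "dual_cov V bs i (bs ! j) = (if i = j then 1 else 0)"
  using bs assms basis_in[OF assms(2)] unfolding dual_cov_def is_basis_of_def
  by (simp add: real_vector.representation_basis nth_eq_iff_index_eq)

lemma basis_expansion:
  assumes "v \<in> V"
  shows "v = (\<Sum>i<length bs. dual_cov V bs i v *\<^sub>R bs ! i)"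
proof -
  have "v = (\<Sum>b\<in>set bs. representation (set bs) v b *\<^sub>R b)"
    using bs assms unfolding is_basis_of_def
    by (simp add: real_vector.sum_representation_eq[of "set bs" v "set bs"])
  also have "\<dots> = (\<Sum>i<length bs. representation (set bs) v (bs ! i) *\<^sub>R bs ! i)"
    using bs bij_betw_nth[of bs "{..<length bs}" "set bs"] unfolding is_basis_of_def
    by (intro sum.reindex_bij_betw[symmetric]) auto
  finally show ?thesis using assms by (simp add: dual_cov_def)
qed

lemma dual_expansion:
  assumes "\<xi> \<in> dual_space V"
  shows "\<xi> = (\<Sum>i<length bs. \<xi> (bs ! i) *\<^sub>R dual_cov V bs i)"
proof
  fix v
  show "\<xi> v = (\<Sum>i<length bs. \<xi> (bs ! i) *\<^sub>R dual_cov V bs i) v"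
  proof (cases "v \<in> V")
    case False
    then show ?thesis using assms by (simp add: fun_sum_apply dual_cov_def scaleR_fun_def dual_space_def)
  next
    case True
    have "subspace V" "linear_on_subspace V \<xi>"
      using bs assms by (metis is_basis_of_def subspace_span, simp add: dual_space_def)
    from linear_on_subspace_sum[OF this, of "{..<length bs}" "(!) bs" "\<lambda>i. dual_cov V bs i v"]
    show ?thesis
      using basis_expansion[OF True] basis_in by (simp add: fun_sum_apply scaleR_fun_def mult.commute)
  qed
qed

end

text \<open>The multi-indices of degree \<open>k\<close>, in the order in which a frame of a bundle induces the frame of
  its exterior power.\<close>

definition incr_lists :: "nat \<Rightarrow> nat \<Rightarrow> nat list list" where
  "incr_lists n k = filter (\<lambda>I. length I = k) (subseqs [0..<n])"

lemma sorted_wrt_subseqs: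
  "sorted_wrt (<) (xs :: nat list) \<Longrightarrow> ys \<in> set (subseqs xs) \<Longrightarrow> sorted_wrt (<) ys \<and> set ys \<subseteq> set xs"
proof (induction xs arbitrary: ys)
  case (Cons x xs)
  have IH: "sorted_wrt (<) zs \<and> set zs \<subseteq> set xs" if "zs \<in> set (subseqs xs)" for zs
    using Cons.IH[OF _ that] Cons.prems(1) by simp
  show ?case using Cons.prems IH by (fastforce simp: Let_def)
qed simp

lemma set_incr_lists:
  "set (incr_lists n k) = {I. sorted_wrt (<) I \<and> set I \<subseteq> {..<n} \<and> length I = k}"
proof (intro equalityI subsetI)
  fix I assume "I \<in> set (incr_lists n k)"
  then show "I \<in> {I. sorted_wrt (<) I \<and> set I \<subseteq> {..<n} \<and> length I = k}"
    using sorted_wrt_subseqs[of "[0..<n]" I] by (auto simp: incr_lists_def)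
next
  fix I assume I: "I \<in> {I. sorted_wrt (<) I \<and> set I \<subseteq> {..<n} \<and> length I = k}"
  then obtain J where J: "J \<in> set (subseqs [0..<n])" "set J = set I"
    using subset_subseqs[of "set I" "[0..<n]"] by (auto simp: lessThan_atLeast0)
  moreover have "sorted_wrt (<) J" using sorted_wrt_subseqs[of "[0..<n]" J] J by simp
  ultimately have "J = I" using I strict_sorted_equal by blast
  then show "I \<in> set (incr_lists n k)" using I J by (simp add: incr_lists_def)
qed

lemma distinct_incr_lists: "distinct (incr_lists n k)"
  unfolding incr_lists_def
  by (intro distinct_filter) (metis distinct_map distinct_set_subseqs distinct_upt)

lemma incr_lists_empty: "n < k \<Longrightarrow> incr_lists n k = []"
proof -
  assume "n < k"
  have "length I \<le> n" if "sorted_wrt (<) I" "set I \<subseteq> {..<n}" for I :: "nat list"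
    using that card_mono[of "{..<n}" "set I"] by (simp add: strict_sorted_iff distinct_card)
  then have "I \<notin> set (incr_lists n k)" for I
    using \<open>n < k\<close> unfolding set_incr_lists mem_Collect_eq by (metis leD)
  then show ?thesis by (metis list.set_intros(1) neq_Nil_conv)
qed

abbreviation basis_wedge :: "'v::real_vector set \<Rightarrow> 'v list \<Rightarrow> nat list \<Rightarrow> 'v ext" where
  "basis_wedge V bs I \<equiv> wedge_list V (map ((!) bs) I)"

context
  fixes V :: "'v::real_vector set" and bs :: "'v list"
  assumes bs: "is_basis_of V bs"
begin

abbreviation (input) "dcov \<equiv> dual_cov V bs"

lemma set_dcov: "set (map dcov I) \<subseteq> dual_space V"
  using dual_cov_in[OF bs] by auto

lemma basis_wedge_dual:
  assumes "sorted_wrt (<) I" "sorted_wrt (<) J" "set I \<subseteq> {..<length bs}" "set J \<subseteq> {..<length bs}"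
    "length I = length J"
  shows "basis_wedge V bs I (map dcov J) = (if I = J then 1 else 0)"
  using assms
proof (induction I arbitrary: J)
  case Nil
  then show ?case by (simp add: wedge_list_Nil ext_one_def)
next
  case (Cons i I)
  then obtain j J' where J: "J = j # J'" by (cases J) auto
  have d: "dcov a (bs ! b) = (if a = b then 1 else 0)" if "a < length bs" "b < length bs" for a b
    by (rule dual_cov_basis[OF bs that])
  have "basis_wedge V bs (i # I) (map dcov J) =
      contr (dcov j) (ext_wedge (ext_vec V (bs ! i)) (basis_wedge V bs I)) (map dcov J')"
    by (simp add: J contr_def wedge_list_Cons)
  also have "\<dots> = dcov j (bs ! i) * basis_wedge V bs I (map dcov J') -
      ext_wedge (ext_vec V (bs ! i)) (contr (dcov j) (basis_wedge V bs I)) (map dcov J')"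
    by (subst contr_vec_wedge[OF dual_cov_in[OF bs]]) (simp add: scaleR_fun_def)
  finally have eq: "basis_wedge V bs (i # I) (map dcov J) = \<dots>" .
  consider "i = j" | "i < j" | "j < i" by linarith
  then show ?case
  proof cases
    case 1
    have "contr (dcov j) (basis_wedge V bs I) = 0"
      by (rule contr_wedge_list_0[OF dual_cov_in[OF bs]]) (use Cons.prems 1 J in \<open>force simp: d\<close>)
    then show ?thesis unfolding eq using 1 Cons J by (simp add: d)
  next
    case 2
    have "ext_wedge (ext_vec V (bs ! i)) (contr (dcov j) (basis_wedge V bs I)) (map dcov J') = 0"
      by (rule vec_wedge_eval_0[OF set_dcov]) (use Cons.prems 2 J in \<open>force simp: d\<close>)
    then show ?thesis unfolding eq using 2 Cons.prems J by (simp add: d)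
  next
    case 3
    have "contr (dcov j) (basis_wedge V bs I) = 0"
      by (rule contr_wedge_list_0[OF dual_cov_in[OF bs]]) (use Cons.prems 3 J in \<open>force simp: d\<close>)
    then show ?thesis unfolding eq using 3 Cons.prems J by (simp add: d)
  qed
qed

text \<open>Slot by slot the arguments are reduced to the dual basis; then they are sorted.\<close>

lemma ext_power_eq_0:
  assumes \<omega>: "\<omega> \<in> ext_power_space k V"
    and z: "\<And>I. I \<in> set (incr_lists (length bs) k) \<Longrightarrow> \<omega> (map dcov I) = 0"
  shows "\<omega> = 0"
proof
  fix l
  have alt: "alt_form V \<omega>" and hom: "homog k \<omega>" using \<omega> by (auto simp: ext_power_space_iff)
  show "\<omega> l = 0 l"
  proof (cases "length l = k \<and> set l \<subseteq> dual_space V")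
    case False
    then show ?thesis using alt_formD(1)[OF alt, of l] hom by (auto simp: homog_def)
  next
    case True
    let ?B = "dcov ` {..<length bs}"
    have "\<omega> l = 0"
    proof (rule zero_by_slots[of ?B "dual_space V" "\<lambda>l. \<omega> l = 0" k])
      show "?B \<subseteq> dual_space V" using dual_cov_in[OF bs] by auto
      fix l1 \<xi> l2 assume l: "set l1 \<subseteq> dual_space V" "set l2 \<subseteq> dual_space V" "\<xi> \<in> dual_space V"
        and b: "\<And>b. b \<in> ?B \<Longrightarrow> \<omega> (l1 @ b # l2) = 0"
      have "\<omega> (l1 @ (\<Sum>i<length bs. \<xi> (bs ! i) *\<^sub>R dcov i) # l2) =
          (\<Sum>i<length bs. \<xi> (bs ! i) *\<^sub>R \<omega> (l1 @ dcov i # l2))"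
        by (rule linear_on_subspace_sum[OF subspace_dual_space alt_formD(2)[OF alt l(1,2)] dual_cov_in[OF bs]])
      also have "\<dots> = 0" using b by (intro sum.neutral) auto
      finally show "\<omega> (l1 @ \<xi> # l2) = 0" using dual_expansion[OF bs l(3)] by simp
    next
      fix l assume l: "length l = k" "set l \<subseteq> ?B"
      then have "l \<in> lists (dcov ` {..<length bs})" by auto
      then have "l \<in> map dcov ` lists {..<length bs}" by (simp only: lists_image)
      then obtain J where J: "l = map dcov J" "set J \<subseteq> {..<length bs}" by auto
      show "\<omega> l = 0"
      proof (cases "distinct J")
        case False
        then have "\<not> distinct l" using J by (auto simp: distinct_map)
        then show ?thesis by (rule alt_form_not_distinct[OF alt])
      next
        case True
        have "\<omega> (map dcov (sort J)) = 0"
          using True l J by (intro z) (auto simp: set_incr_lists strict_sorted_iff)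
        then show ?thesis unfolding J(1) by (rule alt_form_perm[OF alt, rotated]) simp
      qed
    qed (use True in auto)
    then show ?thesis by simp
  qed
qed

lemma basis_wedge_in:
  "I \<in> set (incr_lists n k) \<Longrightarrow> basis_wedge V bs I \<in> ext_power_space k V"
  using wedge_list_in[of V "map ((!) bs) I"] by (simp add: set_incr_lists)

lemma ext_power_expansion:
  assumes \<omega>: "\<omega> \<in> ext_power_space k V"
  shows "\<omega> = (\<Sum>I\<in>set (incr_lists (length bs) k). \<omega> (map dcov I) *\<^sub>R basis_wedge V bs I)"
    (is "\<omega> = ?S")
proof -
  have "?S \<in> ext_power_space k V"
    by (intro subspace_sum subspace_scale subspace_ext_power_space basis_wedge_in)
  then have "\<omega> - ?S \<in> ext_power_space k V" using \<omega> subspace_diff subspace_ext_power_space by blast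
  then have "\<omega> - ?S = 0"
  proof (rule ext_power_eq_0)
    fix J assume J: "J \<in> set (incr_lists (length bs) k)"
    have "?S (map dcov J) = (\<Sum>I\<in>set (incr_lists (length bs) k). if I = J then \<omega> (map dcov I) else 0)"
      unfolding fun_sum_apply[of _ _ "map dcov J"]
      by (rule sum.cong[OF refl])
        (use J basis_wedge_dual in \<open>auto simp: set_incr_lists scaleR_fun_def\<close>)
    also have "\<dots> = \<omega> (map dcov J)" using J by simp
    finally show "(\<omega> - ?S) (map dcov J) = 0" by simp
  qed
  then show ?thesis by simp
qed

lemma ext_power_space_above_rank: "\<omega> \<in> ext_power_space k V \<Longrightarrow> length bs < k \<Longrightarrow> \<omega> = 0"
  using ext_power_expansion[of \<omega> k] incr_lists_empty by simp

text \<open>A coefficient of \<open>q\<close> belongs to a multi-index of length \<open>m\<close>, which omits some \<open>i\<close>. Contracting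
  \<open>e\<^sub>i \<and> q\<close> with the \<open>i\<close>-th covector and evaluating at this multi-index returns the coefficient.\<close>

lemma wedge_nondegenerate_step:
  assumes q: "q \<in> ext_power_space m V" "m < length bs"
    and z: "\<And>i. i < length bs \<Longrightarrow> ext_wedge (ext_vec V (bs ! i)) q = 0"
  shows "q = 0"
proof (rule ext_power_eq_0[OF q(1)])
  fix I assume I: "I \<in> set (incr_lists (length bs) m)"
  have "card (set I) \<le> m" using I by (auto simp: set_incr_lists card_length)
  then have "\<not> {..<length bs} \<subseteq> set I"
    using card_mono[of "set I" "{..<length bs}"] q(2) by auto
  then obtain i where i: "i < length bs" "i \<notin> set I" by auto
  have "0 = contr (dcov i) (ext_wedge (ext_vec V (bs ! i)) q) (map dcov I)"
    by (simp add: z[OF i(1)] contr_simps)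
  also have "\<dots> = q (map dcov I) - ext_wedge (ext_vec V (bs ! i)) (contr (dcov i) q) (map dcov I)"
    by (subst contr_vec_wedge[OF dual_cov_in[OF bs]])
      (simp add: dual_cov_basis[OF bs i(1) i(1)])
  also have "ext_wedge (ext_vec V (bs ! i)) (contr (dcov i) q) (map dcov I) = 0"
  proof (rule vec_wedge_eval_0[OF set_dcov])
    fix \<xi> assume "\<xi> \<in> set (map dcov I)"
    then obtain j where j: "\<xi> = dcov j" "j \<in> set I" by auto
    then show "\<xi> (bs ! i) = 0" using dual_cov_basis[OF bs, of j i] i I by (auto simp: set_incr_lists)
  qed
  finally show "q (map dcov I) = 0" by simp
qed

text \<open>Nondegeneracy of the wedge pairing into the top degree: the factors of \<open>vs\<close> are split off one
  at a time, each step raising the degree of \<open>q\<close> by one.\<close>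

lemma wedge_nondegenerate:
  assumes "q \<in> ext_power_space m V" "m + d = length bs"
    and "\<And>vs. set vs \<subseteq> set bs \<Longrightarrow> length vs = d \<Longrightarrow> ext_wedge (wedge_list V vs) q = 0"
  shows "q = 0"
  using assms
proof (induction d arbitrary: m q)
  case 0
  from 0(3)[of "[]"] show ?case by (simp add: wedge_list_Nil)
next
  case (Suc d)
  show ?case
  proof (rule wedge_nondegenerate_step[OF Suc.prems(1)])
    fix i assume i: "i < length bs"
    show "ext_wedge (ext_vec V (bs ! i)) q = 0"
    proof (rule Suc.IH)
      show "ext_wedge (ext_vec V (bs ! i)) q \<in> ext_power_space (1 + m) V"
        by (rule ext_power_space_wedge[OF ext_vec_in Suc.prems(1)])
      fix vs assume vs: "set vs \<subseteq> set bs" "length vs = d"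
      from Suc.prems(3)[of "vs @ [bs ! i]"] show
        "ext_wedge (wedge_list V vs) (ext_wedge (ext_vec V (bs ! i)) q) = 0"
        using vs i by (simp add: wedge_list_append wedge_list_Cons wedge_list_Nil ext_wedge_assoc
            zero_fun_def)
    qed (use Suc.prems(2) in simp)
  qed (use Suc.prems(2) in simp)
qed

end


section \<open>Sections of a vector bundle and of its exterior powers\<close>

definition wedge_sections :: "('m, 'v::real_vector, 'z) vbundle_scheme \<Rightarrow> ('m \<Rightarrow> 'v) list \<Rightarrow> 'm \<Rightarrow> 'v ext" where
  "wedge_sections E Xs = (\<lambda>x. wedge_list (fibre E x) (map (\<lambda>X. X x) Xs))"

lemma wedge_list_scale:
  "set vs \<subseteq> V \<Longrightarrow> wedge_list V (map (\<lambda>v. c *\<^sub>R v) vs) = c ^ length vs *\<^sub>R wedge_list V vs"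
  by (induction vs)
    (simp_all add: wedge_list_Nil wedge_list_Cons ext_vec_scale ext_wedge_scale_left ext_wedge_scale_right
      mult.commute)

context
  fixes M :: "('m::{t2_space,second_countable_topology}, 'e::real_inner) atlas"
    and E :: "('m, 'v::real_vector, 'z) vbundle_scheme" and n :: nat
  assumes M: "smooth_manifold M" and E: "vector_bundle M n E"
begin

lemma subspace_fibre: "subspace (fibre E x)"
  using E by (simp add: vector_bundle_def)

lemma frame_at: obtains U es where "(U, es) \<in> frames E" "x \<in> U"
proof -
  have "x \<in> (\<Union>(U, es)\<in>frames E. U)" using E unfolding vector_bundle_def by (metis UNIV_I)
  then show thesis using that by auto
qed

lemma frameD:
  assumes "(U, es) \<in> frames E"
  shows "open U" "length es = n" "x \<in> U \<Longrightarrow> is_basis_of (fibre E x) (map (\<lambda>e. e x) es)"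
    "e \<in> set es \<Longrightarrow> e \<in> sections_on M E U"
  using E assms unfolding vector_bundle_def by fastforce+

abbreviation (input) coframe :: "('m \<Rightarrow> 'v) list \<Rightarrow> 'm \<Rightarrow> nat \<Rightarrow> 'v \<Rightarrow> real" where
  "coframe es x \<equiv> dual_cov (fibre E x) (map (\<lambda>e. e x) es)"

lemma coframe_linear:
  assumes "(U, es) \<in> frames E" "x \<in> U"
  shows "linear_on_subspace (fibre E x) (coframe es x i)"
  using dual_cov_in[OF frameD(3)[OF assms]] by (simp add: dual_space_def)

text \<open>The coefficient functions in a frame are unique, hence they can be computed by the dual frame.
  This turns the existential quantifier in the definition of sections into an explicit test.\<close>

lemma sections_on_iff:
  assumes W: "open W"
  shows "s \<in> sections_on M E W \<longleftrightarrow> (\<forall>x\<in>W. s x \<in> fibre E x) \<and>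
    (\<forall>(U, es)\<in>frames E. \<forall>i<n. smooth_fun_on M (U \<inter> W) (\<lambda>x. coframe es x i (s x)))"
proof (intro iffI conjI ballI)
  assume s: "s \<in> sections_on M E W"
  then show "x \<in> W \<Longrightarrow> s x \<in> fibre E x" for x by (simp add: sections_on_def)
  fix p assume p: "p \<in> frames E"
  obtain U es where U: "p = (U, es)" by fastforce
  note fr = p[unfolded U]
  have "\<forall>(U, es)\<in>frames E. \<exists>c :: nat \<Rightarrow> 'm \<Rightarrow> real.
      (\<forall>i<length es. smooth_fun_on M (U \<inter> W) (c i)) \<and>
      (\<forall>x\<in>U \<inter> W. s x = (\<Sum>i<length es. c i x *\<^sub>R (es ! i) x))"
    using s unfolding sections_on_def by blast
  then obtain c :: "nat \<Rightarrow> 'm \<Rightarrow> real" where c: "\<And>i. i < n \<Longrightarrow> smooth_fun_on M (U \<inter> W) (c i)"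
    "\<And>x. x \<in> U \<inter> W \<Longrightarrow> s x = (\<Sum>i<n. c i x *\<^sub>R (es ! i) x)"
    using fr frameD(2)[OF fr] by fastforce
  have "smooth_fun_on M (U \<inter> W) (\<lambda>x. coframe es x i (s x))" if i: "i < n" for i
  proof (rule smooth_fun_on_cong[OF M _ _ c(1)[OF i]])
    show "open (U \<inter> W)" using W frameD(1)[OF fr] by blast
    fix x assume x: "x \<in> U \<inter> W"
    note b = frameD(3)[OF fr, of x] and len = frameD(2)[OF fr]
    have e: "(es ! j) x \<in> fibre E x" if "j < n" for j
      using basis_in[OF b, of j] x len that by simp
    have lin: "linear_on_subspace (fibre E x) (coframe es x i)" using coframe_linear[OF fr] x by blast
    have "coframe es x i (s x) = (\<Sum>j<n. c j x * coframe es x i ((es ! j) x))"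
      unfolding c(2)[OF x] using linear_on_subspace_sum[OF subspace_fibre lin, of "{..<n}"] e by simp
    also have "\<dots> = (\<Sum>j<n. if j = i then c i x else 0)"
    proof (rule sum.cong[OF refl])
      fix j assume "j \<in> {..<n}"
      then show "c j x * coframe es x i ((es ! j) x) = (if j = i then c i x else 0)"
        using dual_cov_basis[OF b, of i j] x i len by auto
    qed
    finally show "c i x = coframe es x i (s x)" using i by simp
  qed
  then show "case p of (U, es) \<Rightarrow> \<forall>i<n. smooth_fun_on M (U \<inter> W) (\<lambda>x. coframe es x i (s x))"
    unfolding U by simp
next
  assume r: "(\<forall>x\<in>W. s x \<in> fibre E x) \<and>
    (\<forall>(U, es)\<in>frames E. \<forall>i<n. smooth_fun_on M (U \<inter> W) (\<lambda>x. coframe es x i (s x)))"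
  have "\<exists>c. (\<forall>i<length es. smooth_fun_on M (U \<inter> W) (c i)) \<and>
            (\<forall>x\<in>U \<inter> W. s x = (\<Sum>i<length es. c i x *\<^sub>R (es ! i) x))"
    if fr: "(U, es) \<in> frames E" for U es
  proof (intro exI[of _ "\<lambda>i x. coframe es x i (s x)"] conjI allI impI ballI)
    show "smooth_fun_on M (U \<inter> W) (\<lambda>x. coframe es x i (s x))" if "i < length es" for i
      using r fr that frameD(2)[OF fr] by fastforce
    fix x assume x: "x \<in> U \<inter> W"
    show "s x = (\<Sum>i<length es. coframe es x i (s x) *\<^sub>R (es ! i) x)"
      using basis_expansion[OF frameD(3)[OF fr], of x "s x"] r x by simp
  qed
  then show "s \<in> sections_on M E W" using r unfolding sections_on_def by blast
qed

lemma sections_subset_fibre: "s \<in> sections M E \<Longrightarrow> s x \<in> fibre E x"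
  by (simp add: sections_on_def)

lemma coframe_smooth:
  "s \<in> sections M E \<Longrightarrow> (U, es) \<in> frames E \<Longrightarrow> i < n \<Longrightarrow> smooth_fun_on M U (\<lambda>x. coframe es x i (s x))"
  using sections_on_iff[of UNIV s] by fastforce

lemma sectionsI:
  assumes "\<And>x. s x \<in> fibre E x"
    and "\<And>U es i. (U, es) \<in> frames E \<Longrightarrow> i < n \<Longrightarrow> smooth_fun_on M U (\<lambda>x. coframe es x i (s x))"
  shows "s \<in> sections M E"
  using assms sections_on_iff[of UNIV s] by fastforce

lemma sections_add:
  assumes "s \<in> sections M E" "t \<in> sections M E"
  shows "s + t \<in> sections M E"
proof (rule sectionsI)
  show "(s + t) x \<in> fibre E x" for x
    using assms sections_subset_fibre subspace_add[OF subspace_fibre] by simp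
  fix U es i assume fr: "(U, es) \<in> frames E" "i < n"
  show "smooth_fun_on M U (\<lambda>x. coframe es x i ((s + t) x))"
    by (rule smooth_fun_on_cong[OF M frameD(1)[OF fr(1)] _ smooth_fun_on_add[OF M frameD(1)[OF fr(1)]
          coframe_smooth[OF assms(1) fr] coframe_smooth[OF assms(2) fr]]])
      (use coframe_linear[OF fr(1)] assms sections_subset_fibre in \<open>simp add: linear_on_subspace_def\<close>)
qed

lemma sections_mult:
  assumes "f \<in> smooth_funs M" "s \<in> sections M E"
  shows "f \<odot> s \<in> sections M E"
proof (rule sectionsI)
  show "(f \<odot> s) x \<in> fibre E x" for x
    using assms sections_subset_fibre subspace_scale[OF subspace_fibre] by (simp add: fun_mult_def)
  fix U es i assume fr: "(U, es) \<in> frames E" "i < n"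
  show "smooth_fun_on M U (\<lambda>x. coframe es x i ((f \<odot> s) x))"
    by (rule smooth_fun_on_cong[OF M frameD(1)[OF fr(1)] _ smooth_fun_on_mult[OF M frameD(1)[OF fr(1)]
          smooth_funs_on[OF M assms(1)] coframe_smooth[OF assms(2) fr]]])
      (use coframe_linear[OF fr(1)] assms sections_subset_fibre in \<open>simp add: linear_on_subspace_def fun_mult_def\<close>)
qed

lemma sections_scale: "s \<in> sections M E \<Longrightarrow> c *\<^sub>R s \<in> sections M E"
  using sections_mult[OF smooth_funs_closed(1)[OF M]] by (simp add: fun_mult_def scaleR_fun_def)

lemma sections_0: "0 \<in> sections M E"
proof (rule sectionsI)
  show "0 x \<in> fibre E x" for x :: 'm using subspace_0[OF subspace_fibre] by simp
  fix U es i assume fr: "(U, es) \<in> frames E" "i < n"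
  have "coframe es x i 0 = 0" if "x \<in> U" for x
    by (rule linear_on_subspace_0[OF subspace_fibre coframe_linear[OF fr(1) that]])
  then show "smooth_fun_on M U (\<lambda>x. coframe es x i (0 x))"
    by (intro smooth_fun_on_cong[OF M frameD(1)[OF fr(1)] _ smooth_fun_on_const[OF M, of _ 0]]) simp
qed

text \<open>A local frame is multiplied by a bump function and so becomes a family of global sections
  that is still a frame at the given point.\<close>

lemma global_frame:
  obtains U es \<rho> C X where "(U, es) \<in> frames E" "x \<in> U" "\<rho> \<in> smooth_funs M" "closed C" "C \<subseteq> U"
    "\<And>y. y \<notin> C \<Longrightarrow> \<rho> y = 0" "\<rho> x \<noteq> 0" "\<And>i. i < n \<Longrightarrow> X i \<in> sections M E"
    "\<And>i y. i < n \<Longrightarrow> X i y = (if y \<in> U then \<rho> y *\<^sub>R (es ! i) y else 0)"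
proof -
  obtain U es where fr: "(U, es) \<in> frames E" and x: "x \<in> U" by (rule frame_at)
  obtain \<rho> C where \<rho>: "\<rho> \<in> smooth_funs M" "closed C" "C \<subseteq> U" "\<And>y. y \<notin> C \<Longrightarrow> \<rho> y = 0" "\<rho> x \<noteq> 0"
    using bump_function[OF M frameD(1)[OF fr] x] by metis
  define X where "X i y = (if y \<in> U then \<rho> y *\<^sub>R (es ! i) y else 0)" for i y
  have "X i \<in> sections M E" if i: "i < n" for i
  proof (rule sectionsI)
    have e: "es ! i \<in> sections_on M E U" using frameD(2,4)[OF fr] i by simp
    then have e': "(es ! i) y \<in> fibre E y" if "y \<in> U" for y
      using that by (simp add: sections_on_def)
    then show "X i y \<in> fibre E y" for y
      unfolding X_def using subspace_scale[OF subspace_fibre] subspace_0[OF subspace_fibre] by simp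
    fix U' es' j assume fr': "(U', es') \<in> frames E" "j < n"
    have sm: "smooth_fun_on M (U' \<inter> U) (\<lambda>y. coframe es' y j ((es ! i) y))"
      using e fr' sections_on_iff[OF frameD(1)[OF fr]] by fastforce
    show "smooth_fun_on M U' (\<lambda>y. coframe es' y j (X i y))"
    proof (rule smooth_fun_on_cong[OF M frameD(1)[OF fr'(1)] _ smooth_extend_by_zero[OF M frameD(1)[OF fr]
            frameD(1)[OF fr'(1)] \<rho>(2,3,1,4) sm]])
      fix y assume y: "y \<in> U'"
      have lin: "linear_on_subspace (fibre E y) (coframe es' y j)" by (rule coframe_linear[OF fr'(1) y])
      from linear_on_subspace_0[OF subspace_fibre lin] show "(if y \<in> U then \<rho> y * coframe es' y j ((es ! i) y) else 0) = coframe es' y j (X i y)"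
        using lin e' by (simp add: X_def linear_on_subspace_def)
    qed
  qed
  then show thesis using that[OF fr x \<rho>, of X] X_def by blast
qed

text \<open>The coefficients of \<open>Z\<close> are defined only on the frame domain; one bump factor extends them, the
  other one turns the local frame into global sections.\<close>

lemma local_generators:
  obtains \<rho> X where "\<rho> \<in> smooth_funs M" "\<rho> x \<noteq> 0" "\<And>i. i < n \<Longrightarrow> X i \<in> sections M E"
    "\<And>Z. Z \<in> sections M E \<Longrightarrow>
      \<exists>f. (\<forall>i<n. f i \<in> smooth_funs M) \<and> (\<forall>y. \<rho> y *\<^sub>R Z y = (\<Sum>i<n. f i y *\<^sub>R X i y))"
proof -
  obtain U es \<rho> C X where fr: "(U, es) \<in> frames E" "x \<in> U"
    and \<rho>: "\<rho> \<in> smooth_funs M" "closed C" "C \<subseteq> U" "\<And>y. y \<notin> C \<Longrightarrow> \<rho> y = 0" "\<rho> x \<noteq> 0"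
    and X: "\<And>i. i < n \<Longrightarrow> X i \<in> sections M E"
      "\<And>i y. i < n \<Longrightarrow> X i y = (if y \<in> U then \<rho> y *\<^sub>R (es ! i) y else 0)"
    by (rule global_frame[of x]) blast
  show thesis
  proof (rule that[of "\<lambda>y. \<rho> y * \<rho> y" X])
    fix Z assume Z: "Z \<in> sections M E"
    define f where "f i y = (if y \<in> U then \<rho> y * coframe es y i (Z y) else 0)" for i y
    have "f i \<in> smooth_funs M" if "i < n" for i
      using smooth_extend_by_zero[OF M frameD(1)[OF fr(1)] open_UNIV \<rho>(2,3,1,4), of "\<lambda>y. coframe es y i (Z y)"]
        coframe_smooth[OF Z fr(1) that] by (simp add: smooth_funs_def f_def[abs_def])
    moreover have "(\<rho> y * \<rho> y) *\<^sub>R Z y = (\<Sum>i<n. f i y *\<^sub>R X i y)" for y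
    proof (cases "y \<in> U")
      case True
      have "Z y = (\<Sum>i<n. coframe es y i (Z y) *\<^sub>R (es ! i) y)"
        using basis_expansion[OF frameD(3)[OF fr(1) True] sections_subset_fibre[OF Z]] frameD(2)[OF fr(1)]
        by simp
      then have "(\<rho> y * \<rho> y) *\<^sub>R Z y = (\<rho> y * \<rho> y) *\<^sub>R (\<Sum>i<n. coframe es y i (Z y) *\<^sub>R (es ! i) y)"
        by (rule arg_cong)
      also have "\<dots> = (\<Sum>i<n. (\<rho> y * \<rho> y) *\<^sub>R coframe es y i (Z y) *\<^sub>R (es ! i) y)"
        by (rule scaleR_sum_right)
      also have "\<dots> = (\<Sum>i<n. f i y *\<^sub>R X i y)"
        by (rule sum.cong) (use True in \<open>auto simp: f_def X(2) mult_ac\<close>)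
      finally show ?thesis .
    next
      case False
      then have "\<rho> y = 0" using \<rho>(3,4) by blast
      then show ?thesis using False by (simp add: f_def)
    qed
    ultimately show "\<exists>f. (\<forall>i<n. f i \<in> smooth_funs M) \<and> (\<forall>y. (\<rho> y * \<rho> y) *\<^sub>R Z y = (\<Sum>i<n. f i y *\<^sub>R X i y))"
      by blast
  qed (use \<rho> X smooth_funs_closed(3)[OF M] in auto)
qed

text \<open>The bump frame at \<open>x\<close> is a basis of the fibre; the division is by the number \<open>\<rho> x\<close>.\<close>

lemma section_through:
  assumes v: "v \<in> fibre E x"
  obtains X where "X \<in> sections M E" "X x = v"
proof -
  obtain U es \<rho> C X where fr: "(U, es) \<in> frames E" "x \<in> U"
    and \<rho>: "\<rho> x \<noteq> 0" and X: "\<And>i. i < n \<Longrightarrow> X i \<in> sections M E"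
      "\<And>i y. i < n \<Longrightarrow> X i y = (if y \<in> U then \<rho> y *\<^sub>R (es ! i) y else 0)"
    by (rule global_frame[of x]) blast
  define Y where "Y k = (\<Sum>i<k. (coframe es x i v / \<rho> x) *\<^sub>R X i)" for k
  have "Y k \<in> sections M E \<and> Y k x = (\<Sum>i<k. coframe es x i v *\<^sub>R (es ! i) x)" if "k \<le> n" for k
    using that
  proof (induction k)
    case (Suc k)
    have "Y (Suc k) = Y k + (coframe es x k v / \<rho> x) *\<^sub>R X k" by (simp add: Y_def)
    moreover have "Y (Suc k) x = Y k x + (coframe es x k v / \<rho> x) *\<^sub>R X k x"
      unfolding calculation by (simp add: scaleR_fun_def)
    moreover have "Y k + (coframe es x k v / \<rho> x) *\<^sub>R X k \<in> sections M E"
      using Suc X(1)[of k] by (intro sections_add sections_scale) auto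
    moreover have "(coframe es x k v / \<rho> x) *\<^sub>R X k x = coframe es x k v *\<^sub>R (es ! k) x"
      using Suc.prems X(2)[of k x] \<rho> fr(2) by simp
    ultimately show ?case using Suc by (simp only:) simp
  qed (simp add: Y_def sections_0)
  then show thesis
    using that[of "Y n"] basis_expansion[OF frameD(3)[OF fr] v] frameD(2)[OF fr(1)] by simp
qed

abbreviation ext_sections :: "nat \<Rightarrow> ('m \<Rightarrow> 'v ext) set" where
  "ext_sections k \<equiv> sections M (ext_power k E)"

lemma ext_power_frame_eq:
  assumes "length es = n"
  shows "map (\<lambda>ss x. wedge_list (fibre E x) (map (\<lambda>s. s x) ss)) (filter (\<lambda>ss. length ss = k) (subseqs es)) =
    map (\<lambda>I x. basis_wedge (fibre E x) (map (\<lambda>e. e x) es) I) (incr_lists n k)"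
proof -
  have subseqs_map: "subseqs (map f xs) = map (map f) (subseqs xs)" for f :: "nat \<Rightarrow> 'm \<Rightarrow> 'v" and xs
    by (induction xs) (simp_all add: Let_def)
  have "subseqs es = map (map ((!) es)) (subseqs [0..<n])"
    using subseqs_map[of "(!) es" "[0..<n]"] unfolding assms[symmetric] map_nth .
  then have "filter (\<lambda>ss. length ss = k) (subseqs es) = map (map ((!) es)) (incr_lists n k)"
    by (simp add: incr_lists_def filter_map comp_def)
  moreover have "map (\<lambda>s. s x) (map ((!) es) I) = map ((!) (map (\<lambda>e. e x) es)) I"
    if "I \<in> set (incr_lists n k)" for I x
    using that assms by (auto simp: set_incr_lists)
  then have "map ((\<lambda>ss x. wedge_list (fibre E x) (map (\<lambda>s. s x) ss)) \<circ> map ((!) es)) (incr_lists n k) =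
      map (\<lambda>I x. basis_wedge (fibre E x) (map (\<lambda>e. e x) es) I) (incr_lists n k)"
    by (intro map_cong) (simp_all add: fun_eq_iff del: map_map)
  ultimately show ?thesis by (simp only: map_map)
qed

lemma sum_incr_lists:
  "(\<Sum>i<length (incr_lists n k). f (incr_lists n k ! i)) = (\<Sum>I\<in>set (incr_lists n k). f I)"
  by (rule sum.reindex_bij_betw[OF bij_betw_nth[OF distinct_incr_lists]]) auto

text \<open>The coefficients with respect to the induced frame of the exterior power are the values at
  increasing lists of the dual frame. Since the product is defined by the evaluation of forms at
  lists, its smoothness is immediate from this criterion, without sorting products of frame
  elements.\<close>

lemma ext_sections_iff:
  "s \<in> ext_sections k \<longleftrightarrow> (\<forall>x. s x \<in> ext_power_space k (fibre E x)) \<and>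
    (\<forall>(U, es)\<in>frames E. \<forall>I\<in>set (incr_lists n k). smooth_fun_on M U (\<lambda>x. s x (map (coframe es x) I)))"
proof (intro iffI conjI ballI allI)
  assume s: "s \<in> ext_sections k"
  then show "s x \<in> ext_power_space k (fibre E x)" for x by (simp add: sections_on_def ext_power_def)
  fix p assume p: "p \<in> frames E"
  obtain U es where U: "p = (U, es)" by fastforce
  note fr = p[unfolded U]
  let ?L = "incr_lists n k" and ?bw = "\<lambda>x. basis_wedge (fibre E x) (map (\<lambda>e. e x) es)"
  have "(U, map (\<lambda>I x. ?bw x I) ?L) \<in> frames (ext_power k E)"
    unfolding ext_power_def using fr ext_power_frame_eq[OF frameD(2)[OF fr], of k, symmetric] by auto
  then obtain c :: "nat \<Rightarrow> 'm \<Rightarrow> real" where c: "\<And>i. i < length ?L \<Longrightarrow> smooth_fun_on M U (c i)"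
    "\<And>x. x \<in> U \<Longrightarrow> s x = (\<Sum>i<length ?L. c i x *\<^sub>R ?bw x (?L ! i))"
    using s unfolding sections_on_def by fastforce
  have "smooth_fun_on M U (\<lambda>x. s x (map (coframe es x) I))" if I: "I \<in> set ?L" for I
  proof -
    obtain j where j: "j < length ?L" "I = ?L ! j" using I by (metis in_set_conv_nth)
    show ?thesis
    proof (rule smooth_fun_on_cong[OF M frameD(1)[OF fr] _ c(1)[OF j(1)]])
      fix x assume x: "x \<in> U"
      have "s x (map (coframe es x) I) = (\<Sum>i<length ?L. c i x * ?bw x (?L ! i) (map (coframe es x) I))"
        unfolding c(2)[OF x] fun_sum_apply scaleR_fun_def by simp
      also have "\<dots> = (\<Sum>i<length ?L. if i = j then c j x else 0)"
      proof (rule sum.cong[OF refl])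
        fix i assume i: "i \<in> {..<length ?L}"
        have "?L ! i \<in> set ?L" using i by simp
        then have "?bw x (?L ! i) (map (coframe es x) I) = (if ?L ! i = I then 1 else 0)"
          using I frameD(2)[OF fr]
          by (intro basis_wedge_dual[OF frameD(3)[OF fr x]]) (auto simp: set_incr_lists)
        then show "c i x * ?bw x (?L ! i) (map (coframe es x) I) = (if i = j then c j x else 0)"
          using i j distinct_incr_lists[of n k] by (simp add: nth_eq_iff_index_eq)
      qed
      finally show "c j x = s x (map (coframe es x) I)" using j(1) by simp
    qed
  qed
  then show "case p of (U, es) \<Rightarrow> \<forall>I\<in>set ?L. smooth_fun_on M U (\<lambda>x. s x (map (coframe es x) I))"
    unfolding U by simp
next
  assume r: "(\<forall>x. s x \<in> ext_power_space k (fibre E x)) \<and>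
    (\<forall>(U, es)\<in>frames E. \<forall>I\<in>set (incr_lists n k). smooth_fun_on M U (\<lambda>x. s x (map (coframe es x) I)))"
  let ?L = "incr_lists n k"
  have "\<exists>c. (\<forall>i<length fs. smooth_fun_on M (U \<inter> UNIV) (c i)) \<and>
            (\<forall>x\<in>U \<inter> UNIV. s x = (\<Sum>i<length fs. c i x *\<^sub>R (fs ! i) x))"
    if "(U, fs) \<in> frames (ext_power k E)" for U fs
  proof -
    obtain es where fr: "(U, es) \<in> frames E"
      and fs: "fs = map (\<lambda>I x. basis_wedge (fibre E x) (map (\<lambda>e. e x) es) I) ?L"
    proof -
      obtain es where es: "(U, es) \<in> frames E"
        "fs = map (\<lambda>ss x. wedge_list (fibre E x) (map (\<lambda>s. s x) ss)) (filter (\<lambda>ss. length ss = k) (subseqs es))"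
        using \<open>(U, fs) \<in> _\<close> unfolding ext_power_def by auto
      from that[OF es(1)] es(2) show thesis unfolding ext_power_frame_eq[OF frameD(2)[OF es(1)]] by blast
    qed
    show ?thesis
    proof (intro exI[of _ "\<lambda>i x. s x (map (coframe es x) (?L ! i))"] conjI allI impI ballI)
      fix i assume "i < length fs"
      then have "?L ! i \<in> set ?L" by (simp add: fs)
      then show "smooth_fun_on M (U \<inter> UNIV) (\<lambda>x. s x (map (coframe es x) (?L ! i)))"
        using r fr by fastforce
    next
      fix x assume x: "x \<in> U \<inter> UNIV"
      have "s x = (\<Sum>I\<in>set ?L. s x (map (coframe es x) I) *\<^sub>R basis_wedge (fibre E x) (map (\<lambda>e. e x) es) I)"
        using ext_power_expansion[OF frameD(3)[OF fr], of x "s x" k] r x frameD(2)[OF fr] by simp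
      also have "\<dots> = (\<Sum>i<length fs. s x (map (coframe es x) (?L ! i)) *\<^sub>R (fs ! i) x)"
        unfolding sum_incr_lists[symmetric] fs by simp
      finally show "s x = (\<Sum>i<length fs. s x (map (coframe es x) (?L ! i)) *\<^sub>R (fs ! i) x)" .
    qed
  qed
  then show "s \<in> ext_sections k"
    unfolding sections_on_def using r by (auto simp: ext_power_def)
qed

lemma ext_sections_in: "s \<in> ext_sections k \<Longrightarrow> s x \<in> ext_power_space k (fibre E x)"
  by (simp add: ext_sections_iff)

lemma ext_sections_smooth:
  assumes "s \<in> ext_sections k" "(U, es) \<in> frames E" "sorted_wrt (<) I" "set I \<subseteq> {..<n}"
  shows "smooth_fun_on M U (\<lambda>x. s x (map (coframe es x) I))"
proof (cases "length I = k")
  case True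
  then have "I \<in> set (incr_lists n k)" using assms by (simp add: set_incr_lists)
  then show ?thesis using assms(1,2) unfolding ext_sections_iff by fastforce
next
  case False
  then have "s x (map (coframe es x) I) = 0" for x
    using ext_sections_in[OF assms(1), of x] by (auto simp: ext_power_space_iff homog_def)
  then show ?thesis by (simp add: smooth_fun_on_const[OF M])
qed

lemma ext_sectionsI:
  assumes "\<And>x. s x \<in> ext_power_space k (fibre E x)"
    and "\<And>U es I. (U, es) \<in> frames E \<Longrightarrow> I \<in> set (incr_lists n k) \<Longrightarrow> open U \<Longrightarrow>
      smooth_fun_on M U (\<lambda>x. s x (map (coframe es x) I))"
  shows "s \<in> ext_sections k"
  using assms frameD(1) unfolding ext_sections_iff by blast

lemma ext_sections_add:
  assumes "s \<in> ext_sections k" "t \<in> ext_sections k"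
  shows "s + t \<in> ext_sections k"
proof (rule ext_sectionsI)
  show "(s + t) x \<in> ext_power_space k (fibre E x)" for x
    using subspace_add[OF subspace_ext_power_space ext_sections_in[OF assms(1)] ext_sections_in[OF assms(2)]]
    by simp
  fix U es I assume fr: "(U, es) \<in> frames E" "I \<in> set (incr_lists n k)" "open U"
  show "smooth_fun_on M U (\<lambda>x. (s + t) x (map (coframe es x) I))"
    using smooth_fun_on_add[OF M fr(3) ext_sections_smooth[OF assms(1) fr(1)]
        ext_sections_smooth[OF assms(2) fr(1)]] fr(2) by (simp add: set_incr_lists)
qed

lemma ext_sections_mult:
  assumes "f \<in> smooth_funs M" "s \<in> ext_sections k"
  shows "f \<odot> s \<in> ext_sections k"
proof (rule ext_sectionsI)
  show "(f \<odot> s) x \<in> ext_power_space k (fibre E x)" for x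
    using subspace_scale[OF subspace_ext_power_space ext_sections_in[OF assms(2)]]
    by (simp add: fun_mult_def)
  fix U es I assume fr: "(U, es) \<in> frames E" "I \<in> set (incr_lists n k)" "open U"
  show "smooth_fun_on M U (\<lambda>x. (f \<odot> s) x (map (coframe es x) I))"
    using smooth_fun_on_mult[OF M fr(3) smooth_funs_on[OF M assms(1)]
        ext_sections_smooth[OF assms(2) fr(1)]] fr(2)
    by (simp add: set_incr_lists fun_mult_def scaleR_fun_def)
qed

lemma ext_sections_scale: "s \<in> ext_sections k \<Longrightarrow> c *\<^sub>R s \<in> ext_sections k"
  using ext_sections_mult[OF smooth_funs_closed(1)[OF M]] by (simp add: fun_mult_def scaleR_fun_def)

lemma ext_sections_0: "0 \<in> ext_sections k"
  by (rule ext_sectionsI)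
    (simp_all add: subspace_0[OF subspace_ext_power_space] smooth_fun_on_const[OF M])

lemma ext_sections_above_rank:
  assumes "s \<in> ext_sections k" "n < k"
  shows "s = 0"
proof
  fix x
  obtain U es where fr: "(U, es) \<in> frames E" "x \<in> U" by (rule frame_at)
  show "s x = 0 x"
    using ext_power_space_above_rank[OF frameD(3)[OF fr] ext_sections_in[OF assms(1)]] assms(2)
      frameD(2)[OF fr(1)] by simp
qed

lemma ext_sections_wedge:
  assumes "a \<in> ext_sections p" "b \<in> ext_sections q"
  shows "a \<and>\<^sub>w b \<in> ext_sections (p + q)"
proof (rule ext_sectionsI)
  show "(a \<and>\<^sub>w b) x \<in> ext_power_space (p + q) (fibre E x)" for x
    unfolding wedge_def using assms ext_sections_in by (intro ext_power_space_wedge) auto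
  fix U es I assume fr: "(U, es) \<in> frames E" "I \<in> set (incr_lists n (p + q))" "open U"
  have nths: "sorted_wrt (<) (nths I S)" "set (nths I S) \<subseteq> {..<n}" for S
    using fr(2) set_nths_subset[of I S]
    by (auto simp: set_incr_lists strict_sorted_iff sorted_nths)
  have "smooth_fun_on M U (\<lambda>x. \<Sum>S\<in>Pow {..<length I}. shuffle_sign S *
      (a x (map (coframe es x) (nths I S)) * b x (map (coframe es x) (nths I (- S)))))"
    by (intro smooth_fun_on_sum[OF M fr(3)] smooth_fun_on_mult[OF M fr(3)] smooth_fun_on_const[OF M]
        ext_sections_smooth[OF assms(1) fr(1)] ext_sections_smooth[OF assms(2) fr(1)] nths)
  then show "smooth_fun_on M U (\<lambda>x. (a \<and>\<^sub>w b) x (map (coframe es x) I))"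
    by (simp add: wedge_def ext_wedge_def nths_map mult.assoc)
qed

lemma of_fun_in_ext_sections: "f \<in> smooth_funs M \<Longrightarrow> of_fun f \<in> ext_sections 0"
proof (rule ext_sectionsI)
  show "of_fun f x \<in> ext_power_space 0 (fibre E x)" for x
    unfolding of_fun_def by (rule subspace_scale[OF subspace_ext_power_space ext_one_in])
qed (simp add: of_fun_def set_incr_lists ext_one_def scaleR_fun_def smooth_funs_on[OF M])

lemma ext_sections_0_of_fun:
  assumes "s \<in> ext_sections 0"
  obtains f where "f \<in> smooth_funs M" "s = of_fun f"
proof
  show "s = of_fun (\<lambda>x. s x [])"
  proof (intro ext)
    fix x l show "s x l = of_fun (\<lambda>x. s x []) x l"
      using ext_sections_in[OF assms, of x]
      by (auto simp: of_fun_def ext_one_def scaleR_fun_def ext_power_space_iff homog_def)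
  qed
  show "(\<lambda>x. s x []) \<in> smooth_funs M"
    unfolding smooth_funs_def mem_Collect_eq
  proof (rule smooth_fun_on_local[OF M])
    fix x
    obtain U es where fr: "(U, es) \<in> frames E" "x \<in> U" by (rule frame_at)
    show "\<exists>T. open T \<and> x \<in> T \<and> smooth_fun_on M T (\<lambda>x. s x [])"
      using ext_sections_smooth[OF assms fr(1), of "[]"] fr frameD(1)[OF fr(1)] by auto
  qed
qed

lemma vec_in_ext_sections:
  assumes "X \<in> sections M E"
  shows "(\<lambda>x. ext_vec (fibre E x) (X x)) \<in> ext_sections 1"
proof (rule ext_sectionsI[OF ext_vec_in])
  fix U es I assume fr: "(U, es) \<in> frames E" "I \<in> set (incr_lists n 1)" "open U"
  then obtain i where i: "I = [i]" "i < n" by (auto simp: set_incr_lists length_Suc_conv)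
  show "smooth_fun_on M U (\<lambda>x. ext_vec (fibre E x) (X x) (map (coframe es x) I))"
    by (rule smooth_fun_on_cong[OF M fr(3) _ coframe_smooth[OF assms fr(1) i(2)]])
      (use dual_cov_in[OF frameD(3)[OF fr(1)]] in \<open>simp add: i ext_vec_def\<close>)
qed

lemma wedge_sections_Cons:
  "wedge_sections E (X # Xs) = (\<lambda>x. ext_vec (fibre E x) (X x)) \<and>\<^sub>w wedge_sections E Xs"
  by (simp add: wedge_sections_def wedge_def wedge_list_Cons)

lemma wedge_sections_in:
  "set Xs \<subseteq> sections M E \<Longrightarrow> wedge_sections E Xs \<in> ext_sections (length Xs)"
proof (induction Xs)
  case Nil
  have "wedge_sections E [] = of_fun (\<lambda>x. 1)"
    by (simp add: wedge_sections_def wedge_list_Nil of_fun_def)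
  then show ?case using of_fun_in_ext_sections[OF smooth_funs_closed(1)[OF M]] by simp
next
  case (Cons X Xs)
  then show ?case
    using ext_sections_wedge[OF vec_in_ext_sections, of X "wedge_sections E Xs" "length Xs"]
    by (simp add: wedge_sections_Cons)
qed

text \<open>The gluing principle: the multiplier can be divided out near its point.\<close>

lemma ext_sections_local:
  assumes "\<And>x. \<exists>\<rho>\<in>smooth_funs M. \<rho> x \<noteq> 0 \<and> \<rho> \<odot> s \<in> ext_sections k"
  shows "s \<in> ext_sections k"
proof (rule ext_sectionsI)
  fix x
  obtain \<rho> where \<rho>: "\<rho> x \<noteq> 0" "\<rho> \<odot> s \<in> ext_sections k" using assms by blast
  have "inverse (\<rho> x) *\<^sub>R (\<rho> \<odot> s) x \<in> ext_power_space k (fibre E x)"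
    by (intro subspace_scale[OF subspace_ext_power_space] ext_sections_in \<rho>)
  then show "s x \<in> ext_power_space k (fibre E x)" using \<rho>(1) by (simp add: fun_mult_def)
next
  fix U es I assume fr: "(U, es) \<in> frames E" "I \<in> set (incr_lists n k)" "open U"
  show "smooth_fun_on M U (\<lambda>x. s x (map (coframe es x) I))"
  proof (rule smooth_fun_on_divide_local[OF M fr(3)])
    fix x
    obtain \<rho> where \<rho>: "\<rho> \<in> smooth_funs M" "\<rho> x \<noteq> 0" "\<rho> \<odot> s \<in> ext_sections k" using assms by blast
    have "smooth_fun_on M U (\<lambda>x. (\<rho> \<odot> s) x (map (coframe es x) I))"
      using fr by (intro ext_sections_smooth[OF \<rho>(3)]) (auto simp: set_incr_lists)
    then show "\<exists>\<rho>\<in>smooth_funs M. \<rho> x \<noteq> 0 \<and> smooth_fun_on M U (\<lambda>y. \<rho> y * s y (map (coframe es y) I))"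
      using \<rho> by (intro bexI[of _ \<rho>]) (simp_all add: fun_mult_def scaleR_fun_def)
  qed
qed

text \<open>The pointwise pairing may be tested with global sections only, for these reach every vector of
  the fibre.\<close>

lemma ext_section_eq_0:
  assumes q: "q \<in> ext_sections m" and "m + d = n"
    and z: "\<And>Ys. set Ys \<subseteq> sections M E \<Longrightarrow> length Ys = d \<Longrightarrow> (wedge_sections E Ys \<and>\<^sub>w q) x = 0"
  shows "q x = 0"
proof -
  obtain U es where fr: "(U, es) \<in> frames E" "x \<in> U" by (rule frame_at)
  show ?thesis
  proof (rule wedge_nondegenerate[OF frameD(3)[OF fr] ext_sections_in[OF q]])
    show "m + d = length (map (\<lambda>e. e x) es)" using assms(2) frameD(2)[OF fr(1)] by simp
    fix vs assume vs: "set vs \<subseteq> set (map (\<lambda>e. e x) es)" "length vs = d"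
    have "set vs \<subseteq> fibre E x"
      using vs(1) frameD(3)[OF fr] unfolding is_basis_of_def by (metis span_superset subset_trans)
    then have "\<exists>Ys. set Ys \<subseteq> sections M E \<and> map (\<lambda>Y. Y x) Ys = vs"
    proof (induction vs)
      case (Cons v vs)
      then obtain Ys where "set Ys \<subseteq> sections M E" "map (\<lambda>Y. Y x) Ys = vs" by auto
      moreover obtain Y where "Y \<in> sections M E" "Y x = v"
        using Cons.prems section_through[of v x] by auto
      ultimately show ?case by (intro exI[of _ "Y # Ys"]) simp
    qed simp
    then obtain Ys where Ys: "set Ys \<subseteq> sections M E" "map (\<lambda>Y. Y x) Ys = vs" by blast
    then show "ext_wedge (wedge_list (fibre E x) vs) (q x) = 0"
      using z[of Ys] vs(2) by (auto simp: wedge_def wedge_sections_def)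
  qed
qed

text \<open>In the expansion by a bump frame the coefficient is absorbed into the first factor of each
  product, which requires a positive degree. The function is the power of a bump function that
  supplies one bump to the coefficient and one to each factor.\<close>

lemma local_wedges:
  assumes s: "s \<in> ext_sections (Suc k)"
  obtains \<rho> G and S :: "nat list set" where "\<rho> \<in> smooth_funs M" "\<rho> x \<noteq> 0" "finite S"
    "\<And>I. I \<in> S \<Longrightarrow> set (G I) \<subseteq> sections M E \<and> length (G I) = Suc k"
    "\<rho> \<odot> s = (\<Sum>I\<in>S. wedge_sections E (G I))"
proof -
  obtain U es \<rho> C X where fr: "(U, es) \<in> frames E" "x \<in> U"
    and \<rho>: "\<rho> \<in> smooth_funs M" "closed C" "C \<subseteq> U" "\<And>y. y \<notin> C \<Longrightarrow> \<rho> y = 0" "\<rho> x \<noteq> 0"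
    and X: "\<And>i. i < n \<Longrightarrow> X i \<in> sections M E"
      "\<And>i y. i < n \<Longrightarrow> X i y = (if y \<in> U then \<rho> y *\<^sub>R (es ! i) y else 0)"
    by (rule global_frame[of x]) blast
  let ?S = "set (incr_lists n (Suc k))"
  define F where "F I y = (if y \<in> U then \<rho> y * s y (map (coframe es y) I) else 0)" for I y
  define G where "G I = (F I \<odot> X (hd I)) # map X (tl I)" for I
  have F: "F I \<in> smooth_funs M" if "I \<in> ?S" for I
    using smooth_extend_by_zero[OF M frameD(1)[OF fr(1)] open_UNIV \<rho>(2,3,1,4), of "\<lambda>y. s y (map (coframe es y) I)"]
      ext_sections_smooth[OF s fr(1), of I] that
    by (simp add: smooth_funs_def F_def[abs_def] set_incr_lists)
  have I: "hd I < n" "set (tl I) \<subseteq> {..<n}" "I = hd I # tl I" "length I = Suc k" if "I \<in> ?S" for I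
  proof -
    have "I \<noteq> []" using that unfolding set_incr_lists by auto
    then obtain i J where J: "I = i # J" by (meson neq_Nil_conv)
    then show "hd I < n" "set (tl I) \<subseteq> {..<n}" "I = hd I # tl I" "length I = Suc k"
      using that by (simp_all add: set_incr_lists)
  qed
  show thesis
  proof (rule that[of "\<lambda>y. \<rho> y ^ Suc (Suc k)" ?S G])
    show "set (G I) \<subseteq> sections M E \<and> length (G I) = Suc k" if "I \<in> ?S" for I
      using I[OF that] X(1) sections_mult[OF F[OF that] X(1)] that by (auto simp: G_def)
    show "(\<lambda>y. \<rho> y ^ Suc (Suc k)) \<odot> s = (\<Sum>I\<in>?S. wedge_sections E (G I))"
    proof
      fix y
      have "wedge_sections E (G I) y = (if y \<in> U then
          (\<rho> y ^ Suc (Suc k) * s y (map (coframe es y) I)) *\<^sub>R basis_wedge (fibre E y) (map (\<lambda>e. e y) es) I else 0)"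
        if IS: "I \<in> ?S" for I
      proof (cases "y \<in> U")
        case False
        then have "(F I \<odot> X (hd I)) y = 0 *\<^sub>R 0" by (simp add: fun_mult_def F_def)
        then show ?thesis using False subspace_0[OF subspace_fibre[of y]] ext_vec_scale[of 0 "fibre E y" 0]
          by (simp add: wedge_sections_def G_def wedge_list_Cons)
      next
        case True
        have e: "(es ! i) y \<in> fibre E y" if "i < n" for i
          using basis_in[OF frameD(3)[OF fr(1) True], of i] that frameD(2)[OF fr(1)] by simp
        have X': "X i y \<in> fibre E y" if "i < n" for i using X(1)[OF that] sections_subset_fibre by blast
        have "wedge_sections E (G I) y = F I y *\<^sub>R wedge_list (fibre E y) (map (\<lambda>i. X i y) I)"
          using X'[OF I(1)[OF IS]]
          by (subst (3) I(3)[OF IS]) (simp add: wedge_sections_def G_def wedge_list_Cons fun_mult_def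
              ext_vec_scale ext_wedge_scale_left comp_def)
        also have "map (\<lambda>i. X i y) I = map (\<lambda>v. \<rho> y *\<^sub>R v) (map ((!) (map (\<lambda>e. e y) es)) I)"
          using IS True X(2) frameD(2)[OF fr(1)] by (auto simp: set_incr_lists)
        also have "wedge_list (fibre E y) \<dots> = \<rho> y ^ Suc k *\<^sub>R basis_wedge (fibre E y) (map (\<lambda>e. e y) es) I"
          using IS e frameD(2)[OF fr(1)] by (subst wedge_list_scale) (auto simp: set_incr_lists)
        finally show ?thesis using True by (simp add: F_def mult_ac)
      qed
      then have "(\<Sum>I\<in>?S. wedge_sections E (G I)) y = (\<Sum>I\<in>?S. if y \<in> U then
          (\<rho> y ^ Suc (Suc k) * s y (map (coframe es y) I)) *\<^sub>R basis_wedge (fibre E y) (map (\<lambda>e. e y) es) I else 0)"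
        unfolding fun_sum_apply[of _ _ y] by (intro sum.cong) auto
      also have "\<dots> = \<rho> y ^ Suc (Suc k) *\<^sub>R s y"
      proof (cases "y \<in> U")
        case True
        have "s y = (\<Sum>I\<in>?S. s y (map (coframe es y) I) *\<^sub>R basis_wedge (fibre E y) (map (\<lambda>e. e y) es) I)"
          using ext_power_expansion[OF frameD(3)[OF fr(1) True] ext_sections_in[OF s]] frameD(2)[OF fr(1)] by simp
        then have "\<rho> y ^ Suc (Suc k) *\<^sub>R s y = \<rho> y ^ Suc (Suc k) *\<^sub>R (\<Sum>I\<in>?S.
            s y (map (coframe es y) I) *\<^sub>R basis_wedge (fibre E y) (map (\<lambda>e. e y) es) I)"
          by (rule arg_cong)
        also have "\<dots> = (\<Sum>I\<in>?S. \<rho> y ^ Suc (Suc k) *\<^sub>R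
            s y (map (coframe es y) I) *\<^sub>R basis_wedge (fibre E y) (map (\<lambda>e. e y) es) I)"
          by (rule scaleR_sum_right)
        finally show ?thesis using True by simp
      next
        case False
        then have "\<rho> y = 0" using \<rho>(3,4) by blast
        then show ?thesis using False by simp
      qed
      finally show "((\<lambda>y. \<rho> y ^ Suc (Suc k)) \<odot> s) y = (\<Sum>I\<in>?S. wedge_sections E (G I)) y"
        by (simp add: fun_mult_def)
    qed
    show "(\<lambda>y. \<rho> y ^ Suc (Suc k)) \<in> smooth_funs M" by (rule smooth_funs_closed(4)[OF M \<rho>(1)])
  qed (use \<rho>(5) in simp_all)
qed

lemma set_incr_lists_top: "set (incr_lists n n) = {[0..<n]}"
proof -
  have "I = [0..<n]" if "sorted_wrt (<) I" "set I \<subseteq> {..<n}" "length I = n" for I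
  proof -
    have "card (set I) = n" using that by (simp add: strict_sorted_iff distinct_card)
    then have "set I = set [0..<n]" using that(2) by (simp add: card_subset_eq lessThan_atLeast0)
    then show ?thesis using that(1) strict_sorted_equal by (metis sorted_wrt_upt)
  qed
  then show ?thesis by (auto simp: set_incr_lists)
qed

text \<open>The product \<open>\<Lambda>\<close> of a bump frame generates the top exterior power wherever the bump does not
  vanish.\<close>

lemma top_frame:
  obtains U es \<rho> C \<Lambda> where "(U, es) \<in> frames E" "x \<in> U" "\<rho> \<in> smooth_funs M" "closed C" "C \<subseteq> U"
    "\<And>y. y \<notin> C \<Longrightarrow> \<rho> y = 0" "\<rho> x \<noteq> 0" "\<Lambda> \<in> ext_sections n"
    "\<And>y. y \<in> U \<Longrightarrow> \<Lambda> y (map (coframe es y) [0..<n]) = \<rho> y ^ n"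
    "\<And>\<Omega> y. \<Omega> \<in> ext_sections n \<Longrightarrow> y \<in> U \<Longrightarrow>
      \<rho> y ^ n *\<^sub>R \<Omega> y = \<Omega> y (map (coframe es y) [0..<n]) *\<^sub>R \<Lambda> y"
proof -
  obtain U es \<rho> C X where fr: "(U, es) \<in> frames E" "x \<in> U"
    and \<rho>: "\<rho> \<in> smooth_funs M" "closed C" "C \<subseteq> U" "\<And>y. y \<notin> C \<Longrightarrow> \<rho> y = 0" "\<rho> x \<noteq> 0"
    and X: "\<And>i. i < n \<Longrightarrow> X i \<in> sections M E"
      "\<And>i y. i < n \<Longrightarrow> X i y = (if y \<in> U then \<rho> y *\<^sub>R (es ! i) y else 0)"
    by (rule global_frame[of x]) blast
  let ?\<Lambda> = "wedge_sections E (map X [0..<n])"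
  let ?top = "\<lambda>y. basis_wedge (fibre E y) (map (\<lambda>e. e y) es) [0..<n]"
  have L: "?\<Lambda> y = \<rho> y ^ n *\<^sub>R ?top y" if y: "y \<in> U" for y
  proof -
    have e: "(es ! i) y \<in> fibre E y" if "i < n" for i
      using basis_in[OF frameD(3)[OF fr(1) y], of i] that frameD(2)[OF fr(1)] by simp
    have "map (\<lambda>i. X i y) [0..<n] = map (\<lambda>v. \<rho> y *\<^sub>R v) (map ((!) (map (\<lambda>e. e y) es)) [0..<n])"
      using y X(2) frameD(2)[OF fr(1)] by simp
    then have "?\<Lambda> y = wedge_list (fibre E y) (map (\<lambda>v. \<rho> y *\<^sub>R v) (map ((!) (map (\<lambda>e. e y) es)) [0..<n]))"
      by (simp only: wedge_sections_def map_map comp_def)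
    also have "\<dots> = \<rho> y ^ n *\<^sub>R ?top y"
      using e frameD(2)[OF fr(1)] by (subst wedge_list_scale) auto
    finally show ?thesis .
  qed
  have top1: "?top y (map (coframe es y) [0..<n]) = 1" if "y \<in> U" for y
    using basis_wedge_dual[OF frameD(3)[OF fr(1) that], of "[0..<n]" "[0..<n]"] frameD(2)[OF fr(1)]
    by (simp add: sorted_wrt_upt lessThan_atLeast0)
  show thesis
  proof (rule that[OF fr \<rho>])
    show "?\<Lambda> \<in> ext_sections n"
      using wedge_sections_in[of "map X [0..<n]"] X(1) by (simp add: image_subset_iff)
    fix y assume y: "y \<in> U"
    show "?\<Lambda> y (map (coframe es y) [0..<n]) = \<rho> y ^ n"
      by (simp add: L[OF y] scaleR_fun_def top1[OF y])
    fix \<Omega> assume \<Omega>: "\<Omega> \<in> ext_sections n"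
    have "\<Omega> y = \<Omega> y (map (coframe es y) [0..<n]) *\<^sub>R ?top y"
      using ext_power_expansion[OF frameD(3)[OF fr(1) y] ext_sections_in[OF \<Omega>]] frameD(2)[OF fr(1)]
      by (simp add: set_incr_lists_top)
    then have "\<rho> y ^ n *\<^sub>R \<Omega> y = \<rho> y ^ n *\<^sub>R \<Omega> y (map (coframe es y) [0..<n]) *\<^sub>R ?top y"
      by (rule arg_cong)
    then show "\<rho> y ^ n *\<^sub>R \<Omega> y = \<Omega> y (map (coframe es y) [0..<n]) *\<^sub>R ?\<Lambda> y"
      by (simp add: L[OF y] mult.commute)
  qed
qed

lemma top_section_nonzero: obtains \<Lambda> where "\<Lambda> \<in> ext_sections n" "\<Lambda> x \<noteq> 0"
proof -
  obtain U es \<rho> C \<Lambda> where *: "x \<in> U" "\<rho> x \<noteq> 0" "\<Lambda> \<in> ext_sections n"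
    "\<And>y. y \<in> U \<Longrightarrow> \<Lambda> y (map (coframe es y) [0..<n]) = \<rho> y ^ n"
    by (rule top_frame[of x]) blast
  have "\<Lambda> x \<noteq> 0"
  proof
    assume "\<Lambda> x = 0"
    then show False using *(4)[OF *(1)] *(2) by simp
  qed
  then show thesis using that * by blast
qed

text \<open>The top exterior power is a line bundle. Near a point the endomorphism is determined by its value
  on one nonvanishing section, and the function is the quotient of two coefficients.\<close>

lemma top_endomorphism:
  assumes T: "\<And>\<Lambda>. \<Lambda> \<in> ext_sections n \<Longrightarrow> T \<Lambda> \<in> ext_sections n"
    and lin: "\<And>f \<Lambda>. f \<in> smooth_funs M \<Longrightarrow> \<Lambda> \<in> ext_sections n \<Longrightarrow> T (f \<odot> \<Lambda>) = f \<odot> T \<Lambda>"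
  obtains g where "g \<in> smooth_funs M" "\<And>\<Lambda>. \<Lambda> \<in> ext_sections n \<Longrightarrow> T \<Lambda> = g \<odot> \<Lambda>"
proof -
  have loc: "\<exists>\<rho> h. \<rho> \<in> smooth_funs M \<and> h \<in> smooth_funs M \<and> \<rho> x \<noteq> 0 \<and>
      (\<forall>\<Lambda>\<in>ext_sections n. \<rho> \<odot> T \<Lambda> = h \<odot> \<Lambda>)" for x
  proof -
    obtain U es \<rho> C \<Lambda>0 where fr: "(U, es) \<in> frames E" "x \<in> U"
      and \<rho>: "\<rho> \<in> smooth_funs M" "closed C" "C \<subseteq> U" "\<And>y. y \<notin> C \<Longrightarrow> \<rho> y = 0" "\<rho> x \<noteq> 0"
      and \<Lambda>0: "\<Lambda>0 \<in> ext_sections n"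
      and ex: "\<And>\<Omega> y. \<Omega> \<in> ext_sections n \<Longrightarrow> y \<in> U \<Longrightarrow>
        \<rho> y ^ n *\<^sub>R \<Omega> y = \<Omega> y (map (coframe es y) [0..<n]) *\<^sub>R \<Lambda>0 y"
      by (rule top_frame[of x]) blast
    define c where "c \<Omega> y = (if y \<in> U then \<rho> y * \<Omega> y (map (coframe es y) [0..<n]) else 0)" for \<Omega> :: "'m \<Rightarrow> 'v ext" and y
    have c: "c \<Omega> \<in> smooth_funs M" if "\<Omega> \<in> ext_sections n" for \<Omega>
      using smooth_extend_by_zero[OF M frameD(1)[OF fr(1)] open_UNIV \<rho>(2,3,1,4), of "\<lambda>y. \<Omega> y (map (coframe es y) [0..<n])"]
        ext_sections_smooth[OF that fr(1), of "[0..<n]"]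
      by (simp add: smooth_funs_def c_def[abs_def] sorted_wrt_upt lessThan_atLeast0)
    let ?r = "\<lambda>y. \<rho> y ^ Suc n"
    have r: "?r \<in> smooth_funs M" by (rule smooth_funs_closed(4)[OF M \<rho>(1)])
    have ex': "?r \<odot> \<Omega> = c \<Omega> \<odot> \<Lambda>0" if "\<Omega> \<in> ext_sections n" for \<Omega>
    proof
      fix y
      show "(?r \<odot> \<Omega>) y = (c \<Omega> \<odot> \<Lambda>0) y"
      proof (cases "y \<in> U")
        case True
        have "\<rho> y *\<^sub>R \<rho> y ^ n *\<^sub>R \<Omega> y = \<rho> y *\<^sub>R \<Omega> y (map (coframe es y) [0..<n]) *\<^sub>R \<Lambda>0 y"
          using ex[OF that True] by (rule arg_cong)
        then show ?thesis using True by (simp add: fun_mult_def c_def)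
      next
        case False
        then have "\<rho> y = 0" using \<rho>(3,4) by blast
        then show ?thesis using False by (simp add: fun_mult_def c_def)
      qed
    qed
    have "(\<lambda>y. ?r y * ?r y) \<odot> T \<Lambda> = (\<lambda>y. c (T \<Lambda>0) y * ?r y) \<odot> \<Lambda>" if \<Lambda>: "\<Lambda> \<in> ext_sections n" for \<Lambda>
    proof -
      have 1: "?r \<odot> T \<Lambda> = c \<Lambda> \<odot> T \<Lambda>0"
        using lin[OF r \<Lambda>] lin[OF c[OF \<Lambda>] \<Lambda>0] ex'[OF \<Lambda>] by simp
      have 2: "?r \<odot> T \<Lambda>0 = c (T \<Lambda>0) \<odot> \<Lambda>0" by (rule ex'[OF T[OF \<Lambda>0]])
      have "?r \<odot> ?r \<odot> T \<Lambda> = c \<Lambda> \<odot> ?r \<odot> T \<Lambda>0"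
        unfolding 1 by (simp add: fun_mult_def mult.commute)
      also have "\<dots> = c (T \<Lambda>0) \<odot> c \<Lambda> \<odot> \<Lambda>0"
        unfolding 2 by (simp add: fun_mult_def mult.commute)
      also have "\<dots> = c (T \<Lambda>0) \<odot> ?r \<odot> \<Lambda>" using ex'[OF \<Lambda>] by simp
      finally show ?thesis by (simp add: fun_mult_def)
    qed
    moreover have "(\<lambda>y. ?r y * ?r y) \<in> smooth_funs M" "(\<lambda>y. c (T \<Lambda>0) y * ?r y) \<in> smooth_funs M"
      using smooth_funs_closed(3)[OF M] r c[OF T[OF \<Lambda>0]] by blast+
    moreover have "?r x * ?r x \<noteq> 0" using \<rho>(5) by simp
    ultimately show ?thesis by blast
  qed
  then obtain r h where r: "\<And>x. r x \<in> smooth_funs M" and h: "\<And>x. h x \<in> smooth_funs M"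
    and r0: "\<And>x. r x x \<noteq> 0" and rh: "\<And>x \<Lambda>. \<Lambda> \<in> ext_sections n \<Longrightarrow> r x \<odot> T \<Lambda> = h x \<odot> \<Lambda>"
    by metis
  define g where "g x = h x x / r x x" for x
  have g: "T \<Lambda> x = g x *\<^sub>R \<Lambda> x" if "\<Lambda> \<in> ext_sections n" for \<Lambda> x
  proof -
    have "r x x *\<^sub>R T \<Lambda> x = h x x *\<^sub>R \<Lambda> x" using rh[OF that, of x] by (simp add: fun_mult_def fun_eq_iff)
    then have "inverse (r x x) *\<^sub>R r x x *\<^sub>R T \<Lambda> x = inverse (r x x) *\<^sub>R h x x *\<^sub>R \<Lambda> x" by simp
    then show ?thesis using r0[of x] by (simp add: g_def divide_inverse mult.commute)
  qed
  have "smooth_fun_on M UNIV g"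
  proof (rule smooth_fun_on_divide_local[OF M open_UNIV])
    fix x
    have "r x y * g y = h x y" for y
    proof -
      obtain \<Lambda> where \<Lambda>: "\<Lambda> \<in> ext_sections n" "\<Lambda> y \<noteq> 0" by (rule top_section_nonzero[of y])
      have "(r x y * g y) *\<^sub>R \<Lambda> y = h x y *\<^sub>R \<Lambda> y"
        using fun_cong[OF rh[OF \<Lambda>(1), of x], of y] g[OF \<Lambda>(1), of y] by (simp add: fun_mult_def)
      then show ?thesis using \<Lambda>(2) by (metis scaleR_cancel_right)
    qed
    then show "\<exists>\<rho>\<in>smooth_funs M. \<rho> x \<noteq> 0 \<and> smooth_fun_on M UNIV (\<lambda>y. \<rho> y * g y)"
      using r h r0 smooth_funs_on[OF M h] by (intro bexI[of _ "r x"]) auto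
  qed
  then have "g \<in> smooth_funs M" by (simp add: smooth_funs_def)
  then show thesis using that g by (force simp: fun_mult_def)
qed

end


section \<open>Calculus in the Gerstenhaber algebra\<close>

text \<open>Multivectors are functions with values in functions. Their sums are not to be evaluated
  pointwise by default.\<close>

declare plus_fun_apply [simp del] zero_fun_apply [simp del] minus_apply [simp del] uminus_apply [simp del]

lemma koszul_sign_diff: "koszul_sign (p - q) = koszul_sign p * koszul_sign q"
  by (simp add: koszul_sign_def)

lemma koszul_sign_minus [simp]: "koszul_sign (- p) = koszul_sign p"
  by (simp add: koszul_sign_def)

lemma koszul_sign_simps [simp]: "koszul_sign 0 = 1" "koszul_sign 1 = -1"
    "koszul_sign p * koszul_sign p = 1" "koszul_sign p * (koszul_sign p * c) = c"
  by (simp_all add: koszul_sign_def)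

lemma koszul_sign_scaleR [simp]: "koszul_sign p *\<^sub>R koszul_sign p *\<^sub>R a = a"
  for a :: "'a::real_vector"
  by simp

lemma scaleR_fun_apply: "(c *\<^sub>R f) x = c *\<^sub>R f x"
  by (simp add: scaleR_fun_def)

lemma koszul_sign_of_nat: "koszul_sign (int k) = (-1) ^ k"
  by (simp add: koszul_sign_def)

lemma fun_mult_simps:
  "f \<odot> (a + b) = f \<odot> a + f \<odot> b" "f \<odot> (a - b) = f \<odot> a - f \<odot> b" "f \<odot> (- a) = - (f \<odot> a)"
  "f \<odot> (c *\<^sub>R a) = c *\<^sub>R (f \<odot> a)" "f \<odot> 0 = 0"
  by (auto simp: fun_mult_def fun_eq_iff scaleR_fun_apply plus_fun_apply minus_apply uminus_apply
      zero_fun_apply algebra_simps)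

lemma fun_mult_commute: "f \<odot> g \<odot> a = g \<odot> f \<odot> a"
  by (simp add: fun_mult_def mult.commute)

lemma wedge_add: "(a + b) \<and>\<^sub>w c = a \<and>\<^sub>w c + b \<and>\<^sub>w c" "c \<and>\<^sub>w (a + b) = c \<and>\<^sub>w a + c \<and>\<^sub>w b"
  by (simp_all add: wedge_def fun_eq_iff ext_wedge_add_left ext_wedge_add_right plus_fun_apply)

lemma wedge_scale: "(r *\<^sub>R a) \<and>\<^sub>w b = r *\<^sub>R (a \<and>\<^sub>w b)" "a \<and>\<^sub>w (r *\<^sub>R b) = r *\<^sub>R (a \<and>\<^sub>w b)"
  by (rule ext, simp add: wedge_def scaleR_fun_apply ext_wedge_scale_left ext_wedge_scale_right)+

lemma wedge_minus: "(- a) \<and>\<^sub>w b = - (a \<and>\<^sub>w b)" "a \<and>\<^sub>w (- b) = - (a \<and>\<^sub>w b)"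
  using wedge_scale(1)[of "-1" a b] wedge_scale(2)[of a "-1" b] by simp_all

lemma wedge_diff: "(a - b) \<and>\<^sub>w c = a \<and>\<^sub>w c - b \<and>\<^sub>w c" "c \<and>\<^sub>w (a - b) = c \<and>\<^sub>w a - c \<and>\<^sub>w b"
  using wedge_add(1)[of a "- b" c] wedge_add(2)[of c a "- b"] by (simp_all add: wedge_minus)

lemma wedge_0 [simp]: "0 \<and>\<^sub>w b = 0" "a \<and>\<^sub>w 0 = 0"
  by (simp_all add: wedge_def fun_eq_iff zero_fun_apply)

lemma wedge_sum: "(\<Sum>i\<in>I. a i) \<and>\<^sub>w b = (\<Sum>i\<in>I. a i \<and>\<^sub>w b)" "b \<and>\<^sub>w (\<Sum>i\<in>I. a i) = (\<Sum>i\<in>I. b \<and>\<^sub>w a i)"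
  by (induction I rule: infinite_finite_induct) (simp_all add: wedge_add)

lemma wedge_assoc: "(a \<and>\<^sub>w b) \<and>\<^sub>w c = a \<and>\<^sub>w b \<and>\<^sub>w c"
  by (simp add: wedge_def ext_wedge_assoc)

lemma wedge_fun_mult: "(f \<odot> a) \<and>\<^sub>w b = f \<odot> (a \<and>\<^sub>w b)" "a \<and>\<^sub>w (f \<odot> b) = f \<odot> (a \<and>\<^sub>w b)"
  by (simp_all add: wedge_def fun_mult_def ext_wedge_scale_left ext_wedge_scale_right)

lemma wedge_of_fun: "of_fun f \<and>\<^sub>w a = f \<odot> a" "a \<and>\<^sub>w of_fun f = f \<odot> a"
  by (simp_all add: wedge_def fun_mult_def of_fun_def ext_wedge_scale_left ext_wedge_scale_right)

lemma of_fun_mult: "f \<odot> of_fun g = of_fun (\<lambda>x. f x * g x)"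
  by (simp add: fun_mult_def of_fun_def)

lemma of_fun_eq_iff: "of_fun f = of_fun g \<longleftrightarrow> f = g"
proof
  assume *: "of_fun f = of_fun g"
  have "f x = g x" for x
    using fun_cong[OF fun_cong[OF *, of x], of "[]"] by (simp add: of_fun_def ext_one_def scaleR_fun_def)
  then show "f = g" ..
qed simp

lemma of_fun_simps: "of_fun (\<lambda>x. f x + g x) = of_fun f + of_fun g" "of_fun (\<lambda>x. f x - g x) = of_fun f - of_fun g"
    "of_fun (\<lambda>x. 0) = 0" "of_fun (\<lambda>x. - f x) = - of_fun f"
  by (auto simp: of_fun_def fun_eq_iff scaleR_fun_apply plus_fun_apply minus_apply uminus_apply
      zero_fun_apply algebra_simps)

locale algebroid_bracket =
  fixes M :: "('m::{t2_space,second_countable_topology}, 'e::real_inner) atlas"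
    and A :: "('m, 'v::real_vector) algebroid"
    and n :: nat
    and br :: "('m \<Rightarrow> 'v ext) \<Rightarrow> ('m \<Rightarrow> 'v ext) \<Rightarrow> ('m \<Rightarrow> 'v ext)"
  assumes M: "smooth_manifold M"
    and A: "lie_algebroid M n A"
    and br: "schouten_bracket M A br"
begin

lemma vb: "vector_bundle M n A"
  using A by (simp add: lie_algebroid_def)

abbreviation "\<R> \<equiv> smooth_funs M"
abbreviation "\<Gamma> \<equiv> sections M A"
abbreviation "\<V> \<equiv> multivec M A"

lemma V_nat: "\<V> (int k) = sections M (ext_power k A)"
  by (simp add: multivec_def)

lemma V_neg: "k < 0 \<Longrightarrow> a \<in> \<V> k \<Longrightarrow> a = 0"
  by (simp add: multivec_def)

lemma V_cases: "a \<in> \<V> k \<Longrightarrow> (\<And>j. k = int j \<Longrightarrow> a \<in> sections M (ext_power j A) \<Longrightarrow> P) \<Longrightarrow> (k < 0 \<Longrightarrow> a = 0 \<Longrightarrow> P) \<Longrightarrow> P"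
  by (cases "k < 0") (auto simp: multivec_def intro: nonneg_int_cases[of k])

lemma V_0: "0 \<in> \<V> k"
  by (auto simp: multivec_def ext_sections_0[OF M vb])

lemma V_add: "a \<in> \<V> k \<Longrightarrow> b \<in> \<V> k \<Longrightarrow> a + b \<in> \<V> k"
  by (auto simp: multivec_def ext_sections_add[OF M vb])

lemma V_scale: "a \<in> \<V> k \<Longrightarrow> c *\<^sub>R a \<in> \<V> k"
  by (auto simp: multivec_def ext_sections_scale[OF M vb])

lemma V_mult: "f \<in> \<R> \<Longrightarrow> a \<in> \<V> k \<Longrightarrow> f \<odot> a \<in> \<V> k"
  by (auto simp: multivec_def ext_sections_mult[OF M vb] fun_mult_simps)

lemma V_minus: "a \<in> \<V> k \<Longrightarrow> - a \<in> \<V> k"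
  using V_scale[of a k "-1"] by simp

lemma V_diff: "a \<in> \<V> k \<Longrightarrow> b \<in> \<V> k \<Longrightarrow> a - b \<in> \<V> k"
  using V_add[OF _ V_minus, of a k b] by simp

lemma V_sum: "(\<And>i. i \<in> I \<Longrightarrow> f i \<in> \<V> k) \<Longrightarrow> (\<Sum>i\<in>I. f i) \<in> \<V> k"
  by (induction I rule: infinite_finite_induct) (auto intro: V_add V_0)

lemma V_wedge:
  assumes "a \<in> \<V> p" "b \<in> \<V> q"
  shows "a \<and>\<^sub>w b \<in> \<V> (p + q)"
proof (cases "p < 0 \<or> q < 0")
  case True
  then have "a = 0 \<or> b = 0" using assms V_neg by blast
  then show ?thesis using V_0 by auto
next
  case False
  then have "a \<and>\<^sub>w b \<in> sections M (ext_power (nat p + nat q) A)"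
    using assms by (intro ext_sections_wedge[OF M vb]) (auto simp: multivec_def)
  then show ?thesis using False by (simp add: multivec_def nat_add_distrib)
qed

lemma V_above_rank: "a \<in> \<V> k \<Longrightarrow> int n < k \<Longrightarrow> a = 0"
  using ext_sections_above_rank[OF M vb, of a "nat k"] by (auto simp: multivec_def split: if_splits)

lemma V_of_fun: "f \<in> \<R> \<Longrightarrow> of_fun f \<in> \<V> 0"
  using of_fun_in_ext_sections[OF M vb] by (simp add: multivec_def)

lemma V_0_of_fun:
  assumes "a \<in> \<V> 0"
  obtains f where "f \<in> \<R>" "a = of_fun f"
proof -
  have "a \<in> sections M (ext_power 0 A)" using assms by (simp add: multivec_def)
  then show thesis using ext_sections_0_of_fun[OF M vb] that by metis
qed

lemma V_of_section: "X \<in> \<Gamma> \<Longrightarrow> of_section A X \<in> \<V> 1"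
  using vec_in_ext_sections[OF M vb] by (simp add: multivec_def of_section_def)

abbreviation W where "W \<equiv> wedge_sections A"

lemma W_Nil: "W [] = of_fun (\<lambda>x. 1)"
  by (simp add: wedge_sections_def wedge_list_Nil of_fun_def)

lemma W_Cons: "W (X # Xs) = of_section A X \<and>\<^sub>w W Xs"
  by (simp add: wedge_sections_Cons[OF M vb] of_section_def)

lemma W_append: "W (Xs @ Ys) = W Xs \<and>\<^sub>w W Ys"
  by (simp add: wedge_sections_def wedge_def wedge_list_append)

lemma V_W: "set Xs \<subseteq> \<Gamma> \<Longrightarrow> W Xs \<in> \<V> (int (length Xs))"
  using wedge_sections_in[OF M vb] by (simp add: V_nat)

lemma of_section_add: "X \<in> \<Gamma> \<Longrightarrow> Y \<in> \<Gamma> \<Longrightarrow> of_section A (X + Y) = of_section A X + of_section A Y"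
  using sections_subset_fibre[OF M vb] by (auto simp: of_section_def fun_eq_iff ext_vec_add plus_fun_apply)

lemma of_section_mult: "X \<in> \<Gamma> \<Longrightarrow> of_section A (f \<odot> X) = f \<odot> of_section A X"
  using sections_subset_fibre[OF M vb] by (auto simp: of_section_def fun_mult_def ext_vec_scale)

lemma \<Gamma>_add: "X \<in> \<Gamma> \<Longrightarrow> Y \<in> \<Gamma> \<Longrightarrow> X + Y \<in> \<Gamma>"
  by (rule sections_add[OF M vb])

lemma \<Gamma>_mult: "f \<in> \<R> \<Longrightarrow> X \<in> \<Gamma> \<Longrightarrow> f \<odot> X \<in> \<Gamma>"
  by (rule sections_mult[OF M vb])

lemma \<Gamma>_scale: "X \<in> \<Gamma> \<Longrightarrow> c *\<^sub>R X \<in> \<Gamma>"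
  by (rule sections_scale[OF M vb])

lemma \<Gamma>_bracket: "X \<in> \<Gamma> \<Longrightarrow> Y \<in> \<Gamma> \<Longrightarrow> bracket A X Y \<in> \<Gamma>"
  using A unfolding lie_algebroid_def by blast

lemmas \<R>_closed = smooth_funs_closed[OF M]

lemma wedge_commute:
  assumes "a \<in> \<V> p" "b \<in> \<V> q"
  shows "a \<and>\<^sub>w b = koszul_sign (p * q) *\<^sub>R (b \<and>\<^sub>w a)"
proof (cases "p < 0 \<or> q < 0")
  case True
  then have "a = 0 \<or> b = 0" using assms V_neg by blast
  then show ?thesis by auto
next
  case False
  then obtain i j where ij: "p = int i" "q = int j" by (meson nonneg_int_cases not_less)
  have "ext_wedge (a x) (b x) = (-1) ^ (i * j) *\<^sub>R ext_wedge (b x) (a x)" for x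
    using assms ext_sections_in[OF M vb, of a i x] ext_sections_in[OF M vb, of b j x]
    by (intro ext_wedge_commute) (auto simp: ij V_nat ext_power_space_iff)
  then show ?thesis
    by (intro ext) (simp add: ij wedge_def koszul_sign_of_nat scaleR_fun_apply flip: of_nat_mult)
qed

lemma section_anticommute:
  assumes "X \<in> \<Gamma>" "Y \<in> \<Gamma>"
  shows "of_section A X \<and>\<^sub>w of_section A Y \<and>\<^sub>w a = - (of_section A Y \<and>\<^sub>w of_section A X \<and>\<^sub>w a)"
proof -
  have "of_section A X \<and>\<^sub>w of_section A Y = - (of_section A Y \<and>\<^sub>w of_section A X)"
    using wedge_commute[OF V_of_section[OF assms(1)] V_of_section[OF assms(2)]] by simp
  then show ?thesis by (simp add: wedge_minus flip: wedge_assoc)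
qed

lemma zero_by_germs:
  fixes s :: "'m \<Rightarrow> 'w::real_vector"
  assumes "\<And>x. \<exists>\<rho>. \<rho> x \<noteq> 0 \<and> \<rho> x *\<^sub>R s x = 0"
  shows "s = 0"
proof
  fix x show "s x = 0 x" using assms[of x] by (auto simp: zero_fun_apply)
qed

lemma multivecs_V: "a \<in> \<V> k \<Longrightarrow> a \<in> multivecs M A"
proof (erule V_cases)
  fix j assume j: "a \<in> sections M (ext_power j A)"
  have "a = (\<Sum>i<Suc j. if i = j then a else 0)" by simp
  then show ?thesis
    unfolding multivecs_def mem_Collect_eq
    by (intro exI[of _ "Suc j"] exI[of _ "\<lambda>i. if i = j then a else 0"])
      (use j ext_sections_0[OF M vb] in \<open>auto simp: V_nat\<close>)
next
  assume "a = 0"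
  then show ?thesis unfolding multivecs_def mem_Collect_eq
    by (intro exI[of _ 0] exI[of _ "\<lambda>i. 0"]) simp
qed

lemma br_lin:
  shows br_add_right: "a \<in> \<V> p \<Longrightarrow> b \<in> \<V> q \<Longrightarrow> c \<in> \<V> r \<Longrightarrow> br a (b + c) = br a b + br a c"
    and br_scale_right: "a \<in> \<V> p \<Longrightarrow> b \<in> \<V> q \<Longrightarrow> br a (k *\<^sub>R b) = k *\<^sub>R br a b"
    and br_add_left: "a \<in> \<V> p \<Longrightarrow> b \<in> \<V> q \<Longrightarrow> c \<in> \<V> r \<Longrightarrow> br (b + c) a = br b a + br c a"
    and br_scale_left: "a \<in> \<V> p \<Longrightarrow> b \<in> \<V> q \<Longrightarrow> br (k *\<^sub>R b) a = k *\<^sub>R br b a"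
proof -
  have "bilinear_on_subspaces (multivecs M A) (multivecs M A) br" using br by (simp add: schouten_bracket_def)
  then have *: "a \<in> multivecs M A \<Longrightarrow> b \<in> multivecs M A \<Longrightarrow> c \<in> multivecs M A \<Longrightarrow>
      br a (b + c) = br a b + br a c \<and> br a (k *\<^sub>R b) = k *\<^sub>R br a b \<and>
      br (b + c) a = br b a + br c a \<and> br (k *\<^sub>R b) a = k *\<^sub>R br b a" for a b c k
    unfolding bilinear_on_subspaces_def linear_on_subspace_def by blast
  show "a \<in> \<V> p \<Longrightarrow> b \<in> \<V> q \<Longrightarrow> c \<in> \<V> r \<Longrightarrow> br a (b + c) = br a b + br a c"
    "a \<in> \<V> p \<Longrightarrow> b \<in> \<V> q \<Longrightarrow> c \<in> \<V> r \<Longrightarrow> br (b + c) a = br b a + br c a"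
    using * multivecs_V by blast+
  show "a \<in> \<V> p \<Longrightarrow> b \<in> \<V> q \<Longrightarrow> br a (k *\<^sub>R b) = k *\<^sub>R br a b"
    "a \<in> \<V> p \<Longrightarrow> b \<in> \<V> q \<Longrightarrow> br (k *\<^sub>R b) a = k *\<^sub>R br b a"
    using *[of a b b k] multivecs_V by blast+
qed

lemma br_0: "a \<in> \<V> p \<Longrightarrow> br a 0 = 0" "a \<in> \<V> p \<Longrightarrow> br 0 a = 0"
  using br_scale_right[OF _ V_0, of a p 0] br_scale_left[OF _ V_0, of a p 0] by simp_all

lemma br_minus_right: "a \<in> \<V> p \<Longrightarrow> b \<in> \<V> q \<Longrightarrow> br a (- b) = - br a b"
  using br_scale_right[of a p b q "-1"] by simp

lemma br_diff_right: "a \<in> \<V> p \<Longrightarrow> b \<in> \<V> q \<Longrightarrow> c \<in> \<V> q \<Longrightarrow> br a (b - c) = br a b - br a c"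
  using br_add_right[OF _ _ V_minus, of a p b q c q] br_minus_right[of a p c q] by simp

lemma V_br: "a \<in> \<V> p \<Longrightarrow> b \<in> \<V> q \<Longrightarrow> br a b \<in> \<V> (p + q - 1)"
proof -
  have "\<forall>p q. \<forall>a\<in>\<V> p. \<forall>b\<in>\<V> q. br a b \<in> \<V> (p + q - 1)"
    using br unfolding schouten_bracket_def by (elim conjE)
  then show "a \<in> \<V> p \<Longrightarrow> b \<in> \<V> q \<Longrightarrow> br a b \<in> \<V> (p + q - 1)" by blast
qed

lemma br_skew: "a \<in> \<V> p \<Longrightarrow> b \<in> \<V> q \<Longrightarrow> br a b = - (koszul_sign ((p - 1) * (q - 1)) *\<^sub>R br b a)"
  using br unfolding schouten_bracket_def by blast

lemma br_jacobi: "a \<in> \<V> p \<Longrightarrow> b \<in> \<V> q \<Longrightarrow> c \<in> \<V> r \<Longrightarrow>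
    br a (br b c) = br (br a b) c + koszul_sign ((p - 1) * (q - 1)) *\<^sub>R br b (br a c)"
  using br unfolding schouten_bracket_def by blast

lemma br_leibniz: "a \<in> \<V> p \<Longrightarrow> b \<in> \<V> q \<Longrightarrow> c \<in> \<V> r \<Longrightarrow>
    br a (b \<and>\<^sub>w c) = br a b \<and>\<^sub>w c + koszul_sign ((p - 1) * q) *\<^sub>R (b \<and>\<^sub>w br a c)"
  using br unfolding schouten_bracket_def by blast

lemma br_section_fun: "X \<in> \<Gamma> \<Longrightarrow> f \<in> \<R> \<Longrightarrow> br (of_section A X) (of_fun f) = of_fun (anchor_act A X f)"
  using br unfolding schouten_bracket_def by blast

lemma br_section_section:
  "X \<in> \<Gamma> \<Longrightarrow> Y \<in> \<Gamma> \<Longrightarrow> br (of_section A X) (of_section A Y) = of_section A (bracket A X Y)"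
  using br unfolding schouten_bracket_def by blast

lemma V_br_fun: "f \<in> \<R> \<Longrightarrow> a \<in> \<V> p \<Longrightarrow> br (of_fun f) a \<in> \<V> (p - 1)"
  using V_br[OF V_of_fun, of f a p] by simp

lemma V_br_section: "X \<in> \<Gamma> \<Longrightarrow> a \<in> \<V> p \<Longrightarrow> br (of_section A X) a \<in> \<V> p"
  using V_br[OF V_of_section, of X a p] by simp

lemma br_fun_fun: "f \<in> \<R> \<Longrightarrow> g \<in> \<R> \<Longrightarrow> br (of_fun f) (of_fun g) = 0"
  using V_neg[OF _ V_br_fun[OF _ V_of_fun]] by simp

lemma br_swap_fun: "f \<in> \<R> \<Longrightarrow> a \<in> \<V> p \<Longrightarrow> br a (of_fun f) = koszul_sign p *\<^sub>R br (of_fun f) a"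
  using br_skew[OF _ V_of_fun, of a p f] by (simp add: koszul_sign_diff)

lemma br_fun_section:
  "X \<in> \<Gamma> \<Longrightarrow> f \<in> \<R> \<Longrightarrow> br (of_fun f) (of_section A X) = - of_fun (anchor_act A X f)"
  using br_swap_fun[OF _ V_of_section, of f X] br_section_fun[of X f] by simp

lemma br_fun_leibniz: "f \<in> \<R> \<Longrightarrow> b \<in> \<V> q \<Longrightarrow> c \<in> \<V> r \<Longrightarrow>
    br (of_fun f) (b \<and>\<^sub>w c) = br (of_fun f) b \<and>\<^sub>w c + koszul_sign q *\<^sub>R (b \<and>\<^sub>w br (of_fun f) c)"
  using br_leibniz[OF V_of_fun, of f b q c r] by simp

lemma br_section_leibniz: "X \<in> \<Gamma> \<Longrightarrow> b \<in> \<V> q \<Longrightarrow> c \<in> \<V> r \<Longrightarrow>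
    br (of_section A X) (b \<and>\<^sub>w c) = br (of_section A X) b \<and>\<^sub>w c + b \<and>\<^sub>w br (of_section A X) c"
  using br_leibniz[OF V_of_section, of X b q c r] by simp

lemma br_fun_mult: "f \<in> \<R> \<Longrightarrow> g \<in> \<R> \<Longrightarrow> a \<in> \<V> p \<Longrightarrow> br (of_fun f) (g \<odot> a) = g \<odot> br (of_fun f) a"
  using br_fun_leibniz[OF _ V_of_fun, of f g a p] by (simp add: wedge_of_fun br_fun_fun)

lemma br_mult_right:
  assumes "f \<in> \<R>" "a \<in> \<V> p" "b \<in> \<V> q"
  shows "br a (f \<odot> b) = koszul_sign p *\<^sub>R (br (of_fun f) a \<and>\<^sub>w b) + f \<odot> br a b"
  using br_leibniz[OF assms(2) V_of_fun[OF assms(1)] assms(3)] br_swap_fun[OF assms(1,2)]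
  by (simp add: wedge_of_fun wedge_scale)

lemma br_leibniz_left:
  assumes a: "a \<in> \<V> p" and b: "b \<in> \<V> q" and c: "c \<in> \<V> r"
  shows "br (a \<and>\<^sub>w b) c = a \<and>\<^sub>w br b c + koszul_sign (q * (r - 1)) *\<^sub>R (br a c \<and>\<^sub>w b)"
proof -
  have "br (a \<and>\<^sub>w b) c = - (koszul_sign ((p + q - 1) * (r - 1)) *\<^sub>R
      (br c a \<and>\<^sub>w b + koszul_sign ((r - 1) * p) *\<^sub>R (a \<and>\<^sub>w br c b)))"
    using br_skew[OF V_wedge[OF a b] c] br_leibniz[OF c a b] by simp
  then show ?thesis unfolding br_skew[OF c a] br_skew[OF c b]
    by (cases "even p"; cases "even q"; cases "even r")
      (simp_all add: koszul_sign_def wedge_minus)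
qed

text \<open>Skew symmetry moves the function to the second argument; the resulting sign is the one of
  exchanging \<open>a\<close> with \<open>[f, b]\<close>.\<close>

lemma br_mult_left:
  assumes f: "f \<in> \<R>" and a: "a \<in> \<V> p" and b: "b \<in> \<V> q"
  shows "br (f \<odot> a) b = f \<odot> br a b + a \<and>\<^sub>w br (of_fun f) b"
proof -
  have "br (f \<odot> a) b = f \<odot> br a b + koszul_sign (p * (q - 1)) *\<^sub>R (br (of_fun f) b \<and>\<^sub>w a)"
    using br_leibniz_left[OF V_of_fun[OF f] a b] by (simp add: wedge_of_fun)
  also have "br (of_fun f) b \<and>\<^sub>w a = koszul_sign ((q - 1) * p) *\<^sub>R (a \<and>\<^sub>w br (of_fun f) b)"
    by (rule wedge_commute[OF V_br_fun[OF f b] a])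
  finally show ?thesis by (simp add: mult.commute)
qed

lemma br_one: "a \<in> \<V> p \<Longrightarrow> br (of_fun (\<lambda>x. 1)) a = 0"
proof -
  assume a: "a \<in> \<V> p"
  have one: "(\<lambda>x. 1) \<in> \<R>" by (rule \<R>_closed(1))
  have "(\<lambda>x. 1) \<odot> of_fun (\<lambda>x. 1) = (of_fun (\<lambda>x. 1) :: 'm \<Rightarrow> 'v ext)" by (simp add: of_fun_mult)
  then have "br (of_fun (\<lambda>x. 1)) a = (\<lambda>x. 1) \<odot> br (of_fun (\<lambda>x. 1)) a + of_fun (\<lambda>x. 1) \<and>\<^sub>w br (of_fun (\<lambda>x. 1)) a"
    using br_mult_left[OF one V_of_fun[OF one] a] by (simp only:)
  moreover have "(\<lambda>x. 1) \<odot> c = c" for c :: "'m \<Rightarrow> 'v ext" by (simp add: fun_mult_def)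
  ultimately show ?thesis by (metis add_cancel_right_right wedge_of_fun(1))
qed

text \<open>After multiplication by a suitable function any multivector of positive degree is a sum of
  products of sections, and a derivation of degree \<open>-1\<close> commutes with functions, for it kills them
  by degree.\<close>

lemma derivation_eq_0:
  assumes deg: "\<And>p a. a \<in> \<V> p \<Longrightarrow> d a \<in> \<V> (p - 1)"
    and add: "\<And>p a b. a \<in> \<V> p \<Longrightarrow> b \<in> \<V> p \<Longrightarrow> d (a + b) = d a + d b"
    and der: "\<And>p q a b. a \<in> \<V> p \<Longrightarrow> b \<in> \<V> q \<Longrightarrow> d (a \<and>\<^sub>w b) = d a \<and>\<^sub>w b + koszul_sign p *\<^sub>R (a \<and>\<^sub>w d b)"
    and sec: "\<And>X. X \<in> \<Gamma> \<Longrightarrow> d (of_section A X) = 0"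
    and s: "s \<in> \<V> p"
  shows "d s = 0"
proof -
  have d0: "d 0 = 0"
    using add[OF V_0[of 0] V_0[of 0]] by simp
  have dfun: "d (of_fun f) = 0" if "f \<in> \<R>" for f
    using V_neg[OF _ deg[OF V_of_fun[OF that]]] by simp
  have dW: "d (W Xs) = 0" if "set Xs \<subseteq> \<Gamma>" for Xs
    using that
  proof (induction Xs)
    case Nil
    then show ?case using dfun[OF \<R>_closed(1)] by (simp add: W_Nil)
  next
    case (Cons X Xs)
    then show ?case using der[OF V_of_section[of X] V_W[of Xs]] sec[of X] by (simp add: W_Cons)
  qed
  show ?thesis
  proof (rule V_cases[OF s])
    fix k assume k: "p = int k" "s \<in> sections M (ext_power k A)"
    show ?thesis
    proof (cases k)
      case 0
      then obtain f where "f \<in> \<R>" "s = of_fun f" using s k V_0_of_fun by auto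
      then show ?thesis using dfun by simp
    next
      case (Suc j)
      show ?thesis
      proof (rule zero_by_germs)
        fix x
        obtain \<rho> G and S :: "nat list set" where \<rho>: "\<rho> \<in> \<R>" "\<rho> x \<noteq> 0" "finite S"
          "\<And>I. I \<in> S \<Longrightarrow> set (G I) \<subseteq> \<Gamma> \<and> length (G I) = Suc j" "\<rho> \<odot> s = (\<Sum>I\<in>S. W (G I))"
          by (rule local_wedges[OF M vb k(2)[unfolded Suc], where x = x]) blast
        have "d (\<Sum>I\<in>T. W (G I)) = 0 \<and> (\<Sum>I\<in>T. W (G I)) \<in> \<V> (int (Suc j))" if "finite T" "T \<subseteq> S" for T
          using that
        proof (induction T)
          case (insert I T)
          then have "W (G I) \<in> \<V> (int (Suc j))" "d (W (G I)) = 0"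
            using \<rho>(4)[of I] V_W[of "G I"] dW[of "G I"] by auto
          then show ?case using insert add V_add by simp
        qed (simp add: d0 V_0)
        from this[OF \<rho>(3)] have "d (\<rho> \<odot> s) = 0" by (simp add: \<rho>(5))
        moreover have "d (\<rho> \<odot> s) = \<rho> \<odot> d s"
          using der[OF V_of_fun[OF \<rho>(1)] s] dfun[OF \<rho>(1)] by (simp add: wedge_of_fun)
        ultimately have "\<rho> \<odot> d s = 0" by simp
        then have "(\<rho> \<odot> d s) x = 0 x" by (rule fun_cong)
        then have "\<rho> x *\<^sub>R d s x = 0" by (simp add: fun_mult_def zero_fun_apply)
        with \<rho>(2) show "\<exists>\<rho>. \<rho> x \<noteq> 0 \<and> \<rho> x *\<^sub>R d s x = 0" by blast
      qed
    qed
  qed (simp add: d0)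
qed

end


section \<open>The generator of a connection on the top exterior power\<close>

locale top_connection = algebroid_bracket M A n br
  for M :: "('m::{t2_space,second_countable_topology}, 'e::real_inner) atlas"
    and A :: "('m, 'v::real_vector) algebroid" and n :: nat
    and br :: "('m \<Rightarrow> 'v ext) \<Rightarrow> ('m \<Rightarrow> 'v ext) \<Rightarrow> ('m \<Rightarrow> 'v ext)" +
  fixes nabla :: "('m \<Rightarrow> 'v) \<Rightarrow> ('m \<Rightarrow> 'v ext) \<Rightarrow> ('m \<Rightarrow> 'v ext)"
    and g :: "('m \<Rightarrow> 'v) \<Rightarrow> 'm \<Rightarrow> real"
  assumes nabla: "nabla \<in> connections M A (ext_power n A)"
    and g_smooth: "X \<in> sections M A \<Longrightarrow> g X \<in> smooth_funs M"
    and g_top: "X \<in> sections M A \<Longrightarrow> \<Lambda> \<in> multivec M A (int n) \<Longrightarrow>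
      g X \<odot> \<Lambda> = br (of_section A X) \<Lambda> - nabla X \<Lambda>"
begin

abbreviation "\<S> \<equiv> of_section A"

lemma nabla_add:
  assumes "X \<in> \<Gamma>" "Y \<in> \<Gamma>" "\<Lambda> \<in> \<V> (int n)"
  shows "nabla (X + Y) \<Lambda> = nabla X \<Lambda> + nabla Y \<Lambda>"
  using nabla assms
  unfolding connections_def bilinear_on_subspaces_def linear_on_subspace_def V_nat by blast

lemma nabla_mult:
  assumes "f \<in> \<R>" "X \<in> \<Gamma>" "\<Lambda> \<in> \<V> (int n)"
  shows "nabla (f \<odot> X) \<Lambda> = f \<odot> nabla X \<Lambda>"
  using nabla assms unfolding connections_def V_nat by blast

text \<open>The value that the generator identity forces on a product of sections, given its value \<open>g X\<close> on
  each section: the first factor is split off, with sign \<open>-1\<close> for its degree. It depends a priori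
  on the list and not only on the product.\<close>

primrec koszul_op :: "('m \<Rightarrow> 'v) list \<Rightarrow> 'm \<Rightarrow> 'v ext" where
  "koszul_op [] = 0"
| "koszul_op (X # Xs) = g X \<odot> W Xs - br (\<S> X) (W Xs) - \<S> X \<and>\<^sub>w koszul_op Xs"

lemma V_koszul_op: "set Xs \<subseteq> \<Gamma> \<Longrightarrow> koszul_op Xs \<in> \<V> (int (length Xs) - 1)"
proof (induction Xs)
  case (Cons X Xs)
  then have "\<S> X \<and>\<^sub>w koszul_op Xs \<in> \<V> (1 + (int (length Xs) - 1))"
    by (intro V_wedge V_of_section) auto
  with Cons.prems show ?case
    by (auto intro!: V_diff V_mult g_smooth V_br_section V_W)
qed (simp add: V_0)

text \<open>The generator identity for two products of sections. By the left Leibniz rule for \<open>[,]\<close> the terms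
  \<open>[Y, W Xs]\<close> that arise from splitting off the first factor \<open>Y\<close> on both sides agree.\<close>

lemma koszul_op_append:
  assumes "set Ys \<subseteq> \<Gamma>" "set Xs \<subseteq> \<Gamma>"
  shows "koszul_op (Ys @ Xs) = koszul_sign (int (length Ys)) *\<^sub>R br (W Ys) (W Xs) + koszul_op Ys \<and>\<^sub>w W Xs
    + koszul_sign (int (length Ys)) *\<^sub>R (W Ys \<and>\<^sub>w koszul_op Xs)"
  using assms(1)
proof (induction Ys)
  case Nil
  show ?case using br_one[OF V_W[OF assms(2)]] by (simp add: W_Nil wedge_of_fun fun_mult_def)
next
  case (Cons Y Ys)
  let ?q = "int (length Ys)" and ?r = "int (length Xs)"
  have Y: "\<S> Y \<in> \<V> 1" and WY: "W Ys \<in> \<V> ?q" and WX: "W Xs \<in> \<V> ?r" and YG: "Y \<in> \<Gamma>"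
    using Cons.prems V_of_section V_W assms(2) by auto
  have e1: "br (\<S> Y) (W Ys \<and>\<^sub>w W Xs) = br (\<S> Y) (W Ys) \<and>\<^sub>w W Xs + W Ys \<and>\<^sub>w br (\<S> Y) (W Xs)"
    by (rule br_section_leibniz[OF YG WY WX])
  have "br (\<S> Y) (W Xs) \<and>\<^sub>w W Ys = koszul_sign (?r * ?q) *\<^sub>R (W Ys \<and>\<^sub>w br (\<S> Y) (W Xs))"
    by (rule wedge_commute[OF V_br_section[OF YG WX] WY])
  then have e2: "br (\<S> Y \<and>\<^sub>w W Ys) (W Xs) = \<S> Y \<and>\<^sub>w br (W Ys) (W Xs) + koszul_sign ?q *\<^sub>R (W Ys \<and>\<^sub>w br (\<S> Y) (W Xs))"
    unfolding br_leibniz_left[OF Y WY WX]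
    by (cases "even ?q"; cases "even ?r") (simp_all add: koszul_sign_def)
  have IH: "koszul_op (Ys @ Xs) = koszul_sign ?q *\<^sub>R br (W Ys) (W Xs) + koszul_op Ys \<and>\<^sub>w W Xs
    + koszul_sign ?q *\<^sub>R (W Ys \<and>\<^sub>w koszul_op Xs)"
    using Cons by simp
  show ?case
    by (cases "even ?q") (simp_all add: IH W_Cons W_append e1 e2 koszul_sign_def wedge_add wedge_diff
        wedge_minus wedge_assoc wedge_fun_mult algebra_simps)
qed

lemma W_swap: "set l1 \<subseteq> \<Gamma> \<Longrightarrow> a \<in> \<Gamma> \<Longrightarrow> b \<in> \<Gamma> \<Longrightarrow> W (l1 @ a # b # l2) = - W (l1 @ b # a # l2)"
  using section_anticommute[of a b "W l2"] by (simp add: W_append W_Cons wedge_minus)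

text \<open>At the head of a list the terms with \<open>[a, b]\<close> are the only ones that do not cancel in pairs, and
  these are skew-symmetric. Further to the right the sign passes through the formula for appended
  lists.\<close>

lemma koszul_op_swap:
  assumes l: "set l1 \<subseteq> \<Gamma>" "a \<in> \<Gamma>" "b \<in> \<Gamma>" "set l2 \<subseteq> \<Gamma>"
  shows "koszul_op (l1 @ a # b # l2) = - koszul_op (l1 @ b # a # l2)"
proof -
  let ?w = "W l2" and ?q = "int (length l2)"
  have w: "?w \<in> \<V> ?q" by (rule V_W[OF l(4)])
  have e1: "br (\<S> a) (\<S> b \<and>\<^sub>w ?w) = br (\<S> a) (\<S> b) \<and>\<^sub>w ?w + \<S> b \<and>\<^sub>w br (\<S> a) ?w"
    and e2: "br (\<S> b) (\<S> a \<and>\<^sub>w ?w) = br (\<S> b) (\<S> a) \<and>\<^sub>w ?w + \<S> a \<and>\<^sub>w br (\<S> b) ?w"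
    using l w by (auto intro!: br_section_leibniz V_of_section)
  have e3: "br (\<S> a) (\<S> b) = - br (\<S> b) (\<S> a)"
    using br_skew[OF V_of_section[OF l(2)] V_of_section[OF l(3)]] by simp
  have e4: "\<S> a \<and>\<^sub>w \<S> b \<and>\<^sub>w koszul_op l2 = - (\<S> b \<and>\<^sub>w \<S> a \<and>\<^sub>w koszul_op l2)"
    by (rule section_anticommute[OF l(2,3)])
  have base: "koszul_op (a # b # l2) = - koszul_op (b # a # l2)"
    by (simp add: W_Cons e1 e2 e3 e4 wedge_add wedge_diff wedge_minus wedge_fun_mult)
  have ws: "W (a # b # l2) = - W (b # a # l2)" using W_swap[of "[]" a b l2] l by simp
  have br: "br (W l1) (- W (b # a # l2)) = - br (W l1) (W (b # a # l2))"
    using l V_W[of l1] V_W[of "b # a # l2"] by (intro br_minus_right) auto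
  show ?thesis
    using l by (simp only: koszul_op_append set_simps insert_subset base ws br wedge_minus)
      (simp add: wedge_minus)
qed

text \<open>If the remaining factors form a top degree product, the Lie derivative cancels and only the
  connection is left. In contrast to the Lie derivative it is function-linear in \<open>X\<close>.\<close>

lemma koszul_op_top_Cons:
  assumes "X \<in> \<Gamma>" "set Xs \<subseteq> \<Gamma>" "length Xs = n"
  shows "koszul_op (X # Xs) = - nabla X (W Xs) - \<S> X \<and>\<^sub>w koszul_op Xs"
  using g_top[OF assms(1), of "W Xs"] V_W[OF assms(2)] assms(3) by (simp add: algebra_simps)

text \<open>This is the step that needs \<open>g\<close> to come from a connection on the top exterior power. On \<open>n + 1\<close>
  sections the operator is function-linear in the first one, hence by alternation in each of them.
  So all arguments can be reduced to the members of a local frame, two of which must coincide.\<close>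

lemma koszul_op_above_rank:
  assumes Zs: "set Zs \<subseteq> \<Gamma>" "length Zs = Suc n"
  shows "koszul_op Zs = 0"
proof
  fix x
  obtain \<rho> X where \<rho>: "\<rho> \<in> \<R>" "\<rho> x \<noteq> 0" and X: "\<And>i. i < n \<Longrightarrow> X i \<in> \<Gamma>"
    and gen: "\<And>Z. Z \<in> \<Gamma> \<Longrightarrow> \<exists>f. (\<forall>i<n. f i \<in> \<R>) \<and> (\<forall>y. \<rho> y *\<^sub>R Z y = (\<Sum>i<n. f i y *\<^sub>R X i y))"
    by (rule local_generators[OF M vb, of x]) blast
  define Z where "Z l \<longleftrightarrow> (set l \<subseteq> \<Gamma> \<longrightarrow> length l = Suc n \<longrightarrow> koszul_op l x = 0)" for l
  have swap: "Z (l1 @ b # a # l2)" if "Z (l1 @ a # b # l2)" for l1 a b l2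
    using that koszul_op_swap[of l1 a b l2] unfolding Z_def by (auto simp: uminus_apply)
  \<comment> \<open>By alternation it is enough to treat the first slot.\<close>
  have front: "Z (l1 @ z # l2) \<longleftrightarrow> Z (z # l1 @ l2)" for l1 z l2
    using zero_closed_under_perm[of Z "l1 @ z # l2" "z # l1 @ l2" "[]"]
      zero_closed_under_perm[of Z "z # l1 @ l2" "l1 @ z # l2" "[]"] swap by auto
  have lin: "koszul_op (z # l) x = 0"
    if l: "set l \<subseteq> \<Gamma>" "length l = n" and z: "z \<in> \<Gamma>" and b: "\<And>i. i < n \<Longrightarrow> koszul_op (X i # l) x = 0" for z l
  proof -
    have Wl: "W l \<in> \<V> (int n)" using V_W[OF l(1)] l(2) by simp
    define L where "L z = koszul_op (z # l) x" for z
    have Lz: "L z = - nabla z (W l) x - (\<S> z \<and>\<^sub>w koszul_op l) x" if "z \<in> \<Gamma>" for z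
      unfolding L_def koszul_op_top_Cons[OF that l] by (simp add: minus_apply uminus_apply)
    have Lm: "L (f \<odot> z) = f x *\<^sub>R L z" if "z \<in> \<Gamma>" "f \<in> \<R>" for f z
      by (simp add: Lz that \<Gamma>_mult nabla_mult Wl of_section_mult wedge_fun_mult)
        (simp add: fun_mult_def algebra_simps)
    have La: "L (z + z') = L z + L z'" if "z \<in> \<Gamma>" "z' \<in> \<Gamma>" for z z'
      by (simp add: Lz that \<Gamma>_add nabla_add Wl of_section_add wedge_add plus_fun_apply)
    obtain f where f: "\<And>i. i < n \<Longrightarrow> f i \<in> \<R>" "\<And>y. \<rho> y *\<^sub>R z y = (\<Sum>i<n. f i y *\<^sub>R X i y)"
      using gen[OF z] by blast
    have z0: "(\<lambda>y. 0 *\<^sub>R z y) = (\<lambda>y. 0) \<odot> z" by (simp add: fun_mult_def)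
    have part: "L (\<lambda>y. \<Sum>i<k. f i y *\<^sub>R X i y) = 0 \<and> (\<lambda>y. \<Sum>i<k. f i y *\<^sub>R X i y) \<in> \<Gamma>" if "k \<le> n" for k
      using that
    proof (induction k)
      case 0
      have "(\<lambda>y. \<Sum>i<0. f i y *\<^sub>R X i y) = (\<lambda>y. 0) \<odot> z" by (simp add: fun_mult_def)
      then show ?case using Lm[OF z \<R>_closed(1)[of 0]] \<Gamma>_mult[OF \<R>_closed(1)[of 0] z] by simp
    next
      case (Suc k)
      have "(\<lambda>y. \<Sum>i<Suc k. f i y *\<^sub>R X i y) = (\<lambda>y. \<Sum>i<k. f i y *\<^sub>R X i y) + f k \<odot> X k"
        by (simp add: fun_mult_def plus_fun_def)
      moreover have "f k \<odot> X k \<in> \<Gamma>" "L (f k \<odot> X k) = 0"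
        using Suc.prems f(1)[of k] X[of k] b[of k] Lm[of "X k" "f k"] by (auto intro: \<Gamma>_mult simp: L_def)
      ultimately show ?case using Suc La \<Gamma>_add by simp
    qed
    have "(\<lambda>y. \<Sum>i<n. f i y *\<^sub>R X i y) = \<rho> \<odot> z" using f(2) by (simp add: fun_mult_def)
    then have "\<rho> x *\<^sub>R L z = 0" using Lm[OF z \<rho>(1)] part[OF order_refl] by simp
    then show ?thesis using \<rho>(2) by (simp add: L_def)
  qed
  have "Z Zs"
  proof (rule zero_by_slots[of "X ` {..<n}" \<Gamma> Z "Suc n"])
    show "X ` {..<n} \<subseteq> \<Gamma>" using X by auto
    fix l1 z l2 assume l: "set l1 \<subseteq> \<Gamma>" "set l2 \<subseteq> \<Gamma>" "z \<in> \<Gamma>"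
      and b: "\<And>b. b \<in> X ` {..<n} \<Longrightarrow> Z (l1 @ b # l2)"
    have "Z (z # l1 @ l2)"
      unfolding Z_def
    proof (intro impI)
      assume len: "length (z # l1 @ l2) = Suc n"
      show "koszul_op (z # l1 @ l2) x = 0"
      proof (rule lin)
        fix i assume i: "i < n"
        have "Z (X i # l1 @ l2)" using b[of "X i"] i front[of l1 "X i" l2] by auto
        then show "koszul_op (X i # l1 @ l2) x = 0"
          using l len X[OF i] by (simp add: Z_def)
      qed (use l len in auto)
    qed
    then show "Z (l1 @ z # l2)" using front by blast
  next
    fix l assume l: "length l = Suc n" "set l \<subseteq> X ` {..<n}"
    have "card (X ` {..<n}) \<le> n" using card_image_le[of "{..<n}" X] by simp
    then have "\<not> distinct l"
      using l card_mono[OF _ l(2)] distinct_card[of l] by auto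
    show "Z l"
    proof (rule zero_of_not_distinct[of Z \<Gamma>])
      show "set l \<subseteq> \<Gamma>" using l X by auto
      fix y r assume y: "set (y # r) \<subseteq> \<Gamma>"
      have "koszul_op (y # y # r) = - koszul_op (y # y # r)"
        using koszul_op_swap[of "[]" y y r] y by simp
      then have "koszul_op (y # y # r) x = - koszul_op (y # y # r) x" by (metis uminus_apply)
      then have "2 *\<^sub>R koszul_op (y # y # r) x = 0" by (simp add: scaleR_2 eq_neg_iff_add_eq_0)
      then have "koszul_op (y # y # r) x = 0" by simp
      then show "Z (y # y # r)" by (simp add: Z_def)
    qed (use swap \<open>\<not> distinct l\<close> in auto)
  qed (use Zs in auto)
  then show "koszul_op Zs x = 0 x" using Zs by (simp add: Z_def zero_fun_apply)
qed

text \<open>If \<open>s\<close> and \<open>Ys\<close> have total degree \<open>n + 1\<close>, then \<open>W Ys \<and>\<^sub>w s\<close> is zero, and the generator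
  identity for this product becomes a relation between \<open>s\<close> and its image \<open>t\<close> under the generator.
  By nondegeneracy of the wedge pairing this relation determines \<open>t\<close>, and it refers to no
  representation of \<open>s\<close> as a sum of products: the generator is well defined.\<close>

definition defect :: "('m \<Rightarrow> 'v) list \<Rightarrow> ('m \<Rightarrow> 'v ext) \<Rightarrow> ('m \<Rightarrow> 'v ext) \<Rightarrow> 'm \<Rightarrow> 'v ext" where
  "defect Ys s t = koszul_sign (int (length Ys)) *\<^sub>R br (W Ys) s + koszul_op Ys \<and>\<^sub>w s
    + koszul_sign (int (length Ys)) *\<^sub>R (W Ys \<and>\<^sub>w t)"

definition gen_rel :: "nat \<Rightarrow> ('m \<Rightarrow> 'v ext) \<Rightarrow> ('m \<Rightarrow> 'v ext) \<Rightarrow> bool" where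
  "gen_rel k s t \<longleftrightarrow> t \<in> \<V> (int k - 1) \<and>
    (\<forall>Ys. set Ys \<subseteq> \<Gamma> \<longrightarrow> length Ys + k = Suc n \<longrightarrow> defect Ys s t = 0)"

lemma gen_rel_W: "set Zs \<subseteq> \<Gamma> \<Longrightarrow> gen_rel (length Zs) (W Zs) (koszul_op Zs)"
  unfolding gen_rel_def defect_def
  using V_koszul_op koszul_op_append koszul_op_above_rank by (metis Un_least length_append set_append)

lemma gen_rel_unique:
  assumes "gen_rel k s t" "gen_rel k s t'"
  shows "t = t'"
proof -
  have t: "t \<in> \<V> (int k - 1)" "t' \<in> \<V> (int k - 1)" using assms by (auto simp: gen_rel_def)
  have d: "t - t' \<in> \<V> (int k - 1)" by (rule V_diff[OF t])
  have "t - t' = 0"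
  proof (cases "k = 0 \<or> Suc n < k")
    case True
    then show ?thesis using V_neg[OF _ d] V_above_rank[OF d] by linarith
  next
    case False
    then obtain m where m: "k = Suc m" "m \<le> n" by (cases k) auto
    show ?thesis
    proof
      fix x
      have "(t - t') x = 0"
      proof (rule ext_section_eq_0[OF M vb])
        show "t - t' \<in> sections M (ext_power m A)" using d m by (simp add: V_nat)
        show "m + (n - m) = n" using m by simp
        fix Ys assume Ys: "set Ys \<subseteq> \<Gamma>" "length Ys = n - m"
        then have "defect Ys s t = 0" "defect Ys s t' = 0"
          using assms m by (auto simp: gen_rel_def)
        then have "koszul_sign (int (length Ys)) *\<^sub>R (W Ys \<and>\<^sub>w t) = koszul_sign (int (length Ys)) *\<^sub>R (W Ys \<and>\<^sub>w t')"
          unfolding defect_def by (metis add_left_cancel)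
        then have "W Ys \<and>\<^sub>w t = W Ys \<and>\<^sub>w t'" by (metis koszul_sign_scaleR)
        then show "(W Ys \<and>\<^sub>w (t - t')) x = 0" by (simp add: wedge_diff zero_fun_apply)
      qed
      then show "(t - t') x = 0 x" by (simp add: zero_fun_apply)
    qed
  qed
  then show ?thesis by simp
qed

lemma defect_add:
  "set Ys \<subseteq> \<Gamma> \<Longrightarrow> s \<in> \<V> k \<Longrightarrow> s' \<in> \<V> k \<Longrightarrow> defect Ys (s + s') (t + t') = defect Ys s t + defect Ys s' t'"
  unfolding defect_def by (simp add: br_add_right[OF V_W] wedge_add algebra_simps)

lemma gen_rel_add:
  "s \<in> \<V> (int k) \<Longrightarrow> s' \<in> \<V> (int k) \<Longrightarrow> gen_rel k s t \<Longrightarrow> gen_rel k s' t' \<Longrightarrow> gen_rel k (s + s') (t + t')"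
  unfolding gen_rel_def by (simp add: V_add defect_add)

lemma gen_rel_0: "gen_rel k 0 0"
  unfolding gen_rel_def defect_def by (auto simp: V_0 br_0[OF V_W])

lemma gen_rel_scale: "s \<in> \<V> (int k) \<Longrightarrow> gen_rel k s t \<Longrightarrow> gen_rel k (c *\<^sub>R s) (c *\<^sub>R t)"
proof -
  assume s: "s \<in> \<V> (int k)" and r: "gen_rel k s t"
  have "defect Ys (c *\<^sub>R s) (c *\<^sub>R t) = c *\<^sub>R defect Ys s t" if "set Ys \<subseteq> \<Gamma>" for Ys
    unfolding defect_def
    by (simp add: br_scale_right[OF V_W[OF that] s] wedge_scale scaleR_add_right mult.commute)
  with r show ?thesis unfolding gen_rel_def by (simp add: V_scale)
qed

lemma gen_rel_sum:
  "(\<And>i. i \<in> I \<Longrightarrow> s i \<in> \<V> (int k) \<and> gen_rel k (s i) (t i)) \<Longrightarrow> gen_rel k (\<Sum>i\<in>I. s i) (\<Sum>i\<in>I. t i)"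
proof (induction I rule: infinite_finite_induct)
  case (insert i I)
  then show ?case by (simp add: gen_rel_add V_sum)
qed (simp_all add: gen_rel_0)

text \<open>The correction terms add up to \<open>[f, W Ys \<and> s]\<close>, the bracket with a product of degree \<open>n + 1\<close>.\<close>

lemma defect_mult:
  assumes f: "f \<in> \<R>" and s: "s \<in> \<V> (int k)" and Ys: "set Ys \<subseteq> \<Gamma>" "length Ys + k = Suc n"
  shows "defect Ys (f \<odot> s) (f \<odot> t + br (of_fun f) s) = f \<odot> defect Ys s t"
proof -
  note WY = V_W[OF Ys(1)]
  let ?q = "koszul_sign (int (length Ys))"
  have "W Ys \<and>\<^sub>w s = 0" using V_above_rank[OF V_wedge[OF WY s]] Ys(2) by simp
  then have "0 = br (of_fun f) (W Ys \<and>\<^sub>w s)" using br_0[OF V_of_fun[OF f]] by simp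
  also have "\<dots> = br (of_fun f) (W Ys) \<and>\<^sub>w s + ?q *\<^sub>R (W Ys \<and>\<^sub>w br (of_fun f) s)"
    by (rule br_fun_leibniz[OF f WY s])
  finally have z: "?q *\<^sub>R (W Ys \<and>\<^sub>w br (of_fun f) s) = - (br (of_fun f) (W Ys) \<and>\<^sub>w s)"
    by (simp add: eq_neg_iff_add_eq_0 add.commute)
  show ?thesis
    unfolding defect_def br_mult_right[OF f WY s]
    by (simp add: wedge_fun_mult fun_mult_simps wedge_add scaleR_add_right z)
qed

lemma gen_rel_mult:
  assumes "f \<in> \<R>" "s \<in> \<V> (int k)" "gen_rel k s t"
  shows "gen_rel k (f \<odot> s) (f \<odot> t + br (of_fun f) s)"
  using assms defect_mult[OF assms(1,2)] unfolding gen_rel_def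
  by (auto intro!: V_add V_mult V_br_fun simp: fun_mult_simps)

text \<open>Near each point a multiple \<open>\<rho> s\<close> is a sum of products of sections and has an image \<open>\<tau>\<close>; then
  \<open>\<rho> t = \<tau> - [\<rho>, s]\<close> is forced. By uniqueness the solutions at different points agree, so that \<open>t\<close>,
  chosen pointwise, is a section.\<close>

lemma gen_rel_exists:
  assumes s: "s \<in> \<V> (int k)"
  shows "\<exists>t. gen_rel k s t"
proof (cases k)
  case 0
  then obtain h where h: "h \<in> \<R>" "s = of_fun h" using s V_0_of_fun by auto
  have "defect Ys s 0 = 0" if Ys: "set Ys \<subseteq> \<Gamma>" "length Ys = Suc n" for Ys
  proof -
    have "W Ys = 0" using V_above_rank[OF V_W[OF Ys(1)]] Ys(2) by simp
    then show ?thesis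
      using koszul_op_above_rank[OF Ys] br_0(2)[OF V_of_fun[OF h(1)]] by (simp add: defect_def h(2))
  qed
  then show ?thesis using 0 by (intro exI[of _ 0]) (auto simp: gen_rel_def V_0)
next
  case (Suc j)
  have "\<exists>\<rho> \<tau>. \<rho> \<in> \<R> \<and> \<rho> x \<noteq> 0 \<and> gen_rel k (\<rho> \<odot> s) \<tau>" for x
  proof -
    obtain \<rho> G and S :: "nat list set" where \<rho>: "\<rho> \<in> \<R>" "\<rho> x \<noteq> 0" "finite S"
      "\<And>I. I \<in> S \<Longrightarrow> set (G I) \<subseteq> \<Gamma> \<and> length (G I) = Suc j" "\<rho> \<odot> s = (\<Sum>I\<in>S. W (G I))"
      by (rule local_wedges[OF M vb s[unfolded Suc V_nat], where x = x]) blast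
    have "gen_rel k (\<Sum>I\<in>S. W (G I)) (\<Sum>I\<in>S. koszul_op (G I))"
      by (rule gen_rel_sum) (use \<rho>(4) V_W gen_rel_W Suc in \<open>metis\<close>)
    with \<rho> show ?thesis by metis
  qed
  then obtain r \<tau> where r: "\<And>x. r x \<in> \<R>" "\<And>x. r x x \<noteq> 0" and \<tau>: "\<And>x. gen_rel k (r x \<odot> s) (\<tau> x)"
    by metis
  define u where "u x = \<tau> x - br (of_fun (r x)) s" for x
  define t where "t y = inverse (r y y) *\<^sub>R u y y" for y
  \<comment> \<open>Both sides are read off from the image of \<open>r x r y s\<close>, computed in two ways.\<close>
  have u: "r x \<odot> u y = r y \<odot> u x" for x y
  proof -
    have "gen_rel k (r x \<odot> r y \<odot> s) (r x \<odot> \<tau> y + br (of_fun (r x)) (r y \<odot> s))"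
      "gen_rel k (r y \<odot> r x \<odot> s) (r y \<odot> \<tau> x + br (of_fun (r y)) (r x \<odot> s))"
      using gen_rel_mult r V_mult s \<tau> by blast+
    then have "r x \<odot> \<tau> y + br (of_fun (r x)) (r y \<odot> s) = r y \<odot> \<tau> x + br (of_fun (r y)) (r x \<odot> s)"
      using gen_rel_unique by (metis fun_mult_commute)
    then show ?thesis
      unfolding u_def br_fun_mult[OF r(1) r(1) s] fun_mult_simps by (simp add: algebra_simps)
  qed
  have rt: "r x \<odot> t = u x" for x
  proof
    fix y
    have "r x y *\<^sub>R u y y = r y y *\<^sub>R u x y" using fun_cong[OF u[of x y], of y] by (simp add: fun_mult_def)
    then have "inverse (r y y) *\<^sub>R r x y *\<^sub>R u y y = u x y" using r(2)[of y] by simp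
    then show "(r x \<odot> t) y = u x y" by (simp add: fun_mult_def t_def mult.commute)
  qed
  have uV: "u x \<in> \<V> (int j)" for x
    using \<tau>[of x] V_br_fun[OF r(1) s] Suc unfolding u_def gen_rel_def by (auto intro: V_diff)
  have "t \<in> sections M (ext_power j A)"
    by (rule ext_sections_local[OF M vb]) (use rt uV r V_nat in metis)
  then have tV: "t \<in> \<V> (int k - 1)" by (simp add: Suc V_nat)
  have "defect Ys s t = 0" if Ys: "set Ys \<subseteq> \<Gamma>" "length Ys + k = Suc n" for Ys
  proof (rule zero_by_germs)
    fix x
    have "r x \<odot> defect Ys s t = defect Ys (r x \<odot> s) (\<tau> x)"
      unfolding defect_mult[OF r(1) s Ys, symmetric] rt u_def by simp
    also have "\<dots> = 0" using \<tau>[of x] Ys by (simp add: gen_rel_def)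
    finally have "(r x \<odot> defect Ys s t) x = 0 x" by (rule fun_cong)
    then show "\<exists>\<rho>. \<rho> x \<noteq> 0 \<and> \<rho> x *\<^sub>R defect Ys s t x = 0"
      using r(2)[of x] by (auto simp: fun_mult_def zero_fun_apply)
  qed
  then show ?thesis using tV unfolding gen_rel_def by blast
qed

definition gen_hom :: "nat \<Rightarrow> ('m \<Rightarrow> 'v ext) \<Rightarrow> 'm \<Rightarrow> 'v ext" where
  "gen_hom k s = (THE t. gen_rel k s t)"

lemma gen_hom: "s \<in> \<V> (int k) \<Longrightarrow> gen_rel k s (gen_hom k s)"
  unfolding gen_hom_def using gen_rel_exists gen_rel_unique by (metis theI)

lemma gen_hom_eqI: "gen_rel k s t \<Longrightarrow> gen_hom k s = t"
  unfolding gen_hom_def using gen_rel_unique by blast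

lemma V_gen_hom: "s \<in> \<V> (int k) \<Longrightarrow> gen_hom k s \<in> \<V> (int k - 1)"
  using gen_hom by (simp add: gen_rel_def)

lemma gen_hom_add: "s \<in> \<V> (int k) \<Longrightarrow> t \<in> \<V> (int k) \<Longrightarrow> gen_hom k (s + t) = gen_hom k s + gen_hom k t"
  by (intro gen_hom_eqI gen_rel_add gen_hom)

lemma gen_hom_scale: "s \<in> \<V> (int k) \<Longrightarrow> gen_hom k (c *\<^sub>R s) = c *\<^sub>R gen_hom k s"
  by (intro gen_hom_eqI gen_rel_scale gen_hom)

lemma gen_hom_0: "gen_hom k 0 = 0"
  by (rule gen_hom_eqI[OF gen_rel_0])

lemma gen_hom_mult: "f \<in> \<R> \<Longrightarrow> s \<in> \<V> (int k) \<Longrightarrow> gen_hom k (f \<odot> s) = f \<odot> gen_hom k s + br (of_fun f) s"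
  by (intro gen_hom_eqI gen_rel_mult gen_hom)

lemma gen_hom_W: "set Zs \<subseteq> \<Gamma> \<Longrightarrow> gen_hom (length Zs) (W Zs) = koszul_op Zs"
  by (intro gen_hom_eqI gen_rel_W)

lemma gen_hom_fun: "h \<in> \<R> \<Longrightarrow> gen_hom 0 (of_fun h) = 0"
  using V_neg[OF _ V_gen_hom[of "of_fun h" 0]] V_of_fun by simp

lemma gen_hom_section: "X \<in> \<Gamma> \<Longrightarrow> gen_hom 1 (\<S> X) = of_fun (g X)"
proof -
  assume X: "X \<in> \<Gamma>"
  have "W [X] = \<S> X" by (simp add: W_Cons W_Nil wedge_of_fun fun_mult_def)
  moreover have "br (\<S> X) (of_fun (\<lambda>x. 1)) = 0"
    using br_swap_fun[OF \<R>_closed(1) V_of_section[OF X]] br_one[OF V_of_section[OF X]] by simp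
  ultimately show ?thesis using gen_hom_W[of "[X]"] X
    by (simp add: W_Nil of_fun_mult)
qed

text \<open>The failure of the generator identity is function-bilinear, and zero on products of sections.\<close>

definition failure :: "nat \<Rightarrow> nat \<Rightarrow> ('m \<Rightarrow> 'v ext) \<Rightarrow> ('m \<Rightarrow> 'v ext) \<Rightarrow> 'm \<Rightarrow> 'v ext" where
  "failure p q a b = gen_hom (p + q) (a \<and>\<^sub>w b) - koszul_sign (int p) *\<^sub>R br a b - gen_hom p a \<and>\<^sub>w b
    - koszul_sign (int p) *\<^sub>R (a \<and>\<^sub>w gen_hom q b)"

lemma failure_mult_left:
  assumes f: "f \<in> \<R>" and a: "a \<in> \<V> (int p)" and b: "b \<in> \<V> (int q)"
  shows "failure p q (f \<odot> a) b = f \<odot> failure p q a b"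
proof -
  have ab: "a \<and>\<^sub>w b \<in> \<V> (int (p + q))" using V_wedge[OF a b] by simp
  show ?thesis
    unfolding failure_def wedge_fun_mult gen_hom_mult[OF f ab] gen_hom_mult[OF f a] br_mult_left[OF f a b]
      br_fun_leibniz[OF f a b]
    by (simp add: fun_mult_simps wedge_add wedge_fun_mult scaleR_add_right)
qed

lemma failure_mult_right:
  assumes f: "f \<in> \<R>" and a: "a \<in> \<V> (int p)" and b: "b \<in> \<V> (int q)"
  shows "failure p q a (f \<odot> b) = f \<odot> failure p q a b"
proof -
  have ab: "a \<and>\<^sub>w b \<in> \<V> (int (p + q))" using V_wedge[OF a b] by simp
  show ?thesis
    unfolding failure_def wedge_fun_mult gen_hom_mult[OF f ab] gen_hom_mult[OF f b] br_mult_right[OF f a b]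
      br_fun_leibniz[OF f a b]
    by (simp add: fun_mult_simps wedge_add wedge_fun_mult scaleR_add_right)
qed

lemma failure_add:
  assumes "a \<in> \<V> (int p)" "a' \<in> \<V> (int p)" "b \<in> \<V> (int q)" "b' \<in> \<V> (int q)"
  shows "failure p q (a + a') b = failure p q a b + failure p q a' b"
    and "failure p q a (b + b') = failure p q a b + failure p q a b'"
proof -
  have w: "c \<and>\<^sub>w d \<in> \<V> (int (p + q))" if "c \<in> \<V> (int p)" "d \<in> \<V> (int q)" for c d
    using V_wedge[OF that] by simp
  show "failure p q (a + a') b = failure p q a b + failure p q a' b"
    using assms w unfolding failure_def
    by (simp add: wedge_add gen_hom_add br_add_left[of b "int q" a "int p" a' "int p"] scaleR_add_right)
  show "failure p q a (b + b') = failure p q a b + failure p q a b'"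
    using assms w unfolding failure_def
    by (simp add: wedge_add gen_hom_add br_add_right[of a "int p" b "int q" b' "int q"] scaleR_add_right)
qed

lemma failure_0: "a \<in> \<V> (int p) \<Longrightarrow> failure p q a 0 = 0" "b \<in> \<V> (int q) \<Longrightarrow> failure p q 0 b = 0"
  by (simp_all add: failure_def gen_hom_0 br_0)

lemma failure_W: "set Xs \<subseteq> \<Gamma> \<Longrightarrow> set Ys \<subseteq> \<Gamma> \<Longrightarrow> failure (length Xs) (length Ys) (W Xs) (W Ys) = 0"
  using gen_hom_W[of "Xs @ Ys"]
  by (simp add: failure_def gen_hom_W koszul_op_append W_append)

lemma failure_eq_0:
  assumes a: "a \<in> \<V> (int p)" and b: "b \<in> \<V> (int q)"
  shows "failure p q a b = 0"
proof -
  consider "p = 0" | "q = 0" | i j where "p = Suc i" "q = Suc j" by (cases p; cases q) auto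
  then show ?thesis
  proof cases
    case 1
    then obtain h where h: "h \<in> \<R>" "a = of_fun h" using a V_0_of_fun by auto
    then show ?thesis using 1 b gen_hom_mult[OF h(1) b] gen_hom_fun[OF h(1)]
      by (simp add: failure_def wedge_of_fun)
  next
    case 2
    then obtain h where h: "h \<in> \<R>" "b = of_fun h" using b V_0_of_fun by auto
    then show ?thesis using 2 a gen_hom_mult[OF h(1) a] gen_hom_fun[OF h(1)] br_swap_fun[OF h(1) a]
      by (simp add: failure_def wedge_of_fun)
  next
    case 3
    show ?thesis
    proof (rule zero_by_germs)
      fix x
      obtain \<rho> G and S :: "nat list set" where \<rho>: "\<rho> \<in> \<R>" "\<rho> x \<noteq> 0" "finite S"
        "\<And>I. I \<in> S \<Longrightarrow> set (G I) \<subseteq> \<Gamma> \<and> length (G I) = Suc i" "\<rho> \<odot> a = (\<Sum>I\<in>S. W (G I))"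
        by (rule local_wedges[OF M vb a[unfolded 3 V_nat], where x = x]) blast
      obtain \<sigma> H and T :: "nat list set" where \<sigma>: "\<sigma> \<in> \<R>" "\<sigma> x \<noteq> 0" "finite T"
        "\<And>I. I \<in> T \<Longrightarrow> set (H I) \<subseteq> \<Gamma> \<and> length (H I) = Suc j" "\<sigma> \<odot> b = (\<Sum>I\<in>T. W (H I))"
        by (rule local_wedges[OF M vb b[unfolded 3 V_nat], where x = x]) blast
      have G: "W (G I) \<in> \<V> (int p)" if "I \<in> S" for I using V_W[of "G I"] \<rho>(4)[OF that] 3 by simp
      have H: "W (H I) \<in> \<V> (int q)" if "I \<in> T" for I using V_W[of "H I"] \<sigma>(4)[OF that] 3 by simp
      have s1: "failure p q (W (G I)) (\<Sum>J\<in>T'. W (H J)) = 0" if "I \<in> S" "finite T'" "T' \<subseteq> T" for I T'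
        using that(2,3)
      proof (induction T')
        case empty
        then show ?case using failure_0(1)[OF G[OF that(1)]] by simp
      next
        case (insert J T')
        have "(\<Sum>J\<in>T'. W (H J)) \<in> \<V> (int q)" using insert H by (intro V_sum) auto
        moreover have "failure p q (W (G I)) (W (H J)) = 0"
          using failure_W[of "G I" "H J"] \<rho>(4)[OF that(1)] \<sigma>(4)[of J] insert 3 by simp
        ultimately show ?case
          using insert failure_add(2)[OF G[OF that(1)] G[OF that(1)] H[of J]] by simp
      qed
      have s2: "failure p q (\<Sum>I\<in>S'. W (G I)) (\<Sum>J\<in>T. W (H J)) = 0" if "finite S'" "S' \<subseteq> S" for S'
        using that
      proof (induction S')
        case empty
        have "(\<Sum>J\<in>T. W (H J)) \<in> \<V> (int q)" using H by (intro V_sum) auto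
        then show ?case by (simp add: failure_0)
      next
        case (insert I S')
        have "(\<Sum>J\<in>T. W (H J)) \<in> \<V> (int q)" "(\<Sum>I\<in>S'. W (G I)) \<in> \<V> (int p)"
          using insert G H by (auto intro!: V_sum)
        then show ?case
          using insert s1[of I T] \<sigma>(3) failure_add(1)[OF G[of I]] by simp
      qed
      have "failure p q (\<rho> \<odot> a) (\<sigma> \<odot> b) = 0" using s2[OF \<rho>(3)] \<rho>(5) \<sigma>(5) by simp
      then have "\<rho> \<odot> \<sigma> \<odot> failure p q a b = 0"
        using failure_mult_left[OF \<rho>(1) a V_mult[OF \<sigma>(1) b]] failure_mult_right[OF \<sigma>(1) a b] by simp
      then have "(\<rho> \<odot> \<sigma> \<odot> failure p q a b) x = 0 x" by (rule fun_cong)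
      then have "(\<rho> x * \<sigma> x) *\<^sub>R failure p q a b x = 0" by (simp add: fun_mult_def zero_fun_apply)
      then show "\<exists>\<rho>. \<rho> x \<noteq> 0 \<and> \<rho> x *\<^sub>R failure p q a b x = 0"
        using \<rho>(2) \<sigma>(2) by (intro exI[of _ "\<lambda>x. \<rho> x * \<sigma> x"]) simp
    qed
  qed
qed

end


section \<open>Generators on all multivectors\<close>

text \<open>A form of degree \<open>k\<close> is supported on lists of length \<open>k\<close>, hence the components of an
  inhomogeneous multivector are its restrictions to lists of a fixed length.\<close>

definition ext_component :: "nat \<Rightarrow> ('m \<Rightarrow> 'v ext) \<Rightarrow> 'm \<Rightarrow> 'v ext" where
  "ext_component k a = (\<lambda>x l. if length l = k then a x l else 0)"

lemma ext_component_simps: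
  "ext_component k (a + b) = ext_component k a + ext_component k b"
  "ext_component k (c *\<^sub>R a) = c *\<^sub>R ext_component k a" "ext_component k 0 = 0"
  by (auto simp: ext_component_def fun_eq_iff plus_fun_apply scaleR_fun_def zero_fun_apply)

context algebroid_bracket
begin

lemma ext_component_V:
  assumes "a \<in> \<V> (int j)"
  shows "ext_component k a = (if k = j then a else 0)"
proof (intro ext)
  fix x l
  have "homog j (a x)"
    using ext_sections_in[OF M vb, of a j x] assms by (simp add: V_nat ext_power_space_iff)
  then show "ext_component k a x l = (if k = j then a else 0) x l"
    by (auto simp: homog_def ext_component_def zero_fun_apply)
qed

lemma ext_component_sum: "ext_component k (\<Sum>i\<in>I. f i) = (\<Sum>i\<in>I. ext_component k (f i))"
  by (induction I rule: infinite_finite_induct) (simp_all add: ext_component_simps)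

lemma V_ext_component:
  assumes "a \<in> multivecs M A"
  shows "ext_component k a \<in> \<V> (int k)"
proof -
  obtain N s where s: "a = (\<Sum>i<N. s i)" "\<And>i. i < N \<Longrightarrow> s i \<in> \<V> (int i)"
    using assms unfolding multivecs_def by blast
  have "ext_component k (s i) \<in> \<V> (int k)" if "i < N" for i
    unfolding ext_component_V[OF s(2)[OF that]] using s(2)[OF that] V_0 by simp
  then show ?thesis unfolding s(1) ext_component_sum by (intro V_sum) simp
qed

lemma multivecs_expansion:
  assumes "a \<in> multivecs M A"
  shows "a = (\<Sum>k\<le>n. ext_component k a)"
proof (intro ext)
  fix x l
  have "(\<Sum>k\<le>n. ext_component k a) x l = (\<Sum>k\<le>n. if k = length l then a x l else 0)"
    unfolding fun_sum_apply by (intro sum.cong) (auto simp: ext_component_def)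
  also have "\<dots> = (if length l \<le> n then a x l else 0)" by simp
  also have "\<dots> = a x l"
  proof (cases "length l \<le> n")
    case False
    then have "ext_component (length l) a = 0"
      using V_above_rank[OF V_ext_component[OF assms]] by simp
    then have "ext_component (length l) a x l = 0" by (simp add: zero_fun_apply)
    then show ?thesis by (simp add: ext_component_def)
  qed simp
  finally show "a x l = (\<Sum>k\<le>n. ext_component k a) x l" by simp
qed

lemma multivecsI:
  assumes "\<And>k. s k \<in> \<V> (int k)"
  shows "(\<Sum>k\<le>N. s k) \<in> multivecs M A"
  unfolding multivecs_def mem_Collect_eq
  by (intro exI[of _ "Suc N"] exI[of _ s]) (use assms in \<open>simp add: lessThan_Suc_atMost\<close>)

lemma multivecs_add: "a \<in> multivecs M A \<Longrightarrow> b \<in> multivecs M A \<Longrightarrow> a + b \<in> multivecs M A"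
proof -
  assume a: "a \<in> multivecs M A" and b: "b \<in> multivecs M A"
  have "a + b = (\<Sum>k\<le>n. ext_component k a + ext_component k b)"
    using multivecs_expansion[OF a] multivecs_expansion[OF b] by (simp add: sum.distrib)
  also have "\<dots> \<in> multivecs M A" by (rule multivecsI) (intro V_add V_ext_component a b)
  finally show ?thesis .
qed

lemma multivecs_0: "0 \<in> multivecs M A"
  using multivecs_V[OF V_0] .

lemma multivecs_sum: "(\<And>i. i \<in> I \<Longrightarrow> f i \<in> multivecs M A) \<Longrightarrow> (\<Sum>i\<in>I. f i) \<in> multivecs M A"
  by (induction I rule: infinite_finite_induct) (auto intro: multivecs_add multivecs_0)

lemma multivecs_scale: "a \<in> multivecs M A \<Longrightarrow> c *\<^sub>R a \<in> multivecs M A"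
proof -
  assume a: "a \<in> multivecs M A"
  have "c *\<^sub>R a = (\<Sum>k\<le>n. c *\<^sub>R ext_component k a)"
    unfolding scaleR_sum_right[symmetric] using multivecs_expansion[OF a] by simp
  also have "\<dots> \<in> multivecs M A" by (rule multivecsI) (intro V_scale V_ext_component a)
  finally show ?thesis .
qed

lemma br_bilinear: "bilinear_on_subspaces (multivecs M A) (multivecs M A) br"
  using br unfolding schouten_bracket_def by (elim conjE)

lemma br_add_right_multivecs:
  "a \<in> multivecs M A \<Longrightarrow> b \<in> multivecs M A \<Longrightarrow> c \<in> multivecs M A \<Longrightarrow> br a (b + c) = br a b + br a c"
  using br_bilinear unfolding bilinear_on_subspaces_def linear_on_subspace_def by blast

abbreviation "generators \<equiv> gerstenhaber_generators M A br"

lemma generator_add: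
  assumes "D \<in> generators" "a \<in> multivecs M A" "b \<in> multivecs M A"
  shows "D (a + b) = D a + D b"
  using assms unfolding gerstenhaber_generators_def linear_on_subspace_def by blast

lemma generator_scale:
  assumes "D \<in> generators" "a \<in> multivecs M A"
  shows "D (c *\<^sub>R a) = c *\<^sub>R D a"
  using assms unfolding gerstenhaber_generators_def linear_on_subspace_def by blast

lemma generator_0: "D \<in> generators \<Longrightarrow> D 0 = 0"
  using generator_scale[OF _ multivecs_0, of D 0] by simp

lemma generator_minus: "D \<in> generators \<Longrightarrow> a \<in> multivecs M A \<Longrightarrow> D (- a) = - D a"
  using generator_scale[of D a "-1"] by simp

lemma generator_sum:
  "D \<in> generators \<Longrightarrow> (\<And>i. i \<in> I \<Longrightarrow> f i \<in> multivecs M A) \<Longrightarrow> D (\<Sum>i\<in>I. f i) = (\<Sum>i\<in>I. D (f i))"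
proof (induction I rule: infinite_finite_induct)
  case (insert i I)
  then show ?case using generator_add[of D "f i" "sum f I"] by (simp add: multivecs_sum)
qed (simp_all add: generator_0)

lemma V_generator: "D \<in> generators \<Longrightarrow> a \<in> \<V> p \<Longrightarrow> D a \<in> \<V> (p - 1)"
  unfolding gerstenhaber_generators_def by blast

lemma generator_wedge:
  assumes "D \<in> generators" "a \<in> \<V> p" "b \<in> \<V> q"
  shows "D (a \<and>\<^sub>w b) = koszul_sign p *\<^sub>R br a b + D a \<and>\<^sub>w b + koszul_sign p *\<^sub>R (a \<and>\<^sub>w D b)"
proof -
  have "br a b = koszul_sign p *\<^sub>R (D (a \<and>\<^sub>w b) - D a \<and>\<^sub>w b - koszul_sign p *\<^sub>R (a \<and>\<^sub>w D b))"
    using assms multivecs_V[OF assms(3)] unfolding gerstenhaber_generators_def by blast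
  then have "koszul_sign p *\<^sub>R br a b = D (a \<and>\<^sub>w b) - D a \<and>\<^sub>w b - koszul_sign p *\<^sub>R (a \<and>\<^sub>w D b)"
    by simp
  then show ?thesis by (simp add: algebra_simps)
qed

lemma generator_fun: "D \<in> generators \<Longrightarrow> f \<in> \<R> \<Longrightarrow> D (of_fun f) = 0"
  using V_neg[OF _ V_generator[OF _ V_of_fun]] by simp

lemma generator_mult:
  "D \<in> generators \<Longrightarrow> f \<in> \<R> \<Longrightarrow> a \<in> \<V> p \<Longrightarrow> D (f \<odot> a) = f \<odot> D a + br (of_fun f) a"
  using generator_wedge[OF _ V_of_fun, of D f a p] generator_fun[of D f] by (simp add: wedge_of_fun)

lemma generator_section_wedge:
  "D \<in> generators \<Longrightarrow> X \<in> \<Gamma> \<Longrightarrow> b \<in> \<V> q \<Longrightarrow>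
    D (of_section A X \<and>\<^sub>w b) = D (of_section A X) \<and>\<^sub>w b - br (of_section A X) b - of_section A X \<and>\<^sub>w D b"
  using generator_wedge[OF _ V_of_section, of D X b q] by simp

lemma generator_extensional: "D \<in> generators \<Longrightarrow> a \<notin> multivecs M A \<Longrightarrow> D a = undefined"
  unfolding gerstenhaber_generators_def by (auto simp: PiE_def extensional_def)

text \<open>The difference of two generators satisfies the derivation rule, because the bracket cancels.\<close>

lemma generator_unique:
  assumes D: "D \<in> generators" and D': "D' \<in> generators"
    and eq: "\<And>X. X \<in> \<Gamma> \<Longrightarrow> D (of_section A X) = D' (of_section A X)"
  shows "D = D'"
proof
  have hom: "D a = D' a" if a: "a \<in> \<V> p" for a p
  proof -
    have "D a - D' a = 0"
    proof (rule derivation_eq_0[where d = "\<lambda>a. D a - D' a"])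
      show "D a - D' a \<in> \<V> (p - 1)" if "a \<in> \<V> p" for p a
        using that D D' by (intro V_diff V_generator)
      show "D (a + b) - D' (a + b) = D a - D' a + (D b - D' b)" if "a \<in> \<V> p" "b \<in> \<V> p" for p a b
        using that D D' by (simp add: generator_add multivecs_V)
      show "D (a \<and>\<^sub>w b) - D' (a \<and>\<^sub>w b) = (D a - D' a) \<and>\<^sub>w b + koszul_sign p *\<^sub>R (a \<and>\<^sub>w (D b - D' b))"
        if "a \<in> \<V> p" "b \<in> \<V> q" for p q a b
        unfolding generator_wedge[OF D that] generator_wedge[OF D' that]
        by (simp add: wedge_diff scaleR_diff_right)
    qed (use eq a in simp_all)
    then show ?thesis by simp
  qed
  fix a
  show "D a = D' a"
  proof (cases "a \<in> multivecs M A")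
    case True
    note e = multivecs_expansion[OF True] and c = V_ext_component[OF True]
    have "D a = (\<Sum>k\<le>n. D (ext_component k a))"
      by (rule trans[OF arg_cong[OF e, of D] generator_sum[OF D multivecs_V[OF c]]])
    also have "\<dots> = (\<Sum>k\<le>n. D' (ext_component k a))" by (intro sum.cong hom[OF c]) simp
    also have "\<dots> = D' a"
      by (rule trans[OF arg_cong[OF e, of D'] generator_sum[OF D' multivecs_V[OF c]], symmetric])
    finally show ?thesis .
  next
    case False
    then show ?thesis using generator_extensional D D' by simp
  qed
qed

text \<open>Both the Lie derivative and the connection along \<open>X\<close> differentiate functions along the anchor of
  \<open>X\<close>. Their difference is therefore an endomorphism of the line bundle, that is, a function.\<close>

lemma connection_divergence:
  assumes nabla: "nabla \<in> connections M A (ext_power n A)"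
  obtains g where "top_connection M A n br nabla g"
proof -
  have nab: "nabla X \<Lambda> \<in> \<V> (int n)" "f \<in> \<R> \<Longrightarrow> nabla X (f \<odot> \<Lambda>) = anchor_act A X f \<odot> \<Lambda> + f \<odot> nabla X \<Lambda>"
    if "X \<in> \<Gamma>" "\<Lambda> \<in> \<V> (int n)" for X \<Lambda> f
    using nabla that unfolding connections_def V_nat by (auto simp: PiE_iff)
  have "\<exists>h. h \<in> \<R> \<and> (\<forall>\<Lambda>\<in>\<V> (int n). br (of_section A X) \<Lambda> - nabla X \<Lambda> = h \<odot> \<Lambda>)" if X: "X \<in> \<Gamma>" for X
  proof -
    let ?T = "\<lambda>\<Lambda>. br (of_section A X) \<Lambda> - nabla X \<Lambda>"
    have "?T \<Lambda> \<in> sections M (ext_power n A)" if "\<Lambda> \<in> sections M (ext_power n A)" for \<Lambda>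
      using V_diff[OF V_br_section[OF X] nab(1)[OF X], of \<Lambda> \<Lambda>] that by (simp add: V_nat)
    moreover have "?T (f \<odot> \<Lambda>) = f \<odot> ?T \<Lambda>" if "f \<in> \<R>" "\<Lambda> \<in> sections M (ext_power n A)" for f \<Lambda>
    proof -
      have L: "\<Lambda> \<in> \<V> (int n)" using that by (simp add: V_nat)
      show ?thesis
        unfolding br_mult_right[OF that(1) V_of_section[OF X] L] nab(2)[OF X L that(1)]
          br_fun_section[OF X that(1)]
        by (simp add: wedge_minus wedge_of_fun fun_mult_simps)
    qed
    ultimately show ?thesis using top_endomorphism[OF M vb, of ?T] unfolding V_nat by metis
  qed
  then obtain g where g: "\<And>X. X \<in> \<Gamma> \<Longrightarrow> g X \<in> \<R>"
    "\<And>X \<Lambda>. X \<in> \<Gamma> \<Longrightarrow> \<Lambda> \<in> \<V> (int n) \<Longrightarrow> br (of_section A X) \<Lambda> - nabla X \<Lambda> = g X \<odot> \<Lambda>"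
    by metis
  have "top_connection M A n br nabla g"
    by unfold_locales (use nabla g in auto)
  then show thesis by (rule that)
qed

end

context top_connection
begin

definition generator :: "('m \<Rightarrow> 'v ext) \<Rightarrow> 'm \<Rightarrow> 'v ext" where
  "generator = (\<lambda>a\<in>multivecs M A. \<Sum>k\<le>n. gen_hom k (ext_component k a))"

lemma generator_V:
  assumes "a \<in> \<V> (int p)"
  shows "generator a = gen_hom p a"
proof -
  have "gen_hom k (ext_component k a) = (if k = p then gen_hom p a else 0)" for k
    by (simp add: ext_component_V[OF assms] gen_hom_0)
  then have "generator a = (\<Sum>k\<le>n. if k = p then gen_hom p a else 0)"
    unfolding generator_def using multivecs_V[OF assms] by simp
  also have "\<dots> = (if p \<le> n then gen_hom p a else 0)" by simp
  also have "\<dots> = gen_hom p a" using V_above_rank[OF assms] gen_hom_0 by auto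
  finally show ?thesis .
qed

lemma generator_in_V: "a \<in> \<V> p \<Longrightarrow> generator a \<in> \<V> (p - 1)"
proof (cases "p < 0")
  case True
  assume "a \<in> \<V> p"
  then have "a = 0" using True V_neg by blast
  then show ?thesis using generator_V[OF V_0, of 0] gen_hom_0 V_0 by simp
next
  case False
  assume "a \<in> \<V> p"
  moreover obtain k where "p = int k" using False by (meson nonneg_int_cases not_less)
  ultimately show ?thesis using generator_V V_gen_hom by simp
qed

lemma generator_linear: "linear_on_subspace (multivecs M A) generator"
  unfolding linear_on_subspace_def
proof (intro conjI ballI allI)
  fix a b c assume a: "a \<in> multivecs M A"
  show "generator (c *\<^sub>R a) = c *\<^sub>R generator a"
    using a multivecs_scale[OF a] V_ext_component[OF a]
    by (simp add: generator_def ext_component_simps gen_hom_scale scaleR_sum_right)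
  assume b: "b \<in> multivecs M A"
  show "generator (a + b) = generator a + generator b"
    using a b multivecs_add[OF a b] V_ext_component[OF a] V_ext_component[OF b]
    by (simp add: generator_def ext_component_simps gen_hom_add sum.distrib)
qed

lemma generator_identity_hom:
  assumes a: "a \<in> \<V> (int p)" and b: "b \<in> \<V> (int q)"
  shows "br a b = koszul_sign (int p) *\<^sub>R (generator (a \<and>\<^sub>w b) - generator a \<and>\<^sub>w b - koszul_sign (int p) *\<^sub>R (a \<and>\<^sub>w generator b))"
proof -
  have ab: "a \<and>\<^sub>w b \<in> \<V> (int (p + q))" using V_wedge[OF a b] by simp
  have "generator (a \<and>\<^sub>w b) - generator a \<and>\<^sub>w b - koszul_sign (int p) *\<^sub>R (a \<and>\<^sub>w generator b) =
      koszul_sign (int p) *\<^sub>R br a b"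
    using failure_eq_0[OF a b] unfolding generator_V[OF ab] generator_V[OF a] generator_V[OF b]
    by (simp add: failure_def algebra_simps)
  then show ?thesis by simp
qed

lemma generator_in_generators: "generator \<in> generators"
proof -
  have PiE: "generator \<in> (\<Pi>\<^sub>E a\<in>multivecs M A. multivecs M A)"
    unfolding PiE_iff
  proof (intro conjI ballI)
    show "generator \<in> extensional (multivecs M A)" by (simp add: generator_def)
    fix a assume a: "a \<in> multivecs M A"
    show "generator a \<in> multivecs M A"
      using multivecs_sum[OF multivecs_V[OF V_gen_hom[OF V_ext_component[OF a]]]] a
      by (simp add: generator_def)
  qed
  have "br a b = koszul_sign p *\<^sub>R (generator (a \<and>\<^sub>w b) - generator a \<and>\<^sub>w b - koszul_sign p *\<^sub>R (a \<and>\<^sub>w generator b))"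
    if a: "a \<in> \<V> p" and b: "b \<in> multivecs M A" for p a b
  proof (cases "p < 0")
    case True
    then have a0: "a = 0" using V_neg a by blast
    have "br 0 b = 0"
    proof -
      have "br (0 *\<^sub>R 0) b = 0 *\<^sub>R br 0 b"
        using br_bilinear b multivecs_0
        unfolding bilinear_on_subspaces_def linear_on_subspace_def by blast
      then show ?thesis by simp
    qed
    moreover have "generator 0 = 0" using generator_V[OF V_0, of 0] gen_hom_0 by simp
    ultimately show ?thesis by (simp add: a0)
  next
    case False
    then obtain k where k: "p = int k" by (meson nonneg_int_cases not_less)
    let ?b = "\<lambda>j. ext_component j b"
    have c: "?b j \<in> \<V> (int j)" for j by (rule V_ext_component[OF b])
    have be: "b = (\<Sum>j\<le>n. ?b j)" by (rule multivecs_expansion[OF b])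
    have gs: "generator (\<Sum>j\<in>J. f j) = (\<Sum>j\<in>J. generator (f j))"
      if "finite J" "\<And>j. j \<in> J \<Longrightarrow> f j \<in> multivecs M A" for J :: "nat set" and f
      using that
    proof (induction J)
      case empty
      show ?case using generator_V[OF V_0, of 0] gen_hom_0 by simp
    next
      case (insert j J)
      then have "generator (f j + sum f J) = generator (f j) + generator (sum f J)"
        using generator_linear multivecs_sum[of J f] unfolding linear_on_subspace_def by blast
      with insert show ?case by simp
    qed
    have bs: "br a (\<Sum>j\<in>J. ?b j) = (\<Sum>j\<in>J. br a (?b j))" if "finite J" for J
      using that
    proof (induction J)
      case empty
      show ?case using br_0[OF a] by simp
    next
      case (insert j J)
      have "br a (?b j + (\<Sum>j\<in>J. ?b j)) = br a (?b j) + br a (\<Sum>j\<in>J. ?b j)"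
        by (rule br_add_right_multivecs[OF multivecs_V[OF a] multivecs_V[OF c]
              multivecs_sum[OF multivecs_V[OF c]]])
      with insert show ?case by simp
    qed
    have w: "a \<and>\<^sub>w ?b j \<in> multivecs M A" for j by (rule multivecs_V[OF V_wedge[OF a c]])
    have "br a (\<Sum>j\<le>n. ?b j) = (\<Sum>j\<le>n. koszul_sign p *\<^sub>R (generator (a \<and>\<^sub>w ?b j) - generator a \<and>\<^sub>w ?b j -
        koszul_sign p *\<^sub>R (a \<and>\<^sub>w generator (?b j))))"
      unfolding bs[OF finite_atMost] k
      by (rule sum.cong[OF refl generator_identity_hom[OF a[unfolded k] c]])
    also have "\<dots> = koszul_sign p *\<^sub>R (generator (a \<and>\<^sub>w (\<Sum>j\<le>n. ?b j)) - generator a \<and>\<^sub>w (\<Sum>j\<le>n. ?b j) -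
        koszul_sign p *\<^sub>R (a \<and>\<^sub>w generator (\<Sum>j\<le>n. ?b j)))"
      unfolding wedge_sum gs[OF finite_atMost w] gs[OF finite_atMost multivecs_V[OF c]]
      by (simp add: sum_subtractf scaleR_diff_right scaleR_sum_right)
    finally show ?thesis using be by simp
  qed
  then show ?thesis
    unfolding gerstenhaber_generators_def using PiE generator_linear generator_in_V by blast
qed

lemma generator_of_connection_generator: "generator_of_connection M n A br nabla generator"
proof -
  have "generator (\<S> X) = of_fun (g X)" if "X \<in> \<Gamma>" for X
    using generator_V[of "\<S> X" 1] V_of_section[OF that] gen_hom_section[OF that] by simp
  then show ?thesis
    unfolding generator_of_connection_def lie_deriv_def
    using generator_in_generators generator_fun g_smooth g_top
    by (auto simp: V_nat[symmetric])
qed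

lemma generator_of_connectionD:
  assumes "generator_of_connection M n A br nabla D" "X \<in> \<Gamma>"
  shows "D (\<S> X) = of_fun (g X)"
proof -
  obtain h where h: "D (\<S> X) = of_fun h"
    "\<And>\<Lambda>. \<Lambda> \<in> \<V> (int n) \<Longrightarrow> h \<odot> \<Lambda> = br (\<S> X) \<Lambda> - nabla X \<Lambda>"
    using assms unfolding generator_of_connection_def lie_deriv_def V_nat by blast
  have "h x = g X x" for x
  proof -
    obtain \<Lambda> where L: "\<Lambda> \<in> sections M (ext_power n A)" "\<Lambda> x \<noteq> 0"
      by (rule top_section_nonzero[OF M vb, of x]) blast
    then have "h \<odot> \<Lambda> = g X \<odot> \<Lambda>" using h(2)[of \<Lambda>] g_top[OF assms(2), of \<Lambda>] by (simp add: V_nat)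
    then have "(h \<odot> \<Lambda>) x = (g X \<odot> \<Lambda>) x" by simp
    then show ?thesis using L(2) by (simp add: fun_mult_def)
  qed
  then have "h = g X" by (rule ext)
  with h(1) show ?thesis by simp
qed

lemma generator_of_connection_unique:
  assumes "generator_of_connection M n A br nabla D"
  shows "D = generator"
  by (rule generator_unique)
    (use assms generator_in_generators generator_of_connectionD[OF assms]
      generator_of_connectionD[OF generator_of_connection_generator]
     in \<open>auto simp: generator_of_connection_def\<close>)


section \<open>Curvature\<close>

definition curv :: "('m \<Rightarrow> 'v) \<Rightarrow> ('m \<Rightarrow> 'v) \<Rightarrow> 'm \<Rightarrow> real" where
  "curv X Y = (\<lambda>x. g (bracket A X Y) x - anchor_act A X (g Y) x + anchor_act A Y (g X) x)"

text \<open>With \<open>\<nabla>\<^sub>X = L\<^sub>X - g X\<close> the second order terms cancel by the Jacobi identity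
  \<open>L\<^bsub>[X, Y]\<^esub> = [L\<^sub>X, L\<^sub>Y]\<close>.\<close>

lemma curvature_eq:
  assumes X: "X \<in> \<Gamma>" and Y: "Y \<in> \<Gamma>" and L: "\<Lambda> \<in> \<V> (int n)"
  shows "curvature A nabla X Y \<Lambda> = curv X Y \<odot> \<Lambda>"
proof -
  have nab: "nabla Z \<Lambda> = br (\<S> Z) \<Lambda> - g Z \<odot> \<Lambda>" if "Z \<in> \<Gamma>" "\<Lambda> \<in> \<V> (int n)" for Z \<Lambda>
    using g_top[OF that] by simp
  \<comment> \<open>Everything but the first two terms is symmetric in \<open>Z\<close> and \<open>Z'\<close>.\<close>
  have two: "nabla Z (nabla Z' \<Lambda>) = br (\<S> Z) (br (\<S> Z') \<Lambda>) - anchor_act A Z (g Z') \<odot> \<Lambda>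
      - g Z' \<odot> br (\<S> Z) \<Lambda> - g Z \<odot> br (\<S> Z') \<Lambda> + g Z \<odot> g Z' \<odot> \<Lambda>"
    if Z: "Z \<in> \<Gamma>" and Z': "Z' \<in> \<Gamma>" for Z Z'
  proof -
    have V: "br (\<S> Z') \<Lambda> \<in> \<V> (int n)" "g Z' \<odot> \<Lambda> \<in> \<V> (int n)"
      using V_br_section[OF Z' L] V_mult[OF g_smooth[OF Z'] L] by auto
    then have "nabla Z' \<Lambda> \<in> \<V> (int n)" unfolding nab[OF Z' L] by (rule V_diff)
    from nab[OF Z this] show ?thesis
      unfolding nab[OF Z' L] br_diff_right[OF V_of_section[OF Z] V]
        br_mult_right[OF g_smooth[OF Z'] V_of_section[OF Z] L] br_fun_section[OF Z g_smooth[OF Z']]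
      by (simp add: wedge_minus wedge_of_fun fun_mult_simps)
  qed
  have jac: "br (\<S> X) (br (\<S> Y) \<Lambda>) = br (\<S> (bracket A X Y)) \<Lambda> + br (\<S> Y) (br (\<S> X) \<Lambda>)"
    using br_jacobi[OF V_of_section[OF X] V_of_section[OF Y] L] by (simp add: br_section_section X Y)
  have "curvature A nabla X Y \<Lambda> = g (bracket A X Y) \<odot> \<Lambda> - anchor_act A X (g Y) \<odot> \<Lambda> + anchor_act A Y (g X) \<odot> \<Lambda>"
    unfolding curvature_def two[OF X Y] two[OF Y X] nab[OF \<Gamma>_bracket[OF X Y] L] jac
      fun_mult_commute[of "g Y" "g X" \<Lambda>]
    by (simp add: algebra_simps)
  also have "\<dots> = curv X Y \<odot> \<Lambda>"
    by (rule ext) (simp add: curv_def fun_mult_def plus_fun_apply minus_apply algebra_simps)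
  finally show ?thesis .
qed

lemma flat_iff: "flat M A (ext_power n A) nabla \<longleftrightarrow> (\<forall>X\<in>\<Gamma>. \<forall>Y\<in>\<Gamma>. curv X Y = (\<lambda>x. 0))"
proof
  assume fl: "flat M A (ext_power n A) nabla"
  show "\<forall>X\<in>\<Gamma>. \<forall>Y\<in>\<Gamma>. curv X Y = (\<lambda>x. 0)"
  proof (intro ballI ext)
    fix X Y x assume X: "X \<in> \<Gamma>" and Y: "Y \<in> \<Gamma>"
    obtain \<Lambda> where L: "\<Lambda> \<in> sections M (ext_power n A)" "\<Lambda> x \<noteq> 0"
      by (rule top_section_nonzero[OF M vb, of x]) blast
    have "curv X Y \<odot> \<Lambda> = 0"
      using fl X Y L(1) curvature_eq[OF X Y, of \<Lambda>] by (simp add: flat_def V_nat)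
    then have "(curv X Y \<odot> \<Lambda>) x = 0 x" by (rule fun_cong)
    then show "curv X Y x = 0" using L(2) by (simp add: fun_mult_def zero_fun_apply)
  qed
next
  assume z: "\<forall>X\<in>\<Gamma>. \<forall>Y\<in>\<Gamma>. curv X Y = (\<lambda>x. 0)"
  show "flat M A (ext_power n A) nabla"
    unfolding flat_def
  proof (intro ballI)
    fix X Y s assume *: "X \<in> \<Gamma>" "Y \<in> \<Gamma>" "s \<in> sections M (ext_power n A)"
    then have "curvature A nabla X Y s = (\<lambda>x. 0) \<odot> s"
      using curvature_eq[of X Y s] z by (simp add: V_nat)
    then show "curvature A nabla X Y s = 0" by (simp add: fun_mult_def zero_fun_def)
  qed
qed

lemma generator_section: "X \<in> \<Gamma> \<Longrightarrow> generator (\<S> X) = of_fun (g X)"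
  using generator_of_connectionD[OF generator_of_connection_generator] .

lemma generator_diff:
  "a \<in> \<V> p \<Longrightarrow> b \<in> \<V> q \<Longrightarrow> generator (a - b) = generator a - generator b"
  using generator_add[OF generator_in_generators multivecs_V[of a p] multivecs_V[OF V_minus[of b q]]]
    generator_minus[OF generator_in_generators multivecs_V[of b q]] by simp

lemma square_section_section:
  assumes X: "X \<in> \<Gamma>" and Y: "Y \<in> \<Gamma>"
  shows "generator (generator (\<S> X \<and>\<^sub>w \<S> Y)) = - of_fun (curv X Y)"
proof -
  note gg = generator_in_generators
  have B: "\<S> (bracket A X Y) \<in> \<V> 1" by (rule V_of_section[OF \<Gamma>_bracket[OF X Y]])
  have gX: "g X \<odot> \<S> Y \<in> \<V> 1" and gY: "g Y \<odot> \<S> X \<in> \<V> 1"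
    using X Y by (auto intro: V_mult g_smooth V_of_section)
  have "generator (\<S> X \<and>\<^sub>w \<S> Y) = g X \<odot> \<S> Y - \<S> (bracket A X Y) - g Y \<odot> \<S> X"
    using generator_section_wedge[OF gg X V_of_section[OF Y]]
    by (simp add: generator_section X Y br_section_section wedge_of_fun)
  then have "generator (generator (\<S> X \<and>\<^sub>w \<S> Y)) =
      generator (g X \<odot> \<S> Y) - generator (\<S> (bracket A X Y)) - generator (g Y \<odot> \<S> X)"
    by (simp add: generator_diff[OF V_diff[OF gX B] gY] generator_diff[OF gX B])
  also have "\<dots> = (of_fun (\<lambda>x. g X x * g Y x) - of_fun (anchor_act A Y (g X))) - of_fun (g (bracket A X Y))
      - (of_fun (\<lambda>x. g Y x * g X x) - of_fun (anchor_act A X (g Y)))"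
    using generator_mult[OF gg g_smooth[OF X] V_of_section[OF Y]] generator_mult[OF gg g_smooth[OF Y] V_of_section[OF X]]
    by (simp add: generator_section X Y \<Gamma>_bracket of_fun_mult br_fun_section g_smooth)
  also have "\<dots> = - of_fun (curv X Y)"
    by (simp add: of_fun_simps[symmetric] curv_def of_fun_eq_iff mult.commute algebra_simps)
  finally show ?thesis .
qed

text \<open>The difference of both sides is a derivation of degree \<open>-1\<close> in \<open>w\<close>, because \<open>L\<^sub>X\<close> is a derivation of the product and of
  the bracket; on a section \<open>Y\<close> it is the curvature \<open>curv X Y\<close>.\<close>

lemma generator_br_section:
  assumes flat: "\<And>X Y. X \<in> \<Gamma> \<Longrightarrow> Y \<in> \<Gamma> \<Longrightarrow> curv X Y = (\<lambda>x. 0)"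
    and X: "X \<in> \<Gamma>" and w: "w \<in> \<V> p"
  shows "generator (br (\<S> X) w) = br (\<S> X) (generator w) + br (of_fun (g X)) w"
proof -
  note gg = generator_in_generators and SX = V_of_section[OF X] and gX = g_smooth[OF X]
  let ?d = "\<lambda>w. generator (br (\<S> X) w) - br (\<S> X) (generator w) - br (of_fun (g X)) w"
  have "?d w = 0"
  proof (rule derivation_eq_0[where d = ?d, OF _ _ _ _ w])
    show "?d a \<in> \<V> (p - 1)" if "a \<in> \<V> p" for p a
      using that by (intro V_diff V_generator[OF gg] V_br_section[OF X] V_br_fun[OF gX])
    show "?d (a + b) = ?d a + ?d b" if a: "a \<in> \<V> p" and b: "b \<in> \<V> p" for p a b
      unfolding br_add_right[OF SX a b] br_add_right[OF V_of_fun[OF gX] a b]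
        generator_add[OF gg multivecs_V[OF a] multivecs_V[OF b]]
        generator_add[OF gg multivecs_V[OF V_br_section[OF X a]] multivecs_V[OF V_br_section[OF X b]]]
        br_add_right[OF SX V_generator[OF gg a] V_generator[OF gg b]]
      by simp
    show "?d (a \<and>\<^sub>w b) = ?d a \<and>\<^sub>w b + koszul_sign p *\<^sub>R (a \<and>\<^sub>w ?d b)"
      if a: "a \<in> \<V> p" and b: "b \<in> \<V> q" for p q a b
    proof -
      note La = V_br_section[OF X a] and Lb = V_br_section[OF X b]
        and Da = V_generator[OF gg a] and Db = V_generator[OF gg b]
      have 1: "generator (br (\<S> X) (a \<and>\<^sub>w b)) =
          (koszul_sign p *\<^sub>R br (br (\<S> X) a) b + generator (br (\<S> X) a) \<and>\<^sub>w b + koszul_sign p *\<^sub>R (br (\<S> X) a \<and>\<^sub>w generator b))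
          + (koszul_sign p *\<^sub>R br a (br (\<S> X) b) + generator a \<and>\<^sub>w br (\<S> X) b + koszul_sign p *\<^sub>R (a \<and>\<^sub>w generator (br (\<S> X) b)))"
        unfolding br_section_leibniz[OF X a b]
          generator_add[OF gg multivecs_V[OF V_wedge[OF La b]] multivecs_V[OF V_wedge[OF a Lb]]]
          generator_wedge[OF gg La b] generator_wedge[OF gg a Lb] ..
      have D: "generator (a \<and>\<^sub>w b) = koszul_sign p *\<^sub>R br a b + (generator a \<and>\<^sub>w b + koszul_sign p *\<^sub>R (a \<and>\<^sub>w generator b))"
        by (simp add: generator_wedge[OF gg a b])
      have v1: "koszul_sign p *\<^sub>R br a b \<in> \<V> (p + q - 1)" by (rule V_scale[OF V_br[OF a b]])
      have v2: "generator a \<and>\<^sub>w b \<in> \<V> (p + q - 1)" using V_wedge[OF Da b] by (simp add: algebra_simps)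
      have v3': "a \<and>\<^sub>w generator b \<in> \<V> (p + q - 1)" using V_wedge[OF a Db] by (simp add: algebra_simps)
      have v3: "koszul_sign p *\<^sub>R (a \<and>\<^sub>w generator b) \<in> \<V> (p + q - 1)" by (rule V_scale[OF v3'])
      have jac: "br (\<S> X) (br a b) = br (br (\<S> X) a) b + br a (br (\<S> X) b)"
        using br_jacobi[OF SX a b] by simp
      have 2: "br (\<S> X) (generator (a \<and>\<^sub>w b)) = koszul_sign p *\<^sub>R (br (br (\<S> X) a) b + br a (br (\<S> X) b))
          + (br (\<S> X) (generator a) \<and>\<^sub>w b + generator a \<and>\<^sub>w br (\<S> X) b)
          + koszul_sign p *\<^sub>R (br (\<S> X) a \<and>\<^sub>w generator b + a \<and>\<^sub>w br (\<S> X) (generator b))"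
        unfolding D br_add_right[OF SX v1 V_add[OF v2 v3]] br_add_right[OF SX v2 v3]
          br_scale_right[OF SX V_br[OF a b]] br_scale_right[OF SX v3'] jac
          br_section_leibniz[OF X Da b] br_section_leibniz[OF X a Db]
        by simp
      show ?thesis
        unfolding 1 2 br_fun_leibniz[OF gX a b]
        by (simp add: wedge_diff scaleR_add_right scaleR_diff_right)
    qed
    show "?d (\<S> Y) = 0" if Y: "Y \<in> \<Gamma>" for Y
    proof -
      have "?d (\<S> Y) = of_fun (g (bracket A X Y)) - of_fun (anchor_act A X (g Y)) + of_fun (anchor_act A Y (g X))"
        by (simp add: br_section_section X Y generator_section \<Gamma>_bracket br_section_fun g_smooth br_fun_section)
      also have "\<dots> = of_fun (curv X Y)" by (simp add: of_fun_simps[symmetric] curv_def)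
      finally show ?thesis by (simp add: flat[OF X Y] of_fun_simps)
    qed
  qed
  then show ?thesis by (simp add: algebra_simps)
qed

lemma square_W:
  assumes flat: "\<And>X Y. X \<in> \<Gamma> \<Longrightarrow> Y \<in> \<Gamma> \<Longrightarrow> curv X Y = (\<lambda>x. 0)"
    and "set Xs \<subseteq> \<Gamma>"
  shows "generator (generator (W Xs)) = 0"
  using assms(2)
proof (induction Xs)
  case Nil
  have "generator (W []) = 0" using generator_fun[OF generator_in_generators \<R>_closed(1)] by (simp add: W_Nil)
  then show ?case by (simp add: generator_0[OF generator_in_generators])
next
  case (Cons X Xs)
  note gg = generator_in_generators
  have X: "X \<in> \<Gamma>" and w: "W Xs \<in> \<V> (int (length Xs))" using Cons.prems V_W by auto
  let ?w = "W Xs"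
  note Dw = V_generator[OF gg w]
  have br_section: "generator (br (\<S> X) ?w) = br (\<S> X) (generator ?w) + br (of_fun (g X)) ?w"
    by (rule generator_br_section[OF _ X w]) (rule flat)
  have v1: "g X \<odot> ?w \<in> \<V> (int (length Xs))" by (rule V_mult[OF g_smooth[OF X] w])
  have v2: "br (\<S> X) ?w \<in> \<V> (int (length Xs))" by (rule V_br_section[OF X w])
  have v3: "\<S> X \<and>\<^sub>w generator ?w \<in> \<V> (int (length Xs))"
    using V_wedge[OF V_of_section[OF X] Dw] by simp
  have "generator (W (X # Xs)) = g X \<odot> ?w - br (\<S> X) ?w - \<S> X \<and>\<^sub>w generator ?w"
    using generator_section_wedge[OF gg X w] by (simp add: W_Cons generator_section[OF X] wedge_of_fun)
  then have "generator (generator (W (X # Xs))) =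
      generator (g X \<odot> ?w) - generator (br (\<S> X) ?w) - generator (\<S> X \<and>\<^sub>w generator ?w)"
    by (simp add: generator_diff[OF V_diff[OF v1 v2] v3] generator_diff[OF v1 v2])
  also have "\<dots> = 0"
    unfolding generator_mult[OF gg g_smooth[OF X] w] br_section
      generator_section_wedge[OF gg X Dw] generator_section[OF X] wedge_of_fun
    using Cons by simp
  finally show ?case .
qed

text \<open>The square of a generator is not function-linear a priori: its commutator with \<open>\<rho>\<close> is the
  operator \<open>N\<close> below. But \<open>N\<close> commutes with \<open>\<rho>\<close>, since \<open>[\<rho>, [\<rho>, s]] = 0\<close>, so the vanishing of the
  square at \<open>\<rho> s\<close> and at \<open>\<rho>\<^sup>2 s\<close> forces it to vanish at \<open>s\<close>.\<close>

lemma square_eq_0: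
  assumes flat: "\<And>X Y. X \<in> \<Gamma> \<Longrightarrow> Y \<in> \<Gamma> \<Longrightarrow> curv X Y = (\<lambda>x. 0)"
    and s: "s \<in> \<V> (int k)"
  shows "generator (generator s) = 0"
proof (cases k)
  case 0
  then have "generator s \<in> \<V> (-1)" using V_generator[OF generator_in_generators s] by simp
  then have "generator s = 0" by (intro V_neg[of "-1"]) simp_all
  then show ?thesis by (simp add: generator_0[OF generator_in_generators])
next
  case (Suc j)
  note gg = generator_in_generators
  show ?thesis
  proof (rule zero_by_germs)
    fix x
    obtain \<rho> G and S :: "nat list set" where \<rho>: "\<rho> \<in> \<R>" "\<rho> x \<noteq> 0" "finite S"
      "\<And>I. I \<in> S \<Longrightarrow> set (G I) \<subseteq> \<Gamma> \<and> length (G I) = Suc j" "\<rho> \<odot> s = (\<Sum>I\<in>S. W (G I))"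
      by (rule local_wedges[OF M vb s[unfolded Suc V_nat], where x = x]) blast
    have sq_sum: "generator (generator (\<Sum>I\<in>S. W (H I))) = 0"
      if "\<And>I. I \<in> S \<Longrightarrow> set (H I) \<subseteq> \<Gamma>" for H
    proof -
      have 1: "W (H I) \<in> multivecs M A" "generator (W (H I)) \<in> multivecs M A" if "I \<in> S" for I
        using multivecs_V V_W V_generator[OF gg] \<open>\<And>I. I \<in> S \<Longrightarrow> set (H I) \<subseteq> \<Gamma>\<close> that by blast+
      have "generator (generator (\<Sum>I\<in>S. W (H I))) = generator (\<Sum>I\<in>S. generator (W (H I)))"
        by (rule arg_cong[of _ _ generator], rule generator_sum[OF gg]) (rule 1)
      also have "\<dots> = (\<Sum>I\<in>S. generator (generator (W (H I))))"
        by (rule generator_sum[OF gg]) (rule 1)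
      also have "\<dots> = 0"
        by (rule sum.neutral, intro ballI square_W) (use flat that in auto)
      finally show ?thesis .
    qed
    let ?br = "br (of_fun \<rho>)"
    define N where "N u = ?br (generator u) + generator (?br u)" for u
    have sq: "generator (generator (\<rho> \<odot> u)) = \<rho> \<odot> generator (generator u) + N u" if u: "u \<in> \<V> p" for u p
    proof -
      note Du = V_generator[OF gg u]
      have "generator (\<rho> \<odot> generator u + ?br u) = generator (\<rho> \<odot> generator u) + generator (?br u)"
        by (rule generator_add[OF gg multivecs_V[OF V_mult[OF \<rho>(1) Du]] multivecs_V[OF V_br_fun[OF \<rho>(1) u]]])
      then show ?thesis
        unfolding generator_mult[OF gg \<rho>(1) u] generator_mult[OF gg \<rho>(1) Du] N_def by simp
    qed
    have brbr: "?br (?br u) = 0" if u: "u \<in> \<V> p" for u p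
    proof -
      have "?br (?br u) = br (?br (of_fun \<rho>)) u - ?br (?br u)"
        using br_jacobi[OF V_of_fun[OF \<rho>(1)] V_of_fun[OF \<rho>(1)] u] by simp
      also have "br (?br (of_fun \<rho>)) u = 0" using br_fun_fun[OF \<rho>(1) \<rho>(1)] br_0(2)[OF u] by simp
      finally have "2 *\<^sub>R ?br (?br u) = 0" by (simp add: scaleR_2 eq_neg_iff_add_eq_0)
      then show ?thesis by simp
    qed
    have Ncomm: "N (\<rho> \<odot> s) = \<rho> \<odot> N s"
    proof -
      note Ds = V_generator[OF gg s] and bs = V_br_fun[OF \<rho>(1) s]
      have b2: "generator (?br (\<rho> \<odot> s)) = \<rho> \<odot> generator (?br s)"
        unfolding br_fun_mult[OF \<rho>(1) \<rho>(1) s] generator_mult[OF gg \<rho>(1) bs] brbr[OF s] by simp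
      have "?br (generator (\<rho> \<odot> s)) = \<rho> \<odot> ?br (generator s)"
        unfolding generator_mult[OF gg \<rho>(1) s] br_add_right[OF V_of_fun[OF \<rho>(1)] V_mult[OF \<rho>(1) Ds] bs]
          br_fun_mult[OF \<rho>(1) \<rho>(1) Ds] brbr[OF s] by simp
      with b2 show ?thesis by (simp add: N_def fun_mult_simps)
    qed
    have E1: "generator (generator (\<rho> \<odot> s)) = 0" unfolding \<rho>(5) by (rule sq_sum) (use \<rho>(4) in blast)
    define H where "H I = (\<rho> \<odot> hd (G I)) # tl (G I)" for I
    have H: "set (H I) \<subseteq> \<Gamma>" "W (H I) = \<rho> \<odot> W (G I)" if IS: "I \<in> S" for I
    proof -
      obtain Y Ys where Y: "G I = Y # Ys" using \<rho>(4)[OF IS] by (cases "G I") auto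
      then have "Y \<in> \<Gamma>" "set Ys \<subseteq> \<Gamma>" using \<rho>(4)[OF IS] by auto
      then show "set (H I) \<subseteq> \<Gamma>" "W (H I) = \<rho> \<odot> W (G I)"
        by (auto simp: H_def Y \<Gamma>_mult \<rho>(1) W_Cons of_section_mult wedge_fun_mult)
    qed
    have mult_sum: "\<rho> \<odot> (\<Sum>I\<in>T. f I) = (\<Sum>I\<in>T. \<rho> \<odot> f I)" for T :: "nat list set" and f :: "_ \<Rightarrow> 'm \<Rightarrow> 'v ext"
      by (induction T rule: infinite_finite_induct) (simp_all add: fun_mult_simps)
    have "\<rho> \<odot> \<rho> \<odot> s = (\<Sum>I\<in>S. W (H I))"
      unfolding \<rho>(5) mult_sum by (rule sum.cong) (simp_all add: H)
    then have E2: "generator (generator (\<rho> \<odot> \<rho> \<odot> s)) = 0" using sq_sum[of H] H(1) by simp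
    have "\<rho> \<odot> N s = 0"
      using sq[OF V_mult[OF \<rho>(1) s]] E1 E2 Ncomm by (simp add: fun_mult_simps)
    moreover have "\<rho> \<odot> generator (generator s) = - N s"
      using sq[OF s] E1 by (simp add: eq_neg_iff_add_eq_0)
    ultimately have "\<rho> \<odot> \<rho> \<odot> generator (generator s) = 0" by (simp add: fun_mult_simps)
    then have "(\<rho> \<odot> \<rho> \<odot> generator (generator s)) x = 0 x" by (rule fun_cong)
    then show "\<exists>\<rho>. \<rho> x \<noteq> 0 \<and> \<rho> x *\<^sub>R generator (generator s) x = 0"
      using \<rho>(2) by (intro exI[of _ \<rho>]) (simp add: fun_mult_def zero_fun_apply)
  qed
qed

lemma flat_iff_BV: "flat M A (ext_power n A) nabla \<longleftrightarrow> generator \<in> BV_generators M A br"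
proof
  note gg = generator_in_generators
  assume "flat M A (ext_power n A) nabla"
  then have flat: "curv X Y = (\<lambda>x. 0)" if "X \<in> \<Gamma>" "Y \<in> \<Gamma>" for X Y using that flat_iff by blast
  have "generator (generator a) = 0" if a: "a \<in> multivecs M A" for a
  proof -
    note c = V_ext_component[OF a]
    have "generator (generator (\<Sum>k\<le>n. ext_component k a)) = (\<Sum>k\<le>n. generator (generator (ext_component k a)))"
      unfolding generator_sum[OF gg multivecs_V[OF c]]
        generator_sum[OF gg multivecs_V[OF V_generator[OF gg c]]] ..
    also have "\<dots> = 0" by (intro sum.neutral ballI square_eq_0[OF _ c]) (rule flat)
    finally show ?thesis using multivecs_expansion[OF a] by simp
  qed
  then show "generator \<in> BV_generators M A br" using gg by (simp add: BV_generators_def)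
next
  assume bv: "generator \<in> BV_generators M A br"
  have "curv X Y = (\<lambda>x. 0)" if X: "X \<in> \<Gamma>" and Y: "Y \<in> \<Gamma>" for X Y
  proof -
    have "\<S> X \<and>\<^sub>w \<S> Y \<in> multivecs M A"
      by (rule multivecs_V[OF V_wedge[OF V_of_section[OF X] V_of_section[OF Y]]])
    then have "generator (generator (\<S> X \<and>\<^sub>w \<S> Y)) = 0" using bv by (simp add: BV_generators_def)
    then have "(of_fun (curv X Y) :: 'm \<Rightarrow> 'v ext) = of_fun (\<lambda>x. 0)"
      using square_section_section[OF X Y] by (simp add: of_fun_simps)
    then show ?thesis by (simp only: of_fun_eq_iff)
  qed
  then show "flat M A (ext_power n A) nabla" using flat_iff by blast
qed

end


section \<open>The correspondence\<close>

context algebroid_bracket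
begin

text \<open>The connection has to be \<open>\<nabla>\<^sub>X \<Lambda> = L\<^sub>X \<Lambda> - (D X) \<Lambda>\<close>. Linearity over functions in \<open>X\<close> is the point at
  issue. The identity \<open>D (f X) = f D X + [f, X]\<close> contributes \<open>- [f, X] \<Lambda>\<close>, and the Lie derivative
  contributes \<open>X \<and> [f, \<Lambda>]\<close>. These cancel, since \<open>X \<and> \<Lambda> = 0\<close>.\<close>

lemma connection_of_generator:
  assumes D: "D \<in> generators"
  obtains nabla where "nabla \<in> connections M A (ext_power n A)"
    "generator_of_connection M n A br nabla D"
proof -
  have "\<exists>h. h \<in> \<R> \<and> D (of_section A X) = of_fun h" if "X \<in> \<Gamma>" for X
    using V_generator[OF D V_of_section[OF that]] V_0_of_fun by (metis diff_self)
  then obtain g where g: "\<And>X. X \<in> \<Gamma> \<Longrightarrow> g X \<in> \<R>" "\<And>X. X \<in> \<Gamma> \<Longrightarrow> D (of_section A X) = of_fun (g X)"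
    by metis
  define nab where "nab X \<Lambda> = br (of_section A X) \<Lambda> - g X \<odot> \<Lambda>" for X \<Lambda>
  define nabla where "nabla = (\<lambda>X\<in>\<Gamma>. \<lambda>\<Lambda>\<in>sections M (ext_power n A). nab X \<Lambda>)"
  have nabla: "nabla X \<Lambda> = nab X \<Lambda>" if "X \<in> \<Gamma>" "\<Lambda> \<in> \<V> (int n)" for X \<Lambda>
    using that by (simp add: nabla_def V_nat)
  have V_nab: "nab X \<Lambda> \<in> \<V> (int n)" if "X \<in> \<Gamma>" "\<Lambda> \<in> \<V> (int n)" for X \<Lambda>
    unfolding nab_def using that g by (intro V_diff V_br_section V_mult)
  have add_right: "nab X (\<Lambda> + \<Omega>) = nab X \<Lambda> + nab X \<Omega>"
    if "X \<in> \<Gamma>" "\<Lambda> \<in> \<V> (int n)" "\<Omega> \<in> \<V> (int n)" for X \<Lambda> \<Omega>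
    unfolding nab_def br_add_right[OF V_of_section[OF that(1)] that(2,3)] fun_mult_simps by simp
  have scale_right: "nab X (c *\<^sub>R \<Lambda>) = c *\<^sub>R nab X \<Lambda>" if "X \<in> \<Gamma>" "\<Lambda> \<in> \<V> (int n)" for X \<Lambda> c
    unfolding nab_def br_scale_right[OF V_of_section[OF that(1)] that(2)] fun_mult_simps
    by (simp add: scaleR_diff_right)
  have add_left: "nab (X + Y) \<Lambda> = nab X \<Lambda> + nab Y \<Lambda>"
    if "X \<in> \<Gamma>" "Y \<in> \<Gamma>" "\<Lambda> \<in> \<V> (int n)" for X Y \<Lambda>
  proof -
    have "(of_fun (g (X + Y)) :: 'm \<Rightarrow> 'v ext) = of_fun (\<lambda>x. g X x + g Y x)"
      using generator_add[OF D multivecs_V[OF V_of_section[OF that(1)]] multivecs_V[OF V_of_section[OF that(2)]]]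
        g(2)[OF that(1)] g(2)[OF that(2)] g(2)[OF \<Gamma>_add[OF that(1,2)]] that
      by (simp add: of_section_add of_fun_simps)
    then have "g (X + Y) = (\<lambda>x. g X x + g Y x)" by (simp only: of_fun_eq_iff)
    then have "g (X + Y) \<odot> \<Lambda> = g X \<odot> \<Lambda> + g Y \<odot> \<Lambda>"
      by (simp add: fun_mult_def plus_fun_def scaleR_add_left)
    then show ?thesis
      unfolding nab_def of_section_add[OF that(1,2)]
        br_add_left[OF that(3) V_of_section[OF that(1)] V_of_section[OF that(2)]] by simp
  qed
  have mult_left: "nab (f \<odot> X) \<Lambda> = f \<odot> nab X \<Lambda>"
    if f: "f \<in> \<R>" and X: "X \<in> \<Gamma>" and L: "\<Lambda> \<in> \<V> (int n)" for f X \<Lambda>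
  proof -
    note SX = V_of_section[OF X]
    have "(of_fun (g (f \<odot> X)) :: 'm \<Rightarrow> 'v ext) = of_fun (\<lambda>x. f x * g X x - anchor_act A X f x)"
      using generator_mult[OF D f SX] g(2)[OF X] g(2)[OF \<Gamma>_mult[OF f X]]
      by (simp add: of_section_mult X of_fun_mult br_fun_section f of_fun_simps)
    then have "g (f \<odot> X) = (\<lambda>x. f x * g X x - anchor_act A X f x)" by (simp only: of_fun_eq_iff)
    then have gf: "g (f \<odot> X) \<odot> \<Lambda> = f \<odot> g X \<odot> \<Lambda> - anchor_act A X f \<odot> \<Lambda>"
      by (intro ext) (simp add: fun_mult_def minus_apply scaleR_diff_left)
    \<comment> \<open>The product has degree \<open>n + 1\<close>.\<close>
    have "of_section A X \<and>\<^sub>w \<Lambda> = 0" using V_above_rank[OF V_wedge[OF SX L]] by simp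
    then have "br (of_fun f) (of_section A X) \<and>\<^sub>w \<Lambda> - of_section A X \<and>\<^sub>w br (of_fun f) \<Lambda> = 0"
      using br_fun_leibniz[OF f SX L] br_0(1)[OF V_of_fun[OF f]] by simp
    then have "of_section A X \<and>\<^sub>w br (of_fun f) \<Lambda> = - (anchor_act A X f \<odot> \<Lambda>)"
      by (simp add: br_fun_section X f wedge_minus wedge_of_fun)
    then show ?thesis
      unfolding nab_def of_section_mult[OF X] br_mult_left[OF f SX L] gf fun_mult_simps by simp
  qed
  have scale_left: "nab (c *\<^sub>R X) \<Lambda> = c *\<^sub>R nab X \<Lambda>" if "X \<in> \<Gamma>" "\<Lambda> \<in> \<V> (int n)" for c X \<Lambda>
  proof -
    have "(\<lambda>x. c) \<odot> u = c *\<^sub>R u" for u :: "'m \<Rightarrow> 'w::real_vector"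
      by (simp add: fun_mult_def scaleR_fun_def)
    then show ?thesis using mult_left[OF \<R>_closed(1) that, of c] by metis
  qed
  have mult_right: "nab X (f \<odot> \<Lambda>) = anchor_act A X f \<odot> \<Lambda> + f \<odot> nab X \<Lambda>"
    if f: "f \<in> \<R>" and X: "X \<in> \<Gamma>" and L: "\<Lambda> \<in> \<V> (int n)" for f X \<Lambda>
    unfolding nab_def br_mult_right[OF f V_of_section[OF X] L] br_fun_section[OF X f]
      fun_mult_commute[of "g X" f]
    by (simp add: wedge_minus wedge_of_fun fun_mult_simps)
  have conn: "nabla \<in> connections M A (ext_power n A)"
    unfolding connections_def mem_Collect_eq bilinear_on_subspaces_def linear_on_subspace_def
    using V_nab add_right scale_right add_left scale_left mult_left mult_right nabla
    by (intro conjI ballI allI)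
      (auto simp: nabla_def V_nat PiE_iff \<Gamma>_add \<Gamma>_mult \<Gamma>_scale ext_sections_add[OF M vb]
        ext_sections_scale[OF M vb] ext_sections_mult[OF M vb])
  have "generator_of_connection M n A br nabla D"
    unfolding generator_of_connection_def lie_deriv_def
  proof (intro conjI ballI)
    show "D (of_fun f) = 0" if "f \<in> \<R>" for f by (rule generator_fun[OF D that])
    show "\<exists>h\<in>\<R>. D (of_section A X) = of_fun h \<and>
        (\<forall>\<Lambda>\<in>sections M (ext_power n A). h \<odot> \<Lambda> = br (of_section A X) \<Lambda> - nabla X \<Lambda>)"
      if X: "X \<in> \<Gamma>" for X
      using g[OF X] nabla[OF X] by (intro bexI[of _ "g X"]) (auto simp: nab_def V_nat)
  qed (rule D)
  with conn show thesis by (rule that)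
qed

lemma connection_determined:
  assumes "nabla \<in> connections M A (ext_power n A)" "nabla' \<in> connections M A (ext_power n A)"
    and D: "generator_of_connection M n A br nabla D" "generator_of_connection M n A br nabla' D"
  shows "nabla = nabla'"
proof -
  have eq: "nabla X \<Lambda> = nabla' X \<Lambda>" if X: "X \<in> \<Gamma>" and L: "\<Lambda> \<in> sections M (ext_power n A)" for X \<Lambda>
  proof -
    obtain g where g: "D (of_section A X) = of_fun g" "g \<odot> \<Lambda> = br (of_section A X) \<Lambda> - nabla X \<Lambda>"
      using D(1) X L unfolding generator_of_connection_def lie_deriv_def by blast
    obtain g' where g': "D (of_section A X) = of_fun g'" "g' \<odot> \<Lambda> = br (of_section A X) \<Lambda> - nabla' X \<Lambda>"
      using D(2) X L unfolding generator_of_connection_def lie_deriv_def by blast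
    have "g = g'" using g(1) g'(1) by (simp add: of_fun_eq_iff)
    then show ?thesis using g(2) g'(2) by simp
  qed
  have P: "nabla \<in> (\<Pi>\<^sub>E X\<in>\<Gamma>. \<Pi>\<^sub>E s\<in>sections M (ext_power n A). sections M (ext_power n A))"
    "nabla' \<in> (\<Pi>\<^sub>E X\<in>\<Gamma>. \<Pi>\<^sub>E s\<in>sections M (ext_power n A). sections M (ext_power n A))"
    using assms(1,2) by (auto simp: connections_def)
  show ?thesis
  proof (rule PiE_ext[OF P])
    fix X assume X: "X \<in> \<Gamma>"
    show "nabla X = nabla' X"
      by (rule PiE_ext[OF PiE_mem[OF P(1) X] PiE_mem[OF P(2) X]]) (rule eq[OF X])
  qed
qed

end

theorem theorem3p1:
  fixes M :: "('m::{t2_space,second_countable_topology}, 'e::real_inner) atlas"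
    and A :: "('m, 'v::real_vector) algebroid"
    and n :: nat
    and br :: "('m \<Rightarrow> 'v ext) \<Rightarrow> ('m \<Rightarrow> 'v ext) \<Rightarrow> ('m \<Rightarrow> 'v ext)"
  assumes "smooth_manifold M"
    and "lie_algebroid M n A"
    and "schouten_bracket M A br"
  shows "(\<forall>nabla\<in>connections M A (ext_power n A). \<exists>!D. generator_of_connection M n A br nabla D) \<and>
    bij_betw (associated_generator M n A br)
      (connections M A (ext_power n A)) (gerstenhaber_generators M A br) \<and>
    (\<forall>nabla\<in>connections M A (ext_power n A).
      flat M A (ext_power n A) nabla \<longleftrightarrow> associated_generator M n A br nabla \<in> BV_generators M A br)"
proof -
  interpret algebroid_bracket M A n br
    using assms by unfold_locales
  let ?C = "connections M A (ext_power n A)" and ?assoc = "associated_generator M n A br"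
  have ex1: "\<exists>!D. generator_of_connection M n A br nabla D" if "nabla \<in> ?C" for nabla
  proof -
    obtain g where "top_connection M A n br nabla g" by (rule connection_divergence[OF \<open>nabla \<in> ?C\<close>])
    then interpret top_connection M A n br nabla g .
    show ?thesis using generator_of_connection_generator generator_of_connection_unique by blast
  qed
  have assoc: "generator_of_connection M n A br nabla (?assoc nabla)" if "nabla \<in> ?C" for nabla
    unfolding associated_generator_def by (rule theI'[OF ex1[OF that]])
  have "bij_betw ?assoc ?C generators"
    unfolding bij_betw_def
  proof (intro conjI inj_onI equalityI subsetI)
    show "nabla = nabla'" if "nabla \<in> ?C" "nabla' \<in> ?C" "?assoc nabla = ?assoc nabla'" for nabla nabla'
      using connection_determined[OF that(1,2) assoc[OF that(1)]] assoc[OF that(2)] that(3) by simp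
    show "D \<in> generators" if "D \<in> ?assoc ` ?C" for D
      using that assoc by (auto simp: generator_of_connection_def)
    show "D \<in> ?assoc ` ?C" if D: "D \<in> generators" for D
    proof -
      obtain nabla where n: "nabla \<in> ?C" "generator_of_connection M n A br nabla D"
        by (rule connection_of_generator[OF D])
      then have "D = ?assoc nabla" using ex1[OF n(1)] assoc[OF n(1)] by blast
      with n(1) show ?thesis by blast
    qed
  qed
  moreover have "flat M A (ext_power n A) nabla \<longleftrightarrow> ?assoc nabla \<in> BV_generators M A br"
    if "nabla \<in> ?C" for nabla
  proof -
    obtain g where "top_connection M A n br nabla g" by (rule connection_divergence[OF \<open>nabla \<in> ?C\<close>])
    then interpret top_connection M A n br nabla g .
    have "?assoc nabla = generator" by (rule generator_of_connection_unique[OF assoc[OF that]])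
    then show ?thesis using flat_iff_BV by simp
  qed
  ultimately show ?thesis using ex1 by blast
qed

end
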